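(* Let $R$ be a one-dimensional Gorenstein local domain, and let $M$ be a torsionfree finitely generated $R$-module such that $\operatorname{Ext}_R^1(M,M)=0$. If $M$ is an Ulrich $R$-module, then $M$ is free. (That is, the Huneke-Wiegand conjecture holds for Ulrich modules.)
   Context: All rings are commutative Noetherian with $1\ne 0$. A finitely generated module $M$ over a local ring $(R,\mathfrak m)$ is maximal Cohen-Macaulay if $\operatorname{depth}_R M=\dim R$ (the zero module has depth $+\infty$ and so is not maximal Cohen-Macaulay). $M$ is Ulrich if it is maximal Cohen-Macaulay and its minimal number of generators $\nu(M)$ equals its multiplicity $\mathrm e(M)$ with respect to $\mathfrak m$. *)

theory Defs
  imports Complex_Main "HOL-Library.Extended_Nat" "HOL-Algebra.Module"
    "HOL-Algebra.Ideal_Product" "HOL-Algebra.Ring_Divisibility"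
begin

section \<open>Submodules, quotients, generators, bases\<close>

definition gen_submodule ::
    "('a, 'm) ring_scheme \<Rightarrow> ('a, 'b, 'n) module_scheme \<Rightarrow> 'b set \<Rightarrow> 'b set" where
  "gen_submodule R M S = \<Inter>{N. submodule N R M \<and> S \<subseteq> N}"

definition ideal_smult ::
    "('a, 'm) ring_scheme \<Rightarrow> 'a set \<Rightarrow> ('a, 'b, 'n) module_scheme \<Rightarrow> 'b set" where
  "ideal_smult R I M = gen_submodule R M {r \<odot>\<^bsub>M\<^esub> x | r x. r \<in> I \<and> x \<in> carrier M}"

text \<open>The fields \<open>monoid.mult\<close> and \<open>one\<close> of a module record carry no meaning; they are left undefined
  in the constructions below.\<close>

definition quot_mod :: "('a, 'b, 'n) module_scheme \<Rightarrow> 'b set \<Rightarrow> ('a, 'b set) module" where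
  "quot_mod M N =
    \<lparr>carrier = a_rcosets\<^bsub>M\<^esub> N, monoid.mult = undefined, one = undefined, zero = N,
     add = set_add M, smult = (\<lambda>r C. \<Union>x\<in>C. N +>\<^bsub>M\<^esub> (r \<odot>\<^bsub>M\<^esub> x))\<rparr>"

definition zero_mod :: "('a, 'b, 'n) module_scheme \<Rightarrow> bool" where
  "zero_mod M \<longleftrightarrow> carrier M = {\<zero>\<^bsub>M\<^esub>}"

definition fin_gen :: "('a, 'm) ring_scheme \<Rightarrow> ('a, 'b, 'n) module_scheme \<Rightarrow> bool" where
  "fin_gen R M \<longleftrightarrow> (\<exists>S. finite S \<and> S \<subseteq> carrier M \<and> gen_submodule R M S = carrier M)"

definition min_gens :: "('a, 'm) ring_scheme \<Rightarrow> ('a, 'b, 'n) module_scheme \<Rightarrow> nat" where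
  "min_gens R M =
    (LEAST n. \<exists>S. finite S \<and> card S = n \<and> S \<subseteq> carrier M \<and> gen_submodule R M S = carrier M)"

definition lin_indep ::
    "('a, 'm) ring_scheme \<Rightarrow> ('a, 'b, 'n) module_scheme \<Rightarrow> 'b set \<Rightarrow> bool" where
  "lin_indep R M B \<longleftrightarrow>
    (\<forall>A c. finite A \<and> A \<subseteq> B \<and> c \<in> A \<rightarrow> carrier R \<and> (\<Oplus>\<^bsub>M\<^esub>b\<in>A. c b \<odot>\<^bsub>M\<^esub> b) = \<zero>\<^bsub>M\<^esub>
      \<longrightarrow> (\<forall>b\<in>A. c b = \<zero>\<^bsub>R\<^esub>))"

definition free_mod :: "('a, 'm) ring_scheme \<Rightarrow> ('a, 'b, 'n) module_scheme \<Rightarrow> bool" where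
  "free_mod R M \<longleftrightarrow> (\<exists>B \<subseteq> carrier M. lin_indep R M B \<and> gen_submodule R M B = carrier M)"

text \<open>For modules over a domain.\<close>

definition torsionfree :: "('a, 'm) ring_scheme \<Rightarrow> ('a, 'b, 'n) module_scheme \<Rightarrow> bool" where
  "torsionfree R M \<longleftrightarrow>
    (\<forall>r\<in>carrier R. \<forall>x\<in>carrier M. r \<odot>\<^bsub>M\<^esub> x = \<zero>\<^bsub>M\<^esub> \<longrightarrow> r = \<zero>\<^bsub>R\<^esub> \<or> x = \<zero>\<^bsub>M\<^esub>)"

definition length_mod :: "('a, 'm) ring_scheme \<Rightarrow> ('a, 'b, 'n) module_scheme \<Rightarrow> enat" where
  "length_mod R M =
    Sup {enat n | n. \<exists>N :: nat \<Rightarrow> 'b set.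
           (\<forall>i\<le>n. submodule (N i) R M) \<and> (\<forall>i<n. N i \<subset> N (Suc i))}"


section \<open>Local rings, dimension, depth, multiplicity\<close>

definition noetherian_local :: "('a, 'm) ring_scheme \<Rightarrow> bool" where
  "noetherian_local R \<longleftrightarrow> cring R \<and> noetherian_ring R \<and> (\<exists>!I. maximalideal I R)"

definition max_ideal :: "('a, 'm) ring_scheme \<Rightarrow> 'a set" where
  "max_ideal R = (THE I. maximalideal I R)"

definition ideal_power :: "('a, 'm) ring_scheme \<Rightarrow> 'a set \<Rightarrow> nat \<Rightarrow> 'a set" where
  "ideal_power R I n = (ideal_prod R I ^^ n) (carrier R)"

definition krull_dim :: "('a, 'm) ring_scheme \<Rightarrow> enat" where
  "krull_dim R =
    Sup {enat n | n. \<exists>P :: nat \<Rightarrow> 'a set.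
           (\<forall>i\<le>n. primeideal (P i) R) \<and> (\<forall>i<n. P i \<subset> P (Suc i))}"

definition nonzerodivisor_on :: "'a \<Rightarrow> ('a, 'b, 'n) module_scheme \<Rightarrow> bool" where
  "nonzerodivisor_on r M \<longleftrightarrow> (\<forall>x\<in>carrier M. r \<odot>\<^bsub>M\<^esub> x = \<zero>\<^bsub>M\<^esub> \<longrightarrow> x = \<zero>\<^bsub>M\<^esub>)"

definition regular_seq ::
    "('a, 'm) ring_scheme \<Rightarrow> ('a, 'b, 'n) module_scheme \<Rightarrow> 'a list \<Rightarrow> bool" where
  "regular_seq R M rs \<longleftrightarrow> set rs \<subseteq> carrier R
    \<and> (\<forall>i<length rs. nonzerodivisor_on (rs ! i)
          (quot_mod M (ideal_smult R (Idl\<^bsub>R\<^esub> (set (take i rs))) M)))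
    \<and> \<not> zero_mod (quot_mod M (ideal_smult R (Idl\<^bsub>R\<^esub> (set rs)) M))"

definition depth_mod :: "('a, 'm) ring_scheme \<Rightarrow> ('a, 'b, 'n) module_scheme \<Rightarrow> enat" where
  "depth_mod R M =
    (if zero_mod M then \<infinity>
     else Sup {enat (length rs) | rs. set rs \<subseteq> max_ideal R \<and> regular_seq R M rs})"

definition max_CM :: "('a, 'm) ring_scheme \<Rightarrow> ('a, 'b, 'n) module_scheme \<Rightarrow> bool" where
  "max_CM R M \<longleftrightarrow> module R M \<and> fin_gen R M \<and> depth_mod R M = krull_dim R"

text \<open>With \<open>d = dim R\<close> and \<open>\<mm>\<close> the maximal ideal, the multiplicity is
  \<open>lim\<^sub>n d! \<cdot> length(M / \<mm>\<^sup>n M) / n\<^sup>d\<close>; for a maximal Cohen-Macaulay module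
  this agrees with the normalization by \<open>dim M\<close>.\<close>

definition multiplicity_mod :: "('a, 'm) ring_scheme \<Rightarrow> ('a, 'b, 'n) module_scheme \<Rightarrow> real" where
  "multiplicity_mod R M =
    (let d = the_enat (krull_dim R) in
     lim (\<lambda>n. fact d / real n ^ d *
       real (the_enat (length_mod R
         (quot_mod M (ideal_smult R (ideal_power R (max_ideal R) n) M))))))"

definition ulrich :: "('a, 'm) ring_scheme \<Rightarrow> ('a, 'b, 'n) module_scheme \<Rightarrow> bool" where
  "ulrich R M \<longleftrightarrow> max_CM R M \<and> real (min_gens R M) = multiplicity_mod R M"


section \<open>Homomorphisms and Ext\<close>

text \<open>Homomorphisms are extensional, so that equality of homomorphisms is equality in HOL.\<close>

definition mod_homs ::
    "('a, 'm) ring_scheme \<Rightarrow> ('a, 'b, 'n) module_scheme \<Rightarrow> ('a, 'c, 'o) module_scheme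
      \<Rightarrow> ('b \<Rightarrow> 'c) set" where
  "mod_homs R M N = {f \<in> carrier M \<rightarrow>\<^sub>E carrier N.
     (\<forall>x\<in>carrier M. \<forall>y\<in>carrier M. f (x \<oplus>\<^bsub>M\<^esub> y) = f x \<oplus>\<^bsub>N\<^esub> f y) \<and>
     (\<forall>r\<in>carrier R. \<forall>x\<in>carrier M. f (r \<odot>\<^bsub>M\<^esub> x) = r \<odot>\<^bsub>N\<^esub> f x)}"

definition Hom_mod ::
    "('a, 'm) ring_scheme \<Rightarrow> ('a, 'b, 'n) module_scheme \<Rightarrow> ('a, 'c, 'o) module_scheme
      \<Rightarrow> ('a, 'b \<Rightarrow> 'c) module" where
  "Hom_mod R M N =
    \<lparr>carrier = mod_homs R M N, monoid.mult = undefined, one = undefined,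
     zero = (\<lambda>x\<in>carrier M. \<zero>\<^bsub>N\<^esub>),
     add = (\<lambda>f g. \<lambda>x\<in>carrier M. f x \<oplus>\<^bsub>N\<^esub> g x),
     smult = (\<lambda>r f. \<lambda>x\<in>carrier M. r \<odot>\<^bsub>N\<^esub> f x)\<rparr>"

definition mod_ker ::
    "('a, 'b, 'n) module_scheme \<Rightarrow> ('a, 'c, 'o) module_scheme \<Rightarrow> ('b \<Rightarrow> 'c) \<Rightarrow> 'b set" where
  "mod_ker M N f = {x \<in> carrier M. f x = \<zero>\<^bsub>N\<^esub>}"

text \<open>\<open>\<cdots> \<rightarrow> P 2 \<rightarrow> P 1 \<rightarrow> P 0 \<rightarrow> M \<rightarrow> 0\<close> with differentials \<open>d i : P (i + 1) \<rightarrow> P i\<close> and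
  augmentation \<open>\<epsilon>\<close>.\<close>

definition free_resolution ::
    "('a, 'm) ring_scheme \<Rightarrow> ('a, 'b, 'n) module_scheme
      \<Rightarrow> (nat \<Rightarrow> ('a, 'p) module) \<Rightarrow> (nat \<Rightarrow> 'p \<Rightarrow> 'p) \<Rightarrow> ('p \<Rightarrow> 'b) \<Rightarrow> bool" where
  "free_resolution R M P d \<epsilon> \<longleftrightarrow>
    (\<forall>i. module R (P i) \<and> free_mod R (P i)) \<and>
    (\<forall>i. d i \<in> mod_homs R (P (Suc i)) (P i)) \<and> \<epsilon> \<in> mod_homs R (P 0) M \<and>
    \<epsilon> ` carrier (P 0) = carrier M \<and>
    d 0 ` carrier (P 1) = mod_ker (P 0) M \<epsilon> \<and>
    (\<forall>i. d (Suc i) ` carrier (P (Suc (Suc i))) = mod_ker (P (Suc i)) (P i) (d i))"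

text \<open>The cohomology modules of the complex \<open>Hom(P, N)\<close>.\<close>

definition cocycles ::
    "('a, 'm) ring_scheme \<Rightarrow> (nat \<Rightarrow> ('a, 'p) module) \<Rightarrow> (nat \<Rightarrow> 'p \<Rightarrow> 'p)
      \<Rightarrow> ('a, 'c, 'o) module_scheme \<Rightarrow> nat \<Rightarrow> ('p \<Rightarrow> 'c) set" where
  "cocycles R P d N n = {f \<in> mod_homs R (P n) N. \<forall>x\<in>carrier (P (Suc n)). f (d n x) = \<zero>\<^bsub>N\<^esub>}"

definition coboundaries ::
    "('a, 'm) ring_scheme \<Rightarrow> (nat \<Rightarrow> ('a, 'p) module) \<Rightarrow> (nat \<Rightarrow> 'p \<Rightarrow> 'p)
      \<Rightarrow> ('a, 'c, 'o) module_scheme \<Rightarrow> nat \<Rightarrow> ('p \<Rightarrow> 'c) set" where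
  "coboundaries R P d N n =
    (case n of 0 \<Rightarrow> {\<lambda>x\<in>carrier (P 0). \<zero>\<^bsub>N\<^esub>}
     | Suc k \<Rightarrow> (\<lambda>g. \<lambda>x\<in>carrier (P (Suc k)). g (d k x)) ` mod_homs R (P k) N)"

definition Hom_cohomology ::
    "('a, 'm) ring_scheme \<Rightarrow> (nat \<Rightarrow> ('a, 'p) module) \<Rightarrow> (nat \<Rightarrow> 'p \<Rightarrow> 'p)
      \<Rightarrow> ('a, 'c, 'o) module_scheme \<Rightarrow> nat \<Rightarrow> ('a, ('p \<Rightarrow> 'c) set) module" where
  "Hom_cohomology R P d N n =
    quot_mod ((Hom_mod R (P n) N)\<lparr>carrier := cocycles R P d N n\<rparr>) (coboundaries R P d N n)"

text \<open>\<open>Ext\<^sup>n(M, N)\<close> is computed from a chosen free resolution of \<open>M\<close>; up to isomorphism the choice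
  is irrelevant. The terms of the resolution have elements in \<^typ>\<open>nat \<Rightarrow> 'a\<close>, which has room for
  every \<open>R\<^sup>k\<close>; thus a resolution of this kind exists whenever \<open>R\<close> is Noetherian and \<open>M\<close> is finitely
  generated, and \<open>Ext_mod\<close> is meant to be used only under these assumptions.\<close>

definition Ext_mod ::
    "('a, 'm) ring_scheme \<Rightarrow> nat \<Rightarrow> ('a, 'b, 'n) module_scheme \<Rightarrow> ('a, 'c, 'o) module_scheme
      \<Rightarrow> ('a, ((nat \<Rightarrow> 'a) \<Rightarrow> 'c) set) module" where
  "Ext_mod R n M N =
    (let (P, d) = (SOME (P, d). \<exists>\<epsilon>. free_resolution R M P d \<epsilon>) in Hom_cohomology R P d N n)"


section \<open>Gorenstein local rings\<close>

text \<open>Injectivity is tested on all monomorphisms between modules whose elements live in the same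
  type \<open>'e\<close> as those of \<open>E\<close>. As soon as \<open>'e\<close> has room for a copy of \<open>R\<close>, the inclusions of ideals
  into \<open>R\<close> are among them, so that by Baer's criterion this is injectivity in the usual sense.\<close>

definition injective_mod :: "('a, 'm) ring_scheme \<Rightarrow> ('a, 'e) module \<Rightarrow> bool" where
  "injective_mod R E \<longleftrightarrow> module R E \<and>
    (\<forall>(A :: ('a, 'e) module) (B :: ('a, 'e) module). module R A \<and> module R B \<longrightarrow>
      (\<forall>j \<in> mod_homs R A B. inj_on j (carrier A) \<longrightarrow>
        (\<forall>f \<in> mod_homs R A E. \<exists>g \<in> mod_homs R B E. \<forall>x\<in>carrier A. g (j x) = f x)))"

text \<open>\<open>0 \<rightarrow> M \<rightarrow> E 0 \<rightarrow> E 1 \<rightarrow> \<cdots>\<close> with coaugmentation \<open>\<eta>\<close> and \<open>\<delta> i : E i \<rightarrow> E (i + 1)\<close>.\<close>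

definition injective_resolution ::
    "('a, 'm) ring_scheme \<Rightarrow> ('a, 'b, 'n) module_scheme
      \<Rightarrow> (nat \<Rightarrow> ('a, 'e) module) \<Rightarrow> (nat \<Rightarrow> 'e \<Rightarrow> 'e) \<Rightarrow> ('b \<Rightarrow> 'e) \<Rightarrow> bool" where
  "injective_resolution R M E \<delta> \<eta> \<longleftrightarrow>
    (\<forall>i. injective_mod R (E i)) \<and>
    (\<forall>i. \<delta> i \<in> mod_homs R (E i) (E (Suc i))) \<and> \<eta> \<in> mod_homs R M (E 0) \<and>
    inj_on \<eta> (carrier M) \<and>
    \<eta> ` carrier M = mod_ker (E 0) (E 1) (\<delta> 0) \<and>
    (\<forall>i. \<delta> i ` carrier (E i) = mod_ker (E (Suc i)) (E (Suc (Suc i))) (\<delta> (Suc i)))"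

definition regular_mod :: "('a, 'm) ring_scheme \<Rightarrow> ('a, 'a) module" where
  "regular_mod R =
    \<lparr>carrier = carrier R, monoid.mult = monoid.mult R, one = one R, zero = zero R, add = add R, smult = monoid.mult R\<rparr>"

text \<open>A Noetherian local ring is Gorenstein if it has finite injective dimension as a module over
  itself. The terms of the resolution have elements in \<^typ>\<open>nat \<Rightarrow> 'a\<close>. This is no restriction:
  the injective hulls occurring in the minimal injective resolution of an infinite Noetherian
  ring \<open>R\<close> of finite injective dimension have at most the cardinality of \<open>R\<close>, and a finite
  Gorenstein local ring is its own injective hull.\<close>

definition gorenstein_local :: "('a, 'm) ring_scheme \<Rightarrow> bool" where
  "gorenstein_local R \<longleftrightarrow> noetherian_local R \<and>
    (\<exists>(E :: nat \<Rightarrow> ('a, nat \<Rightarrow> 'a) module) \<delta> \<eta> n.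
       injective_resolution R (regular_mod R) E \<delta> \<eta> \<and> (\<forall>i>n. zero_mod (E i)))"

end

theory Submission
  imports Defs
begin

text \<open>
  Let \<open>\<mm>\<close> be the maximal ideal. Over an infinite residue field, \<open>\<mm> M = x M\<close> for some \<open>x \<in> \<mm>\<close> whenever
  \<open>M\<close> is Ulrich. The following argument replaces this and works for every residue field.

  Call a submodule of \<open>M\<close> a lattice if it contains \<open>r M\<close> for some \<open>r \<noteq> 0\<close>, and let \<open>\<nu>\<close> be the minimal
  number of generators. If \<open>\<nu>\<close> is maximal at a lattice \<open>A\<close>, then \<open>\<nu>(\<mm> A) = \<nu>(A)\<close>, by an argument of
  Petridis on sumsets. Hence the length of \<open>A / \<mm>\<^sup>n A\<close> is \<open>n \<nu>(A)\<close>, so the multiplicity of \<open>M\<close> is the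
  maximum of \<open>\<nu>\<close> over all lattices, and \<open>M\<close> is Ulrich exactly if this maximum is attained at \<open>M\<close>
  itself. In this case the same argument for socles instead of generators yields \<open>x \<in> \<mm>\<close> and a lattice
  \<open>D\<close> with \<open>\<mm> D = x M\<close>.

  Since \<open>Ext\<^sup>1(M, x M) = 0\<close>, all homomorphisms from \<open>M\<close> to \<open>D / x M\<close> lift to \<open>D\<close>. Let \<open>I\<close> be the ideal of
  coefficients of the relations between minimal generators of \<open>M\<close>. Lifting the homomorphisms that
  send one generator to an arbitrary element and the others to \<open>0\<close> gives \<open>I D \<subseteq> I x M = \<mm> I D\<close>. By
  Nakayama's lemma \<open>I D = 0\<close>, so \<open>I = 0\<close> and \<open>M\<close> is free.
\<close>

text \<open>Maximality of nu acts through one inequality. If A' \<subseteq> A are lattices with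
  nu(A') \<le> nu(A), counting the length of A / \<mm> A' once through A' and once through \<mm> A
  gives len(\<mm> A / \<mm> A') \<le> len(A / A'). Adding a generator c of \<mm> to a partial
  product I A enlarges it by a copy of A / A', where A' consists of the a in A with c a in I A,
  while \<mm> I A grows by a quotient of \<mm> A / \<mm> A'. So nu cannot drop.

  Boundedness of nu is a rigidity of length: for nonzero a in \<mm>, the quotients A / a A and M / a
  M have equal length, and the former maps onto A / \<mm> A.

  For socles, let tau(A) be the length of (A : \<mm>) / A. Since \<mm> (A : \<mm>) \<subseteq> A,
  tau is bounded by the maximum of nu. If M attains this maximum, then A = x \<mm> M has maximal tau
  and A : \<mm> = x M. Maximality of tau passes on to x M, which leaves no room between \<mm> D and
  x M for D = x M : \<mm>.

  The equation \<mm> D = x M replaces \<mm> M = x M: it rewrites I x M as \<mm> I D.\<close>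

section \<open>Submodules\<close>

context module
begin

abbreviation sub :: "'c set \<Rightarrow> bool" where "sub A \<equiv> submodule A R M"

lemma sub_carrier: "sub A \<Longrightarrow> x \<in> A \<Longrightarrow> x \<in> carrier M"
  using submoduleE(1) by blast

lemma sub_zero [simp]: "sub A \<Longrightarrow> \<zero>\<^bsub>M\<^esub> \<in> A"
  using subgroup.one_closed[OF submodule.axioms(1)] by fastforce

lemma sub_add: "sub A \<Longrightarrow> x \<in> A \<Longrightarrow> y \<in> A \<Longrightarrow> x \<oplus>\<^bsub>M\<^esub> y \<in> A"
  by (rule submoduleE(5))

lemma sub_smult: "sub A \<Longrightarrow> r \<in> carrier R \<Longrightarrow> x \<in> A \<Longrightarrow> r \<odot>\<^bsub>M\<^esub> x \<in> A"
  by (rule submoduleE(4))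

lemma sub_neg: "sub A \<Longrightarrow> x \<in> A \<Longrightarrow> \<ominus>\<^bsub>M\<^esub> x \<in> A"
  by (rule submoduleE(3))

lemma sub_minus: "sub A \<Longrightarrow> x \<in> A \<Longrightarrow> y \<in> A \<Longrightarrow> x \<ominus>\<^bsub>M\<^esub> y \<in> A"
  by (simp add: a_minus_def sub_add sub_neg)

lemma sub_add_cancel:
  assumes "sub A" "x \<in> A" "y \<in> carrier M" "x \<oplus>\<^bsub>M\<^esub> y \<in> A"
  shows "y \<in> A"
proof -
  have "y = (\<ominus>\<^bsub>M\<^esub> x) \<oplus>\<^bsub>M\<^esub> (x \<oplus>\<^bsub>M\<^esub> y)"
    using assms sub_carrier by (simp add: M.r_neg1)
  then show ?thesis using assms sub_add sub_neg by metis
qed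

lemma subI:
  assumes "H \<subseteq> carrier M" "\<zero>\<^bsub>M\<^esub> \<in> H"
    and "\<And>a b. a \<in> H \<Longrightarrow> b \<in> H \<Longrightarrow> a \<oplus>\<^bsub>M\<^esub> b \<in> H"
    and "\<And>a x. a \<in> carrier R \<Longrightarrow> x \<in> H \<Longrightarrow> a \<odot>\<^bsub>M\<^esub> x \<in> H"
  shows "sub H"
proof (rule submoduleI)
  fix a assume a: "a \<in> H"
  have "\<ominus>\<^bsub>M\<^esub> a = (\<ominus> \<one>) \<odot>\<^bsub>M\<^esub> a"
    using a assms(1) by (subst smult_l_minus) auto
  then show "\<ominus>\<^bsub>M\<^esub> a \<in> H" using assms(4) a by simp
qed (use assms in auto)

lemma sub_inter: "sub A \<Longrightarrow> sub B \<Longrightarrow> sub (A \<inter> B)"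
  by (rule subI) (auto simp: sub_add sub_smult dest: sub_carrier)

lemma sub_set_add:
  assumes "sub A" "sub B"
  shows "sub (A <+>\<^bsub>M\<^esub> B)"
proof (rule subI)
  show "A <+>\<^bsub>M\<^esub> B \<subseteq> carrier M"
    using assms by (auto simp: set_add_def' dest: sub_carrier)
  show "\<zero>\<^bsub>M\<^esub> \<in> A <+>\<^bsub>M\<^esub> B"
    using assms by (auto simp: set_add_def' intro!: bexI[of _ "\<zero>\<^bsub>M\<^esub>"])
next
  fix u v assume "u \<in> A <+>\<^bsub>M\<^esub> B" "v \<in> A <+>\<^bsub>M\<^esub> B"
  then obtain a b a' b' where *: "a \<in> A" "b \<in> B" "a' \<in> A" "b' \<in> B" "u = a \<oplus>\<^bsub>M\<^esub> b" "v = a' \<oplus>\<^bsub>M\<^esub> b'"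
    by (auto simp: set_add_def')
  then have "u \<oplus>\<^bsub>M\<^esub> v = (a \<oplus>\<^bsub>M\<^esub> a') \<oplus>\<^bsub>M\<^esub> (b \<oplus>\<^bsub>M\<^esub> b')"
    using assms sub_carrier M.add.m_ac by (smt (verit) M.add.m_closed)
  then show "u \<oplus>\<^bsub>M\<^esub> v \<in> A <+>\<^bsub>M\<^esub> B"
    using * assms unfolding set_add_def' by (auto intro: sub_add)
next
  fix r u assume r: "r \<in> carrier R" and "u \<in> A <+>\<^bsub>M\<^esub> B"
  then obtain a b where *: "a \<in> A" "b \<in> B" "u = a \<oplus>\<^bsub>M\<^esub> b"
    by (auto simp: set_add_def')
  then have "r \<odot>\<^bsub>M\<^esub> u = r \<odot>\<^bsub>M\<^esub> a \<oplus>\<^bsub>M\<^esub> r \<odot>\<^bsub>M\<^esub> b"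
    using assms sub_carrier smult_r_distr r by auto
  then show "r \<odot>\<^bsub>M\<^esub> u \<in> A <+>\<^bsub>M\<^esub> B"
    using * assms r unfolding set_add_def' by (auto intro: sub_smult)
qed

lemma set_add_memI: "a \<in> A \<Longrightarrow> b \<in> B \<Longrightarrow> a \<oplus>\<^bsub>M\<^esub> b \<in> A <+>\<^bsub>M\<^esub> B"
  by (auto simp: set_add_def')

lemma set_add_memE:
  assumes "u \<in> A <+>\<^bsub>M\<^esub> B" obtains a b where "a \<in> A" "b \<in> B" "u = a \<oplus>\<^bsub>M\<^esub> b"
  using assms by (auto simp: set_add_def')

lemma set_add_upper1: "sub A \<Longrightarrow> sub B \<Longrightarrow> A \<subseteq> A <+>\<^bsub>M\<^esub> B"
  by (metis M.r_zero set_add_memI sub_carrier sub_zero subsetI)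

lemma set_add_upper2: "sub A \<Longrightarrow> sub B \<Longrightarrow> B \<subseteq> A <+>\<^bsub>M\<^esub> B"
  by (metis M.l_zero set_add_memI sub_carrier sub_zero subsetI)

lemma set_add_least: "sub C \<Longrightarrow> A \<subseteq> C \<Longrightarrow> B \<subseteq> C \<Longrightarrow> A <+>\<^bsub>M\<^esub> B \<subseteq> C"
  by (auto simp: set_add_def' sub_add subset_iff)

lemma set_add_mono: "A \<subseteq> A' \<Longrightarrow> B \<subseteq> B' \<Longrightarrow> A <+>\<^bsub>M\<^esub> B \<subseteq> A' <+>\<^bsub>M\<^esub> B'"
  by (auto simp: set_add_def')

lemma set_add_absorb: "sub A \<Longrightarrow> sub B \<Longrightarrow> B \<subseteq> A \<Longrightarrow> A <+>\<^bsub>M\<^esub> B = A"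
  by (simp add: set_add_least set_add_upper1 subset_antisym)

definition scale :: "'a \<Rightarrow> 'c set \<Rightarrow> 'c set" where
  "scale c A = (\<lambda>x. c \<odot>\<^bsub>M\<^esub> x) ` A"

lemma sub_scale:
  assumes "c \<in> carrier R" "sub A" shows "sub (scale c A)"
proof (rule subI)
  show "\<zero>\<^bsub>M\<^esub> \<in> scale c A"
    unfolding scale_def using assms by (intro image_eqI[of _ _ "\<zero>\<^bsub>M\<^esub>"]) auto
next
  fix u v assume "u \<in> scale c A" "v \<in> scale c A"
  then obtain a b where *: "a \<in> A" "b \<in> A" "u = c \<odot>\<^bsub>M\<^esub> a" "v = c \<odot>\<^bsub>M\<^esub> b"
    by (auto simp: scale_def)
  then show "u \<oplus>\<^bsub>M\<^esub> v \<in> scale c A"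
    unfolding scale_def using assms sub_carrier smult_r_distr
    by (intro image_eqI[of _ _ "a \<oplus>\<^bsub>M\<^esub> b"]) (auto intro: sub_add)
next
  fix r u assume r: "r \<in> carrier R" and "u \<in> scale c A"
  then obtain a where *: "a \<in> A" "u = c \<odot>\<^bsub>M\<^esub> a"
    by (auto simp: scale_def)
  then have "r \<odot>\<^bsub>M\<^esub> u = c \<odot>\<^bsub>M\<^esub> (r \<odot>\<^bsub>M\<^esub> a)"
    using assms sub_carrier r by (metis R.m_comm smult_assoc1)
  then show "r \<odot>\<^bsub>M\<^esub> u \<in> scale c A"
    unfolding scale_def using assms r * by (auto intro: sub_smult)
qed (use assms sub_carrier in \<open>auto simp: scale_def\<close>)

lemma scale_le: "c \<in> carrier R \<Longrightarrow> sub A \<Longrightarrow> scale c A \<subseteq> A"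
  by (auto simp: scale_def intro: sub_smult)

lemma scale_mono: "A \<subseteq> B \<Longrightarrow> scale c A \<subseteq> scale c B"
  by (auto simp: scale_def)

lemma scale_scale:
  assumes "c \<in> carrier R" "d \<in> carrier R" "A \<subseteq> carrier M"
  shows "scale c (scale d A) = scale (c \<otimes> d) A"
  using assms unfolding scale_def image_image
  by (intro image_cong) (auto simp: smult_assoc1)

text \<open>The kernel of multiplication by c from X to M / Y, when X and Y are submodules.\<close>

definition preim :: "'a \<Rightarrow> 'c set \<Rightarrow> 'c set \<Rightarrow> 'c set" where
  "preim c X Y = {v \<in> X. c \<odot>\<^bsub>M\<^esub> v \<in> Y}"

lemma sub_preim:
  assumes "c \<in> carrier R" "sub X" "sub Y" shows "sub (preim c X Y)"
proof (rule subI)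
  fix r u assume "r \<in> carrier R" "u \<in> preim c X Y"
  then have "c \<odot>\<^bsub>M\<^esub> (r \<odot>\<^bsub>M\<^esub> u) = r \<odot>\<^bsub>M\<^esub> (c \<odot>\<^bsub>M\<^esub> u)"
    using assms sub_carrier by (metis (no_types, lifting) R.m_comm mem_Collect_eq preim_def smult_assoc1)
  then show "r \<odot>\<^bsub>M\<^esub> u \<in> preim c X Y"
    using \<open>r \<in> carrier R\<close> \<open>u \<in> preim c X Y\<close> assms by (auto simp: preim_def intro: sub_smult)
qed (use assms sub_carrier in \<open>auto simp: preim_def smult_r_distr intro: sub_add\<close>)


section \<open>Lengths of intervals of submodules\<close>

text \<open>Only the end points and the number of steps of a chain are recorded. All lengths are
  taken of intervals inside one ambient module, so that quotient modules first appear when the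
  multiplicity is computed.\<close>

inductive chn :: "'c set \<Rightarrow> 'c set \<Rightarrow> nat \<Rightarrow> bool" for B where
  base: "sub B \<Longrightarrow> chn B B 0"
| step: "chn B A n \<Longrightarrow> sub A' \<Longrightarrow> A \<subset> A' \<Longrightarrow> chn B A' (Suc n)"

lemma chn_sub: "chn B A n \<Longrightarrow> sub B \<and> sub A \<and> B \<subseteq> A"
  by (induction rule: chn.induct) auto

lemma chn_trans: "chn B A n \<Longrightarrow> chn C B m \<Longrightarrow> chn C A (m + n)"
  by (induction rule: chn.induct) (auto intro: chn.intros)

lemma chn_one: "sub B \<Longrightarrow> sub A \<Longrightarrow> B \<subset> A \<Longrightarrow> chn B A 1"
  using chn.step[OF chn.base] by simp

lemma chn_ex: "sub B \<Longrightarrow> sub A \<Longrightarrow> B \<subseteq> A \<Longrightarrow> \<exists>n. chn B A n"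
  using chn.base chn_one by (metis psubsetI)

text \<open>The modular law: if x in A' equals a + b with a in A and b in B, then b lies in A'
  \<inter> B = A \<inter> B, so x lies in A.\<close>

lemma modular_strict:
  assumes "sub A" "sub A'" "sub B" "A \<subset> A'"
    and "A \<inter> B = A' \<inter> B"
  shows "A <+>\<^bsub>M\<^esub> B \<subset> A' <+>\<^bsub>M\<^esub> B"
proof
  show "A <+>\<^bsub>M\<^esub> B \<subseteq> A' <+>\<^bsub>M\<^esub> B" using assms by (intro set_add_mono) auto
  obtain x where x: "x \<in> A'" "x \<notin> A" using assms by blast
  have "x \<notin> A <+>\<^bsub>M\<^esub> B"
  proof
    assume "x \<in> A <+>\<^bsub>M\<^esub> B"
    then obtain a b where ab: "a \<in> A" "b \<in> B" "x = a \<oplus>\<^bsub>M\<^esub> b" by (rule set_add_memE)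
    then have "b \<in> A'" using x assms sub_add_cancel[of A' a b] sub_carrier by blast
    then show False using ab x assms sub_add by blast
  qed
  then show "A <+>\<^bsub>M\<^esub> B \<noteq> A' <+>\<^bsub>M\<^esub> B" using set_add_upper1[OF assms(2,3)] x by blast
qed

text \<open>By \<open>modular_strict\<close>, each step of the chain survives in the intersections
  with B or in the sums with B. This is the hard half of the additivity of length.\<close>

lemma chn_split:
  "chn C A n \<Longrightarrow> sub B \<Longrightarrow> C \<subseteq> B \<Longrightarrow>
    \<exists>p q. chn C (A \<inter> B) p \<and> chn B (A <+>\<^bsub>M\<^esub> B) q \<and> n \<le> p + q"
proof (induction rule: chn.induct)
  case base
  have "C <+>\<^bsub>M\<^esub> B = B" "C \<inter> B = C"
    using base set_add_least[of B C B] set_add_upper2[of C B] by auto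
  then show ?case using base chn.base by (intro exI[of _ 0]) auto
next
  case (step A n A')
  then obtain p q where pq: "chn C (A \<inter> B) p" "chn B (A <+>\<^bsub>M\<^esub> B) q" "n \<le> p + q" by blast
  have sA: "sub A" using step.hyps chn_sub by blast
  have s: "sub (A' \<inter> B)" "sub (A' <+>\<^bsub>M\<^esub> B)" "A <+>\<^bsub>M\<^esub> B \<subseteq> A' <+>\<^bsub>M\<^esub> B" "A \<inter> B \<subseteq> A' \<inter> B"
    using step sA sub_inter sub_set_add set_add_mono[of A A' B B] by auto
  show ?case
  proof (cases "A \<inter> B = A' \<inter> B")
    case True
    then have "A <+>\<^bsub>M\<^esub> B \<subset> A' <+>\<^bsub>M\<^esub> B"
      by (rule modular_strict[OF sA step.hyps(2) step.prems(1) step.hyps(3)])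
    then have "chn B (A' <+>\<^bsub>M\<^esub> B) (Suc q)"
      by (rule chn.step[OF pq(2) s(2)])
    then show ?thesis using pq True by (intro exI[of _ p] exI[of _ "Suc q"]) auto
  next
    case False
    then have 1: "chn C (A' \<inter> B) (Suc p)"
      using s(4) by (intro chn.step[OF pq(1) s(1)]) auto
    obtain q' where "chn B (A' <+>\<^bsub>M\<^esub> B) q'" "q \<le> q'"
    proof (cases "A <+>\<^bsub>M\<^esub> B = A' <+>\<^bsub>M\<^esub> B")
      case False
      then have "chn B (A' <+>\<^bsub>M\<^esub> B) (Suc q)"
        using s(3) by (intro chn.step[OF pq(2) s(2)]) auto
      then show ?thesis using that by fastforce
    qed (use pq that in auto)
    then show ?thesis using 1 pq by (intro exI[of _ "Suc p"] exI[of _ q']) auto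
  qed
qed

section \<open>Intervals of finite length\<close>

definition fl :: "'c set \<Rightarrow> 'c set \<Rightarrow> bool" where
  "fl B A \<longleftrightarrow> sub B \<and> sub A \<and> B \<subseteq> A \<and> (\<exists>K. \<forall>n. chn B A n \<longrightarrow> n \<le> K)"

text \<open>Meaningful only under \<open>fl\<close>: without a bound on the chains,
  \<open>GREATEST\<close> is unspecified.\<close>

definition len :: "'c set \<Rightarrow> 'c set \<Rightarrow> nat" where
  "len B A = (GREATEST n. chn B A n)"

lemma fl_sub: "fl B A \<Longrightarrow> sub B" "fl B A \<Longrightarrow> sub A" "fl B A \<Longrightarrow> B \<subseteq> A"
  by (auto simp: fl_def)

lemma chn_len: assumes "fl B A" shows "chn B A (len B A)"
proof -
  obtain K where "\<forall>n. chn B A n \<longrightarrow> n \<le> K" using assms fl_def by auto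
  moreover obtain n where "chn B A n" using assms chn_ex fl_def by blast
  ultimately show ?thesis unfolding len_def by (metis GreatestI_nat)
qed

lemma len_upper: assumes "fl B A" "chn B A n" shows "n \<le> len B A"
proof -
  obtain K where "\<forall>n. chn B A n \<longrightarrow> n \<le> K" using assms fl_def by auto
  then show ?thesis unfolding len_def using assms(2) by (metis Greatest_le_nat)
qed

lemma len_leI: "sub B \<Longrightarrow> sub A \<Longrightarrow> B \<subseteq> A \<Longrightarrow> (\<And>n. chn B A n \<Longrightarrow> n \<le> K) \<Longrightarrow> fl B A \<and> len B A \<le> K"
  using chn_len fl_def by blast

lemma fl_refl: assumes "sub A" shows "fl A A" "len A A = 0"
proof -
  have "n \<le> 0" if "chn A A n" for n
    using that by (cases rule: chn.cases) (auto dest: chn_sub)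
  then show "fl A A" "len A A = 0" using len_leI[of A A 0] assms by auto
qed

lemma len_0: assumes "fl B A" "len B A = 0" shows "A = B"
proof (rule ccontr)
  assume "A \<noteq> B"
  then have "chn B A 1" using chn_one[of B A] fl_sub[OF assms(1)] by blast
  then show False using len_upper[OF assms(1), of 1] assms(2) by simp
qed

lemma len_add:
  assumes "fl C B" "fl B A"
  shows "fl C A" "len C A = len C B + len B A"
proof -
  have s: "sub A" "sub B" "sub C" "C \<subseteq> B" "B \<subseteq> A" using assms fl_sub by auto
  have up: "n \<le> len C B + len B A" if ch: "chn C A n" for n
  proof -
    obtain p q where "chn C (A \<inter> B) p" "chn B (A <+>\<^bsub>M\<^esub> B) q" "n \<le> p + q"
      using chn_split[OF ch] s by blast
    moreover have "A \<inter> B = B" "A <+>\<^bsub>M\<^esub> B = A" using s set_add_absorb by auto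
    ultimately show ?thesis using len_upper[OF assms(1), of p] len_upper[OF assms(2), of q] by simp
  qed
  then show 1: "fl C A" using len_leI[of C A] s by auto
  show "len C A = len C B + len B A"
    using up[OF chn_len[OF 1]] len_upper[OF 1 chn_trans[OF chn_len[OF assms(2)] chn_len[OF assms(1)]]]
    by simp
qed

lemma fl_parts:
  assumes "fl C A" "sub B" "C \<subseteq> B" "B \<subseteq> A"
  shows "fl C B" "fl B A"
proof -
  obtain m where m: "chn C B m" using assms chn_ex fl_sub by blast
  obtain n where n: "chn B A n" using assms chn_ex fl_sub by blast
  have "k \<le> len C A" if "chn C B k" for k
    using len_upper[OF assms(1) chn_trans[OF n that]] by simp
  then show "fl C B" using assms fl_sub len_leI by metis
  have "k \<le> len C A" if "chn B A k" for k
    using len_upper[OF assms(1) chn_trans[OF that m]] by simp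
  then show "fl B A" using assms fl_sub len_leI by metis
qed

lemma len_split:
  assumes "fl C A" "sub B" "C \<subseteq> B" "B \<subseteq> A"
  shows "len C A = len C B + len B A"
  using len_add fl_parts assms by blast

text \<open>Strictness survives because c z' = y + c z puts z' - z into \<open>preim c X Y\<close>,
  which lies below every member of the chain.\<close>

lemma chn_push:
  assumes "c \<in> carrier R" "sub X" "sub Y"
  shows "chn (preim c X Y) Z n \<Longrightarrow> Z \<subseteq> X \<Longrightarrow> chn Y (Y <+>\<^bsub>M\<^esub> scale c Z) n"
proof (induction rule: chn.induct)
  case base
  have "scale c (preim c X Y) \<subseteq> Y" by (auto simp: scale_def preim_def)
  then have "Y <+>\<^bsub>M\<^esub> scale c (preim c X Y) = Y"
    using assms base sub_scale set_add_absorb by metis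
  then show ?case using chn.base assms by simp
next
  case (step Z n Z')
  have sZ: "sub Z" "preim c X Y \<subseteq> Z" using step.hyps chn_sub by auto
  have s: "sub (Y <+>\<^bsub>M\<^esub> scale c Z)" "sub (Y <+>\<^bsub>M\<^esub> scale c Z')"
    using step sZ assms sub_scale sub_set_add by auto
  have le: "Y <+>\<^bsub>M\<^esub> scale c Z \<subseteq> Y <+>\<^bsub>M\<^esub> scale c Z'"
    using step by (intro set_add_mono scale_mono) auto
  obtain z' where z': "z' \<in> Z'" "z' \<notin> Z" using step by blast
  have "c \<odot>\<^bsub>M\<^esub> z' \<notin> Y <+>\<^bsub>M\<^esub> scale c Z"
  proof
    assume "c \<odot>\<^bsub>M\<^esub> z' \<in> Y <+>\<^bsub>M\<^esub> scale c Z"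
    then obtain y z where yz: "y \<in> Y" "z \<in> Z" "c \<odot>\<^bsub>M\<^esub> z' = y \<oplus>\<^bsub>M\<^esub> c \<odot>\<^bsub>M\<^esub> z"
      by (auto elim!: set_add_memE simp: scale_def)
    have c: "y \<in> carrier M" "z \<in> carrier M" "z' \<in> carrier M" "z \<in> X" "z' \<in> X"
      using yz z' sZ assms step sub_carrier by blast+
    then have "c \<odot>\<^bsub>M\<^esub> (z' \<ominus>\<^bsub>M\<^esub> z) = c \<odot>\<^bsub>M\<^esub> z' \<ominus>\<^bsub>M\<^esub> c \<odot>\<^bsub>M\<^esub> z"
      using assms by (simp add: a_minus_def smult_r_distr smult_r_minus)
    also have "\<dots> = y" using yz c assms(1) by (simp add: a_minus_def M.a_assoc M.r_neg)
    finally have "z' \<ominus>\<^bsub>M\<^esub> z \<in> Z" using sZ(2) yz c assms sub_minus by (auto simp: preim_def)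
    then have "z \<oplus>\<^bsub>M\<^esub> (z' \<ominus>\<^bsub>M\<^esub> z) \<in> Z" using yz sZ sub_add by blast
    moreover have "z \<oplus>\<^bsub>M\<^esub> (z' \<ominus>\<^bsub>M\<^esub> z) = z'" using c
      by (metis M.add.inv_closed M.a_comm M.l_neg M.r_zero a_minus_def M.a_assoc)
    ultimately show False using z' by simp
  qed
  moreover have "c \<odot>\<^bsub>M\<^esub> z' \<in> Y <+>\<^bsub>M\<^esub> scale c Z'"
    using set_add_upper2[of Y "scale c Z'"] step assms sub_scale z' by (auto simp: scale_def)
  ultimately have "Y <+>\<^bsub>M\<^esub> scale c Z \<subset> Y <+>\<^bsub>M\<^esub> scale c Z'" using le by blast
  then show ?case using step s by (intro chn.step[where A="Y <+>\<^bsub>M\<^esub> scale c Z"]) auto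
qed

text \<open>Modulo Y every element of Y + c X is a multiple c x, so an element separating W from W'
  yields an x separating the preimages.\<close>

lemma chn_pull:
  assumes "c \<in> carrier R" "sub X" "sub Y"
  shows "chn Y W n \<Longrightarrow> W \<subseteq> Y <+>\<^bsub>M\<^esub> scale c X \<Longrightarrow> chn (preim c X Y) (preim c X W) n"
proof (induction rule: chn.induct)
  case base
  show ?case using chn.base sub_preim assms by simp
next
  case (step W n W')
  have sW: "sub W" "Y \<subseteq> W" using step.hyps chn_sub by auto
  obtain w where w: "w \<in> W'" "w \<notin> W" using step by blast
  obtain y x where yx: "y \<in> Y" "x \<in> X" "w = y \<oplus>\<^bsub>M\<^esub> c \<odot>\<^bsub>M\<^esub> x"
    using step.prems w by (force elim!: set_add_memE simp: scale_def)
  have "c \<odot>\<^bsub>M\<^esub> x \<in> W'"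
    using sub_add_cancel[of W' y "c \<odot>\<^bsub>M\<^esub> x"] w yx step sW assms sub_carrier by blast
  moreover have "c \<odot>\<^bsub>M\<^esub> x \<notin> W" using w yx sW sub_add by blast
  ultimately have "preim c X W \<subset> preim c X W'"
    using step yx by (auto simp: preim_def)
  then show ?case using step sub_preim assms by (intro chn.step[where A="preim c X W"]) auto
qed

lemma preim_push:
  assumes "c \<in> carrier R" "sub X" "sub Y"
  shows "preim c X (Y <+>\<^bsub>M\<^esub> scale c X) = X"
proof -
  have "scale c X \<subseteq> Y <+>\<^bsub>M\<^esub> scale c X" using set_add_upper2 sub_scale assms by auto
  then show ?thesis by (auto simp: preim_def scale_def)
qed

text \<open>Multiplication by \<open>c\<close> induces an isomorphism from \<open>X / (Y : c)\<close> onto \<open>(Y + c X) / Y\<close>.\<close>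

lemma len_push:
  assumes "c \<in> carrier R" "sub X" "sub Y" "fl (preim c X Y) X"
  shows "fl Y (Y <+>\<^bsub>M\<^esub> scale c X)" "len Y (Y <+>\<^bsub>M\<^esub> scale c X) = len (preim c X Y) X"
proof -
  have s: "sub (Y <+>\<^bsub>M\<^esub> scale c X)" "Y \<subseteq> Y <+>\<^bsub>M\<^esub> scale c X"
    using assms sub_set_add sub_scale set_add_upper1 by auto
  have up: "n \<le> len (preim c X Y) X" if "chn Y (Y <+>\<^bsub>M\<^esub> scale c X) n" for n
    using chn_pull[OF assms(1-3) that] preim_push[OF assms(1-3)] len_upper[OF assms(4)] by simp
  show 1: "fl Y (Y <+>\<^bsub>M\<^esub> scale c X)" using len_leI[OF assms(3) s up] by simp
  show "len Y (Y <+>\<^bsub>M\<^esub> scale c X) = len (preim c X Y) X"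
    using up[OF chn_len[OF 1]] len_upper[OF 1 chn_push[OF assms(1-3) chn_len[OF assms(4)] order.refl]]
    by simp
qed

end


section \<open>Generators and products with ideals\<close>

context module
begin

abbreviation gen :: "'c set \<Rightarrow> 'c set" where "gen S \<equiv> gen_submodule R M S"

lemma gen_sub: "S \<subseteq> carrier M \<Longrightarrow> sub (gen S)"
proof (rule subI)
  assume S: "S \<subseteq> carrier M"
  show "gen S \<subseteq> carrier M"
    unfolding gen_submodule_def using S carrier_is_submodule by blast
qed (auto simp: gen_submodule_def intro: sub_add sub_smult)

lemma gen_incl: "S \<subseteq> gen S"
  unfolding gen_submodule_def by blast

lemma gen_least: "sub N \<Longrightarrow> S \<subseteq> N \<Longrightarrow> gen S \<subseteq> N"
  unfolding gen_submodule_def by blast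

lemma gen_mono: "S \<subseteq> T \<Longrightarrow> gen S \<subseteq> gen T"
  unfolding gen_submodule_def by blast

lemma gen_id: "sub N \<Longrightarrow> gen N = N"
  using gen_least gen_incl by blast

lemma sub_trivial: "sub {\<zero>\<^bsub>M\<^esub>}"
  by (rule subI) auto

lemma gen_empty: "gen {} = {\<zero>\<^bsub>M\<^esub>}"
  using gen_least[OF sub_trivial, of "{}"] sub_zero[OF gen_sub, of "{}"] by auto

lemma gen_Un:
  assumes "S \<subseteq> carrier M" "T \<subseteq> carrier M"
  shows "gen (S \<union> T) = gen S <+>\<^bsub>M\<^esub> gen T"
proof
  have s: "sub (gen S)" "sub (gen T)" using assms gen_sub by auto
  show "gen (S \<union> T) \<subseteq> gen S <+>\<^bsub>M\<^esub> gen T"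
    using set_add_upper1[OF s] set_add_upper2[OF s] gen_incl[of S] gen_incl[of T]
    by (intro gen_least sub_set_add s) blast
  show "gen S <+>\<^bsub>M\<^esub> gen T \<subseteq> gen (S \<union> T)"
    using assms by (intro set_add_least gen_sub gen_mono) auto
qed

definition cyc :: "'c \<Rightarrow> 'c set" where
  "cyc x = (\<lambda>r. r \<odot>\<^bsub>M\<^esub> x) ` carrier R"

lemma sub_cyc:
  assumes "x \<in> carrier M" shows "sub (cyc x)"
proof (rule subI)
  show "\<zero>\<^bsub>M\<^esub> \<in> cyc x"
    unfolding cyc_def using assms by (intro image_eqI[of _ _ \<zero>]) auto
next
  fix u v assume "u \<in> cyc x" "v \<in> cyc x"
  then show "u \<oplus>\<^bsub>M\<^esub> v \<in> cyc x"
    using assms by (auto simp: cyc_def smult_l_distr[symmetric])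
next
  fix r u assume "r \<in> carrier R" "u \<in> cyc x"
  then show "r \<odot>\<^bsub>M\<^esub> u \<in> cyc x"
    using assms by (auto simp: cyc_def smult_assoc1[symmetric])
qed (use assms in \<open>auto simp: cyc_def\<close>)

lemma cyc_self: "x \<in> carrier M \<Longrightarrow> x \<in> cyc x"
  unfolding cyc_def by (intro image_eqI[of _ _ \<one>]) auto

lemma cyc_least: "sub N \<Longrightarrow> x \<in> N \<Longrightarrow> cyc x \<subseteq> N"
  by (auto simp: cyc_def intro: sub_smult)

lemma gen_singleton: "x \<in> carrier M \<Longrightarrow> gen {x} = cyc x"
  by (intro subset_antisym gen_least cyc_least sub_cyc gen_sub)
     (use cyc_self gen_incl in auto)

lemma gen_insert:
  assumes "x \<in> carrier M" "S \<subseteq> carrier M"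
  shows "gen (insert x S) = gen S <+>\<^bsub>M\<^esub> cyc x"
  using gen_Un[OF assms(2), of "{x}"] assms by (simp add: gen_singleton)

text \<open>I need not be an ideal. This permits inductions over a finite generating set of \<mm>;
  \<open>sprod_Idl\<close> returns to the ideal itself.\<close>

definition sprod :: "'a set \<Rightarrow> 'c set \<Rightarrow> 'c set" where
  "sprod I A = gen {r \<odot>\<^bsub>M\<^esub> x | r x. r \<in> I \<and> x \<in> A}"

lemma sprod_sub: "I \<subseteq> carrier R \<Longrightarrow> A \<subseteq> carrier M \<Longrightarrow> sub (sprod I A)"
  unfolding sprod_def by (rule gen_sub) auto

lemma sub_subset: "sub A \<Longrightarrow> A \<subseteq> carrier M"
  by (rule submoduleE(1))

lemma sprod_sub': "I \<subseteq> carrier R \<Longrightarrow> sub A \<Longrightarrow> sub (sprod I A)"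
  by (intro sprod_sub sub_subset)

lemma sprod_memI: "r \<in> I \<Longrightarrow> x \<in> A \<Longrightarrow> r \<odot>\<^bsub>M\<^esub> x \<in> sprod I A"
  unfolding sprod_def by (rule subsetD[OF gen_incl]) blast

lemma sprod_least: "sub C \<Longrightarrow> (\<And>r x. r \<in> I \<Longrightarrow> x \<in> A \<Longrightarrow> r \<odot>\<^bsub>M\<^esub> x \<in> C) \<Longrightarrow> sprod I A \<subseteq> C"
  unfolding sprod_def by (rule gen_least) auto

lemma sprod_mono: "I \<subseteq> J \<Longrightarrow> A \<subseteq> B \<Longrightarrow> sprod I A \<subseteq> sprod J B"
  unfolding sprod_def by (rule gen_mono) blast

lemma sprod_le: "I \<subseteq> carrier R \<Longrightarrow> sub A \<Longrightarrow> sprod I A \<subseteq> A"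
  by (rule sprod_least) (auto intro: sub_smult)

lemma sprod_set_add:
  assumes "I \<subseteq> carrier R" "sub A" "sub B"
  shows "sprod I (A <+>\<^bsub>M\<^esub> B) = sprod I A <+>\<^bsub>M\<^esub> sprod I B"
proof
  have c: "A \<subseteq> carrier M" "B \<subseteq> carrier M" using assms sub_carrier by auto
  have s: "sub (sprod I A)" "sub (sprod I B)" "sub (sprod I (A <+>\<^bsub>M\<^esub> B))"
    using assms by (auto intro!: sprod_sub' sub_set_add)
  show "sprod I (A <+>\<^bsub>M\<^esub> B) \<subseteq> sprod I A <+>\<^bsub>M\<^esub> sprod I B"
  proof (rule sprod_least[OF sub_set_add[OF s(1,2)]])
    fix r x assume r: "r \<in> I" and "x \<in> A <+>\<^bsub>M\<^esub> B"
    then obtain a b where ab: "a \<in> A" "b \<in> B" "x = a \<oplus>\<^bsub>M\<^esub> b" by (rule_tac set_add_memE)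
    then have "r \<odot>\<^bsub>M\<^esub> x = r \<odot>\<^bsub>M\<^esub> a \<oplus>\<^bsub>M\<^esub> r \<odot>\<^bsub>M\<^esub> b"
      using r assms c smult_r_distr by (simp add: subset_iff)
    then show "r \<odot>\<^bsub>M\<^esub> x \<in> sprod I A <+>\<^bsub>M\<^esub> sprod I B"
      using r ab by (auto intro: set_add_memI sprod_memI)
  qed
  show "sprod I A <+>\<^bsub>M\<^esub> sprod I B \<subseteq> sprod I (A <+>\<^bsub>M\<^esub> B)"
    using set_add_upper1[OF assms(2,3)] set_add_upper2[OF assms(2,3)]
    by (intro set_add_least s sprod_mono) auto
qed

lemma sprod_scale:
  assumes "I \<subseteq> carrier R" "sub A" "c \<in> carrier R"
  shows "sprod I (scale c A) = scale c (sprod I A)"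
proof
  have c: "A \<subseteq> carrier M" using assms sub_carrier by auto
  have s: "sub (sprod I A)" using assms by (auto intro!: sprod_sub')
  have s': "sub (sprod I (scale c A))"
    using assms by (auto intro!: sprod_sub' sub_scale)
  have comm: "r \<odot>\<^bsub>M\<^esub> (c \<odot>\<^bsub>M\<^esub> a) = c \<odot>\<^bsub>M\<^esub> (r \<odot>\<^bsub>M\<^esub> a)" if "r \<in> I" "a \<in> A" for r a
    using that assms c by (metis R.m_comm smult_assoc1 subsetD)
  show "sprod I (scale c A) \<subseteq> scale c (sprod I A)"
    using comm by (intro sprod_least sub_scale assms s) (auto simp: scale_def intro!: imageI sprod_memI)
  have "sprod I A \<subseteq> preim c (carrier M) (sprod I (scale c A))"
  proof (rule sprod_least[OF sub_preim[OF assms(3) carrier_is_submodule s']])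
    fix r a assume "r \<in> I" "a \<in> A"
    then show "r \<odot>\<^bsub>M\<^esub> a \<in> preim c (carrier M) (sprod I (scale c A))"
      unfolding preim_def using comm[of r a] assms c
      by (auto simp: scale_def subset_iff comm[symmetric] intro!: sprod_memI)
  qed
  then show "scale c (sprod I A) \<subseteq> sprod I (scale c A)"
    by (auto simp: scale_def preim_def)
qed

lemma sprod_empty: "sprod {} A = {\<zero>\<^bsub>M\<^esub>}"
  by (simp add: sprod_def gen_empty)

lemma sprod_insert:
  assumes "I \<subseteq> carrier R" "sub A" "c \<in> carrier R"
  shows "sprod (insert c I) A = sprod I A <+>\<^bsub>M\<^esub> scale c A"
proof
  have s: "sub (sprod I A)" "sub (scale c A)" "sub (sprod (insert c I) A)"
    using assms by (auto intro!: sprod_sub' sub_scale)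
  show "sprod (insert c I) A \<subseteq> sprod I A <+>\<^bsub>M\<^esub> scale c A"
  proof (rule sprod_least[OF sub_set_add[OF s(1,2)]])
    fix r x assume "r \<in> insert c I" "x \<in> A"
    then have "r \<odot>\<^bsub>M\<^esub> x \<in> sprod I A \<union> scale c A"
      by (auto simp: scale_def intro: sprod_memI)
    then show "r \<odot>\<^bsub>M\<^esub> x \<in> sprod I A <+>\<^bsub>M\<^esub> scale c A"
      using set_add_upper1[OF s(1,2)] set_add_upper2[OF s(1,2)] by blast
  qed
  have "scale c A \<subseteq> sprod (insert c I) A" by (auto simp: scale_def intro: sprod_memI)
  then show "sprod I A <+>\<^bsub>M\<^esub> scale c A \<subseteq> sprod (insert c I) A"
    by (intro set_add_least s sprod_mono) auto
qed

text \<open>Serves to extend an inclusion from generators of an ideal to the whole ideal, by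
  minimality of \<open>Idl\<close>.\<close>

lemma multiplier_ideal:
  assumes "A \<subseteq> carrier M" "sub C"
  shows "ideal {r \<in> carrier R. \<forall>x\<in>A. r \<odot>\<^bsub>M\<^esub> x \<in> C} R"
proof (rule idealI)
  show "ring R" by (rule R.ring_axioms)
  show "subgroup {r \<in> carrier R. \<forall>x\<in>A. r \<odot>\<^bsub>M\<^esub> x \<in> C} (add_monoid R)"
    using assms by (intro R.add.subgroupI)
      (auto simp: smult_l_distr subset_iff smult_l_minus a_inv_def[of R, symmetric] intro: sub_add sub_neg)
next
  fix a x assume a: "a \<in> {r \<in> carrier R. \<forall>x\<in>A. r \<odot>\<^bsub>M\<^esub> x \<in> C}" and x: "x \<in> carrier R"
  then show 1: "x \<otimes> a \<in> {r \<in> carrier R. \<forall>x\<in>A. r \<odot>\<^bsub>M\<^esub> x \<in> C}"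
    using assms by (auto simp: subset_iff smult_assoc1 intro: sub_smult)
  then show "a \<otimes> x \<in> {r \<in> carrier R. \<forall>x\<in>A. r \<odot>\<^bsub>M\<^esub> x \<in> C}"
    using a x by (simp add: R.m_comm)
qed

lemma sprod_Idl:
  assumes "C \<subseteq> carrier R" "A \<subseteq> carrier M"
  shows "sprod (Idl\<^bsub>R\<^esub> C) A = sprod C A"
proof
  have "Idl\<^bsub>R\<^esub> C \<subseteq> {r \<in> carrier R. \<forall>x\<in>A. r \<odot>\<^bsub>M\<^esub> x \<in> sprod C A}"
    using assms by (intro R.genideal_minimal multiplier_ideal sprod_sub) (auto intro: sprod_memI)
  then show "sprod (Idl\<^bsub>R\<^esub> C) A \<subseteq> sprod C A"
    using assms by (intro sprod_least sprod_sub) auto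
  show "sprod C A \<subseteq> sprod (Idl\<^bsub>R\<^esub> C) A"
    using R.genideal_self[OF assms(1)] by (intro sprod_mono) auto
qed

lemma sprod_ideal_prod:
  assumes "ideal I R" "ideal J R" "A \<subseteq> carrier M"
  shows "sprod (I \<cdot>\<^bsub>R\<^esub> J) A = sprod I (sprod J A)"
proof
  have I: "I \<subseteq> carrier R" "J \<subseteq> carrier R"
    using ideal.Icarr[OF assms(1)] ideal.Icarr[OF assms(2)] by auto
  have s: "sub (sprod J A)" using I assms sprod_sub by auto
  have s': "sub (sprod I (sprod J A))" using I s sprod_sub' by auto
  have s'': "sub (sprod (I \<cdot>\<^bsub>R\<^esub> J) A)"
    using R.ideal_prod_in_carrier[OF assms(1,2)] assms(3) by (rule sprod_sub)
  have "I \<cdot>\<^bsub>R\<^esub> J \<subseteq> {r \<in> carrier R. \<forall>x\<in>A. r \<odot>\<^bsub>M\<^esub> x \<in> sprod I (sprod J A)}"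
  proof
    fix r assume "r \<in> I \<cdot>\<^bsub>R\<^esub> J"
    then show "r \<in> {r \<in> carrier R. \<forall>x\<in>A. r \<odot>\<^bsub>M\<^esub> x \<in> sprod I (sprod J A)}"
      using I assms(3) by (induction rule: ideal_prod.induct)
        (auto simp: subset_iff smult_assoc1 smult_l_distr intro: sprod_memI sub_add[OF s'])
  qed
  then show "sprod (I \<cdot>\<^bsub>R\<^esub> J) A \<subseteq> sprod I (sprod J A)"
    using s' by (intro sprod_least) auto
  show "sprod I (sprod J A) \<subseteq> sprod (I \<cdot>\<^bsub>R\<^esub> J) A"
  proof (rule sprod_least[OF s''])
    fix r y assume r: "r \<in> I" and y: "y \<in> sprod J A"
    have "sprod J A \<subseteq> preim r (carrier M) (sprod (I \<cdot>\<^bsub>R\<^esub> J) A)"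
    proof (rule sprod_least[OF sub_preim[OF _ carrier_is_submodule s'']])
      show "r \<in> carrier R" using r I by auto
      fix j x assume jx: "j \<in> J" "x \<in> A"
      then have "r \<odot>\<^bsub>M\<^esub> (j \<odot>\<^bsub>M\<^esub> x) = (r \<otimes> j) \<odot>\<^bsub>M\<^esub> x"
        using r I assms(3) by (auto simp: subset_iff smult_assoc1)
      also have "\<dots> \<in> sprod (I \<cdot>\<^bsub>R\<^esub> J) A"
        using r jx by (intro sprod_memI ideal_prod.prod)
      finally show "j \<odot>\<^bsub>M\<^esub> x \<in> preim r (carrier M) (sprod (I \<cdot>\<^bsub>R\<^esub> J) A)"
        using jx I assms(3) by (auto simp: preim_def subset_iff)
    qed
    then show "r \<odot>\<^bsub>M\<^esub> y \<in> sprod (I \<cdot>\<^bsub>R\<^esub> J) A" using y by (auto simp: preim_def)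
  qed
qed

lemma sprod_carrier: "sub A \<Longrightarrow> sprod (carrier R) A = A"
proof
  assume A: "sub A"
  show "sprod (carrier R) A \<subseteq> A" using A by (intro sprod_le) auto
  show "A \<subseteq> sprod (carrier R) A"
  proof
    fix x assume "x \<in> A"
    then have "\<one> \<odot>\<^bsub>M\<^esub> x \<in> sprod (carrier R) A" by (intro sprod_memI) auto
    then show "x \<in> sprod (carrier R) A" using \<open>x \<in> A\<close> A sub_carrier by simp
  qed
qed

section \<open>Submodules of finitely generated modules over a Noetherian ring\<close>

definition fg :: "'c set \<Rightarrow> bool" where
  "fg N \<longleftrightarrow> (\<exists>S. finite S \<and> S \<subseteq> carrier M \<and> gen S = N)"

text \<open>Splitting off one generator x, N is controlled by two pieces: N \<inter>
  \<open>gen S\<close>, finitely generated by induction, and the ideal of all r for which r x agrees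
  with an element of N modulo \<open>gen S\<close>. Generators of this ideal are lifted to elements
  \<open>n t\<close> of N.\<close>

lemma sub_of_gen_fg:
  assumes noeth: "noetherian_ring R"
  shows "finite S \<Longrightarrow> S \<subseteq> carrier M \<Longrightarrow> sub N \<Longrightarrow> N \<subseteq> gen S \<Longrightarrow> fg N"
proof (induction S arbitrary: N rule: finite_induct)
  case empty
  then have "N = {\<zero>\<^bsub>M\<^esub>}" using gen_empty sub_zero by blast
  then show ?case using gen_empty fg_def by blast
next
  case (insert x S)
  have x: "x \<in> carrier M" and S: "S \<subseteq> carrier M" using insert by auto
  have sS: "sub (gen S)" using S gen_sub by auto
  let ?J = "{r \<in> carrier R. \<forall>y\<in>{x}. r \<odot>\<^bsub>M\<^esub> y \<in> N <+>\<^bsub>M\<^esub> gen S}"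
  have "ideal ?J R" using x insert sS by (intro multiplier_ideal sub_set_add) auto
  then obtain T where T: "T \<subseteq> carrier R" "finite T" "?J = Idl\<^bsub>R\<^esub> T"
    using noetherian_ring.finetely_gen[OF noeth] by meson
  have "\<exists>n\<in>N. \<exists>s\<in>gen S. t \<odot>\<^bsub>M\<^esub> x = n \<oplus>\<^bsub>M\<^esub> s" if "t \<in> T" for t
  proof -
    have "t \<in> ?J" using that T R.genideal_self[OF T(1)] by blast
    then show ?thesis by (auto elim!: set_add_memE)
  qed
  then obtain n where n: "\<And>t. t \<in> T \<Longrightarrow> n t \<in> N" "\<And>t. t \<in> T \<Longrightarrow> \<exists>s\<in>gen S. t \<odot>\<^bsub>M\<^esub> x = n t \<oplus>\<^bsub>M\<^esub> s"
    by metis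
  have nT: "n ` T \<subseteq> N" "n ` T \<subseteq> carrier M" using n insert sub_carrier by blast+
  have "fg (N \<inter> gen S)" using insert S sS sub_inter by (intro insert.IH) auto
  then obtain T0 where T0: "finite T0" "T0 \<subseteq> carrier M" "gen T0 = N \<inter> gen S"
    unfolding fg_def by blast
  have s: "sub (gen (n ` T))" "sub (gen (n ` T) <+>\<^bsub>M\<^esub> gen S)" using nT gen_sub sub_set_add sS by auto
  \<comment> \<open>Checked on the generators T, this replaces N by the span of the finitely many
    lifts.\<close>
  have J: "?J \<subseteq> {r \<in> carrier R. \<forall>y\<in>{x}. r \<odot>\<^bsub>M\<^esub> y \<in> gen (n ` T) <+>\<^bsub>M\<^esub> gen S}"
    unfolding T(3)
  proof (intro R.genideal_minimal multiplier_ideal s)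
    show "T \<subseteq> {r \<in> carrier R. \<forall>y\<in>{x}. r \<odot>\<^bsub>M\<^esub> y \<in> gen (n ` T) <+>\<^bsub>M\<^esub> gen S}"
    proof
      fix t assume t: "t \<in> T"
      then obtain s where "s \<in> gen S" "t \<odot>\<^bsub>M\<^esub> x = n t \<oplus>\<^bsub>M\<^esub> s" using n by blast
      moreover have "n t \<in> gen (n ` T)" using t gen_incl by blast
      ultimately show "t \<in> {r \<in> carrier R. \<forall>y\<in>{x}. r \<odot>\<^bsub>M\<^esub> y \<in> gen (n ` T) <+>\<^bsub>M\<^esub> gen S}"
        using t T by (auto intro: set_add_memI)
    qed
  qed (use x in auto)
  have "gen (T0 \<union> n ` T) = N"
  proof
    show "gen (T0 \<union> n ` T) \<subseteq> N"
      using nT T0 gen_incl[of T0] insert by (intro gen_least) auto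
    show "N \<subseteq> gen (T0 \<union> n ` T)"
    proof
      fix y assume y: "y \<in> N"
      then have "y \<in> gen S <+>\<^bsub>M\<^esub> cyc x" using insert x S gen_insert by blast
      then obtain s r where sr: "s \<in> gen S" "r \<in> carrier R" "y = s \<oplus>\<^bsub>M\<^esub> r \<odot>\<^bsub>M\<^esub> x"
        by (auto elim!: set_add_memE simp: cyc_def)
      have yc: "y \<in> carrier M" "s \<in> carrier M" using y sr insert sS sub_carrier by blast+
      have "r \<odot>\<^bsub>M\<^esub> x = y \<oplus>\<^bsub>M\<^esub> (\<ominus>\<^bsub>M\<^esub> s)"
        using sr yc x by (simp add: M.a_comm M.r_neg1)
      then have "r \<odot>\<^bsub>M\<^esub> x \<in> N <+>\<^bsub>M\<^esub> gen S"
        using set_add_memI[OF y sub_neg[OF sS sr(1)]] by simp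
      then have "r \<in> ?J" using sr by simp
      then have "r \<odot>\<^bsub>M\<^esub> x \<in> gen (n ` T) <+>\<^bsub>M\<^esub> gen S" using J by auto
      then obtain g s' where g: "g \<in> gen (n ` T)" "s' \<in> gen S" "r \<odot>\<^bsub>M\<^esub> x = g \<oplus>\<^bsub>M\<^esub> s'"
        by (rule set_add_memE)
      have gc: "g \<in> carrier M" "s' \<in> carrier M" using g s sS sub_carrier by blast+
      have gN: "g \<in> N" using g gen_least[OF insert.prems(2) nT(1)] by auto
      have y': "y = g \<oplus>\<^bsub>M\<^esub> (s \<oplus>\<^bsub>M\<^esub> s')" using sr g yc gc by (simp add: M.a_lcomm)
      have "s \<oplus>\<^bsub>M\<^esub> s' \<in> N"
        using sub_add_cancel[OF insert.prems(2) gN, of "s \<oplus>\<^bsub>M\<^esub> s'"] y y' yc gc by simp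
      then have "s \<oplus>\<^bsub>M\<^esub> s' \<in> gen T0" using T0 sr g sS sub_add by auto
      then show "y \<in> gen (T0 \<union> n ` T)"
        unfolding y' gen_Un[OF T0(2) nT(2)] set_add_def' using g yc gc M.a_comm by fastforce
    qed
  qed
  then show ?case unfolding fg_def using T0 T nT by (intro exI[of _ "T0 \<union> n ` T"]) auto
qed

end


section \<open>Modules over local rings\<close>

text \<open>Locality is expressed by a proper ideal whose complement consists of units; this is the
  form needed for Nakayama's lemma and for quotients killed by \<mm>.\<close>

locale local_module = module +
  fixes \<mm> :: "'a set"
  assumes noeth: "noetherian_ring R"
    and mm_ideal: "ideal \<mm> R"
    and mm_proper: "\<one> \<notin> \<mm>"
    and mm_unit: "\<lbrakk>a \<in> carrier R; a \<notin> \<mm>\<rbrakk> \<Longrightarrow> a \<in> Units R"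
begin

lemma mm_carrier: "\<mm> \<subseteq> carrier R"
  using ideal.Icarr[OF mm_ideal] by blast

lemma one_minus_mm: assumes "a \<in> \<mm>" shows "\<one> \<ominus> a \<in> Units R"
proof (rule mm_unit)
  have a: "a \<in> carrier R" using assms mm_carrier by auto
  then show "\<one> \<ominus> a \<in> carrier R" by simp
  show "\<one> \<ominus> a \<notin> \<mm>"
  proof
    assume "\<one> \<ominus> a \<in> \<mm>"
    then have "(\<one> \<ominus> a) \<oplus> a \<in> \<mm>"
      using additive_subgroup.a_closed[OF ideal.axioms(1)[OF mm_ideal]] assms by blast
    moreover have "(\<one> \<ominus> a) \<oplus> a = \<one>"
      using a by (simp add: R.minus_eq R.a_assoc R.l_neg)
    ultimately show False using mm_proper by simp
  qed
qed

lemma unit_smult_cancel: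
  assumes "u \<in> Units R" "sub B" "x \<in> carrier M" "u \<odot>\<^bsub>M\<^esub> x \<in> B"
  shows "x \<in> B"
proof -
  have "inv u \<odot>\<^bsub>M\<^esub> (u \<odot>\<^bsub>M\<^esub> x) \<in> B"
    using assms by (intro sub_smult[OF assms(2) _ assms(4)]) auto
  moreover have "inv u \<odot>\<^bsub>M\<^esub> (u \<odot>\<^bsub>M\<^esub> x) = x"
    using assms by (simp add: smult_assoc1[symmetric] R.Units_closed)
  ultimately show ?thesis by simp
qed

lemma sprod_mm_cyc: assumes "x \<in> carrier M" shows "sprod \<mm> (cyc x) \<subseteq> (\<lambda>a. a \<odot>\<^bsub>M\<^esub> x) ` \<mm>"
proof (rule sprod_least)
  show "sub ((\<lambda>a. a \<odot>\<^bsub>M\<^esub> x) ` \<mm>)"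
  proof (rule subI)
    show "(\<lambda>a. a \<odot>\<^bsub>M\<^esub> x) ` \<mm> \<subseteq> carrier M" using assms mm_carrier by auto
    show "\<zero>\<^bsub>M\<^esub> \<in> (\<lambda>a. a \<odot>\<^bsub>M\<^esub> x) ` \<mm>"
      using assms additive_subgroup.zero_closed[OF ideal.axioms(1)[OF mm_ideal]]
      by (intro image_eqI[of _ _ \<zero>]) auto
  next
    fix u v assume "u \<in> (\<lambda>a. a \<odot>\<^bsub>M\<^esub> x) ` \<mm>" "v \<in> (\<lambda>a. a \<odot>\<^bsub>M\<^esub> x) ` \<mm>"
    then obtain a b where ab: "a \<in> \<mm>" "b \<in> \<mm>" "u = a \<odot>\<^bsub>M\<^esub> x" "v = b \<odot>\<^bsub>M\<^esub> x" by auto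
    moreover have "a \<oplus> b \<in> \<mm>"
      using additive_subgroup.a_closed[OF ideal.axioms(1)[OF mm_ideal]] ab by blast
    moreover have "u \<oplus>\<^bsub>M\<^esub> v = (a \<oplus> b) \<odot>\<^bsub>M\<^esub> x"
      using ab assms mm_carrier by (simp add: smult_l_distr subset_iff)
    ultimately show "u \<oplus>\<^bsub>M\<^esub> v \<in> (\<lambda>a. a \<odot>\<^bsub>M\<^esub> x) ` \<mm>" by blast
  next
    fix r u assume r: "r \<in> carrier R" and "u \<in> (\<lambda>a. a \<odot>\<^bsub>M\<^esub> x) ` \<mm>"
    then obtain a where "a \<in> \<mm>" "u = a \<odot>\<^bsub>M\<^esub> x" by auto
    then have "r \<odot>\<^bsub>M\<^esub> u = (r \<otimes> a) \<odot>\<^bsub>M\<^esub> x" "r \<otimes> a \<in> \<mm>"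
      using r assms mm_carrier ideal.I_l_closed[OF mm_ideal] by (auto simp: smult_assoc1 subset_iff)
    then show "r \<odot>\<^bsub>M\<^esub> u \<in> (\<lambda>a. a \<odot>\<^bsub>M\<^esub> x) ` \<mm>" by blast
  qed
next
  fix a y assume a: "a \<in> \<mm>" and "y \<in> cyc x"
  then obtain r where r: "r \<in> carrier R" "y = r \<odot>\<^bsub>M\<^esub> x" by (auto simp: cyc_def)
  then have "a \<odot>\<^bsub>M\<^esub> y = (a \<otimes> r) \<odot>\<^bsub>M\<^esub> x" "a \<otimes> r \<in> \<mm>"
    using a assms mm_carrier ideal.I_r_closed[OF mm_ideal] by (auto simp: smult_assoc1 subset_iff)
  then show "a \<odot>\<^bsub>M\<^esub> y \<in> (\<lambda>a. a \<odot>\<^bsub>M\<^esub> x) ` \<mm>" by blast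
qed

text \<open>Induction on the generators with B arbitrary. Enlarging B by the new generator x lets
  the induction hypothesis absorb the others; what remains is x = b + a x with a in \<mm>, and 1 - a
  is a unit.\<close>

lemma nakayama_gen:
  "finite S \<Longrightarrow> S \<subseteq> carrier M \<Longrightarrow> sub B \<Longrightarrow> gen S \<subseteq> B <+>\<^bsub>M\<^esub> sprod \<mm> (gen S) \<Longrightarrow> gen S \<subseteq> B"
proof (induction S arbitrary: B rule: finite_induct)
  case empty
  then show ?case by (simp add: gen_empty)
next
  case (insert x S)
  have x: "x \<in> carrier M" and S: "S \<subseteq> carrier M" using insert by auto
  let ?N = "gen (insert x S)"
  have N: "?N = gen S <+>\<^bsub>M\<^esub> cyc x" using x S gen_insert by blast
  have s: "sub (gen S)" "sub (cyc x)" "sub (sprod \<mm> (gen S))" "sub (sprod \<mm> (cyc x))"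
    using x S gen_sub sub_cyc sprod_sub' mm_carrier by auto
  have mN: "sprod \<mm> ?N = sprod \<mm> (gen S) <+>\<^bsub>M\<^esub> sprod \<mm> (cyc x)"
    unfolding N using s mm_carrier sprod_set_add by blast
  have B': "sub (B <+>\<^bsub>M\<^esub> cyc x)" using insert s sub_set_add by blast
  have sm: "sub ((B <+>\<^bsub>M\<^esub> cyc x) <+>\<^bsub>M\<^esub> sprod \<mm> (gen S))" using B' s sub_set_add by blast
  have "sprod \<mm> (cyc x) \<subseteq> cyc x" using s mm_carrier sprod_le by blast
  also have "\<dots> \<subseteq> B <+>\<^bsub>M\<^esub> cyc x" using set_add_upper2[OF insert.prems(2) s(2)] .
  finally have 1: "sprod \<mm> (cyc x) \<subseteq> (B <+>\<^bsub>M\<^esub> cyc x) <+>\<^bsub>M\<^esub> sprod \<mm> (gen S)"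
    using set_add_upper1[OF B' s(3)] by blast
  have 2: "B \<subseteq> (B <+>\<^bsub>M\<^esub> cyc x) <+>\<^bsub>M\<^esub> sprod \<mm> (gen S)"
    using set_add_upper1[OF insert.prems(2) s(2)] set_add_upper1[OF B' s(3)] by blast
  have "gen S \<subseteq> ?N" by (rule gen_mono) auto
  also have "\<dots> \<subseteq> B <+>\<^bsub>M\<^esub> sprod \<mm> ?N" by (rule insert.prems)
  also have "\<dots> \<subseteq> (B <+>\<^bsub>M\<^esub> cyc x) <+>\<^bsub>M\<^esub> sprod \<mm> (gen S)"
    unfolding mN using 1 2 set_add_upper2[OF B' s(3)] by (intro set_add_least sm) auto
  \<comment> \<open>The induction hypothesis is applied to B + R x instead of B.\<close>
  finally have gS: "gen S \<subseteq> B <+>\<^bsub>M\<^esub> cyc x" using insert.IH[OF S B'] by blast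
  have sBm: "sub (B <+>\<^bsub>M\<^esub> sprod \<mm> (cyc x))" using insert s sub_set_add by blast
  have "sprod \<mm> (gen S) \<subseteq> sprod \<mm> (B <+>\<^bsub>M\<^esub> cyc x)" using gS by (intro sprod_mono) auto
  also have "\<dots> = sprod \<mm> B <+>\<^bsub>M\<^esub> sprod \<mm> (cyc x)"
    using insert s mm_carrier sprod_set_add by blast
  also have "\<dots> \<subseteq> B <+>\<^bsub>M\<^esub> sprod \<mm> (cyc x)"
    using insert.prems(2) mm_carrier by (intro set_add_mono sprod_le) auto
  finally have 3: "sprod \<mm> (gen S) \<subseteq> B <+>\<^bsub>M\<^esub> sprod \<mm> (cyc x)" .
  have "x \<in> ?N" using gen_incl by blast
  then have "x \<in> B <+>\<^bsub>M\<^esub> sprod \<mm> ?N" using insert.prems by blast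
  moreover have "B <+>\<^bsub>M\<^esub> sprod \<mm> ?N \<subseteq> B <+>\<^bsub>M\<^esub> sprod \<mm> (cyc x)"
    unfolding mN using 3 set_add_upper1[OF insert.prems(2) s(4)] set_add_upper2[OF insert.prems(2) s(4)]
    by (intro set_add_least sBm) auto
  ultimately have "x \<in> B <+>\<^bsub>M\<^esub> sprod \<mm> (cyc x)" by blast
  then obtain b a where ba: "b \<in> B" "a \<in> \<mm>" "x = b \<oplus>\<^bsub>M\<^esub> a \<odot>\<^bsub>M\<^esub> x"
    using sprod_mm_cyc[OF x] by (force elim!: set_add_memE)
  have c: "b \<in> carrier M" "a \<in> carrier R" using ba insert.prems sub_carrier mm_carrier by auto
  have "(\<one> \<ominus> a) \<odot>\<^bsub>M\<^esub> x = x \<ominus>\<^bsub>M\<^esub> a \<odot>\<^bsub>M\<^esub> x"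
    using c x by (simp add: R.minus_eq M.minus_eq smult_l_distr smult_l_minus)
  also have "\<dots> = (b \<oplus>\<^bsub>M\<^esub> a \<odot>\<^bsub>M\<^esub> x) \<ominus>\<^bsub>M\<^esub> a \<odot>\<^bsub>M\<^esub> x" using ba(3) by simp
  also have "\<dots> = b" using c x by (simp add: M.minus_eq M.a_assoc M.r_neg)
  finally have "(\<one> \<ominus> a) \<odot>\<^bsub>M\<^esub> x \<in> B" using ba by simp
  then have "x \<in> B" using unit_smult_cancel[OF one_minus_mm] ba insert.prems x by blast
  then have "cyc x \<subseteq> B" using insert.prems cyc_least by blast
  then have "B <+>\<^bsub>M\<^esub> cyc x = B" using insert.prems s set_add_absorb by blast
  then show ?case unfolding N using gS \<open>cyc x \<subseteq> B\<close> insert.prems by (intro set_add_least) auto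
qed

lemma nakayama:
  assumes "fg N" "sub B" "N \<subseteq> B <+>\<^bsub>M\<^esub> sprod \<mm> N"
  shows "N \<subseteq> B"
  using nakayama_gen assms unfolding fg_def by metis

text \<open>The quotient (B + R x) / B is generated by one element killed by \<mm>. In any w = b + r
  x outside B the coefficient r is a unit, so w recovers x and nothing lies strictly in
  between.\<close>

lemma len_cyc:
  assumes B: "sub B" and x: "x \<in> carrier M" and m: "\<And>a. a \<in> \<mm> \<Longrightarrow> a \<odot>\<^bsub>M\<^esub> x \<in> B"
  shows "fl B (B <+>\<^bsub>M\<^esub> cyc x)" "len B (B <+>\<^bsub>M\<^esub> cyc x) \<le> 1"
proof -
  let ?A = "B <+>\<^bsub>M\<^esub> cyc x"
  have s: "sub ?A" "B \<subseteq> ?A" using B x sub_cyc sub_set_add set_add_upper1 by auto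
  have top: "W = ?A" if W: "sub W" "B \<subset> W" "W \<subseteq> ?A" for W
  proof -
    obtain w where w: "w \<in> W" "w \<notin> B" using W by blast
    then obtain b r where br: "b \<in> B" "r \<in> carrier R" "w = b \<oplus>\<^bsub>M\<^esub> r \<odot>\<^bsub>M\<^esub> x"
      using W by (force elim!: set_add_memE simp: cyc_def)
    have "r \<notin> \<mm>" using m w br B sub_add by blast
    moreover have "r \<odot>\<^bsub>M\<^esub> x \<in> W" using sub_add_cancel[OF W(1), of b] br w W x by auto
    ultimately have "x \<in> W" using unit_smult_cancel[OF mm_unit W(1) x] br by blast
    then have "cyc x \<subseteq> W" using W cyc_least by blast
    then show ?thesis using set_add_least[of W B "cyc x"] W by blast
  qed
  have "n \<le> 1" if ch: "chn B A n" "A \<subseteq> ?A" for A n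
    using ch
  proof (cases rule: chn.cases)
    case (step A0 n0)
    have "n0 = 0"
    proof (rule ccontr)
      assume "n0 \<noteq> 0"
      have "B \<subset> A0"
        using \<open>chn B A0 n0\<close>
      proof (cases rule: chn.cases)
        case base
        then show ?thesis using \<open>n0 \<noteq> 0\<close> by simp
      next
        case (step A1 n1)
        then show ?thesis using chn_sub[of B A1 n1] by blast
      qed
      then have "A0 = ?A" using top[of A0] chn_sub[OF \<open>chn B A0 n0\<close>] step ch by blast
      then show False using step ch by blast
    qed
    then show ?thesis using step by simp
  qed simp
  then show "fl B ?A" "len B ?A \<le> 1" using len_leI[OF B s, of 1] by auto
qed

lemma len_gen:
  "finite S \<Longrightarrow> S \<subseteq> carrier M \<Longrightarrow> sub B \<Longrightarrow> (\<And>a x. a \<in> \<mm> \<Longrightarrow> x \<in> S \<Longrightarrow> a \<odot>\<^bsub>M\<^esub> x \<in> B) \<Longrightarrow>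
    fl B (B <+>\<^bsub>M\<^esub> gen S) \<and> len B (B <+>\<^bsub>M\<^esub> gen S) \<le> card S"
proof (induction S rule: finite_induct)
  case empty
  have "B <+>\<^bsub>M\<^esub> gen {} = B"
    using empty by (simp add: gen_empty set_add_absorb sub_trivial)
  then show ?case using fl_refl empty by simp
next
  case (insert x S)
  let ?A = "B <+>\<^bsub>M\<^esub> gen S"
  have x: "x \<in> carrier M" and S: "S \<subseteq> carrier M" using insert by auto
  have s: "sub (gen S)" "sub (cyc x)" "sub B" using x S insert gen_sub sub_cyc by auto
  then have sA: "sub ?A" "B \<subseteq> ?A" using sub_set_add set_add_upper1 by auto
  have IH: "fl B ?A" "len B ?A \<le> card S" using insert by auto
  have m: "a \<odot>\<^bsub>M\<^esub> x \<in> ?A" if "a \<in> \<mm>" for a using that insert sA by blast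
  have eq: "B <+>\<^bsub>M\<^esub> gen (insert x S) = ?A <+>\<^bsub>M\<^esub> cyc x"
  proof -
    have "B <+>\<^bsub>M\<^esub> gen (insert x S) = gen B <+>\<^bsub>M\<^esub> gen (insert x S)" using s gen_id by simp
    also have "\<dots> = gen (B \<union> insert x S)" using gen_Un[of B "insert x S"] x S sub_subset[OF s(3)] by simp
    also have "B \<union> insert x S = (B \<union> S) \<union> {x}" by auto
    also have "gen \<dots> = (gen B <+>\<^bsub>M\<^esub> gen S) <+>\<^bsub>M\<^esub> gen {x}"
      using gen_Un[of "B \<union> S" "{x}"] gen_Un[of B S] x S sub_subset[OF s(3)] by simp
    finally show ?thesis using s gen_id gen_singleton x by simp
  qed
  have "fl ?A (?A <+>\<^bsub>M\<^esub> cyc x)" "len ?A (?A <+>\<^bsub>M\<^esub> cyc x) \<le> 1"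
    using len_cyc[OF sA(1) x m] by auto
  then show ?case unfolding eq using len_add[OF IH(1)] IH insert by auto
qed

text \<open>Number of generators as a length, so that additivity applies;
  \<open>min_gens_eq_nu\<close> links it to \<open>min_gens\<close> for the whole module.\<close>

definition nu :: "'c set \<Rightarrow> nat" where
  "nu A = len (sprod \<mm> A) A"

lemma fg_carrier_imp_fg: "fg (carrier M) \<Longrightarrow> sub N \<Longrightarrow> fg N"
  using sub_of_gen_fg[OF noeth] sub_subset unfolding fg_def by metis

lemma nu_le_card:
  assumes "finite S" "S \<subseteq> carrier M" "gen S = A"
  shows "fl (sprod \<mm> A) A" "nu A \<le> card S"
proof -
  have s: "sub A" "sub (sprod \<mm> A)" using assms gen_sub sprod_sub' mm_carrier by auto
  have "a \<odot>\<^bsub>M\<^esub> x \<in> sprod \<mm> A" if "a \<in> \<mm>" "x \<in> S" for a x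
    using that assms gen_incl by (intro sprod_memI) auto
  then have "fl (sprod \<mm> A) (sprod \<mm> A <+>\<^bsub>M\<^esub> A) \<and> len (sprod \<mm> A) (sprod \<mm> A <+>\<^bsub>M\<^esub> A) \<le> card S"
    using len_gen[OF assms(1,2) s(2)] assms(3) by blast
  moreover have "sprod \<mm> A <+>\<^bsub>M\<^esub> A = A"
    using s sprod_le mm_carrier set_add_least[OF s(1), of "sprod \<mm> A" A] set_add_upper2[OF s(2,1)] by blast
  ultimately show "fl (sprod \<mm> A) A" "nu A \<le> card S" by (auto simp: nu_def)
qed

text \<open>Generators already contained in B plus the earlier ones are discarded; each of the
  others contributes a strict step.\<close>

lemma chn_gen_subset:
  "finite S \<Longrightarrow> S \<subseteq> carrier M \<Longrightarrow> sub B \<Longrightarrow>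
    \<exists>T\<subseteq>S. B <+>\<^bsub>M\<^esub> gen T = B <+>\<^bsub>M\<^esub> gen S \<and> chn B (B <+>\<^bsub>M\<^esub> gen T) (card T)"
proof (induction S rule: finite_induct)
  case empty
  have "B <+>\<^bsub>M\<^esub> gen {} = B"
    using empty by (simp add: gen_empty set_add_absorb sub_trivial)
  then show ?case using chn.base empty by auto
next
  case (insert x S)
  have x: "x \<in> carrier M" and S: "S \<subseteq> carrier M" using insert by auto
  obtain T where T: "T \<subseteq> S" "B <+>\<^bsub>M\<^esub> gen T = B <+>\<^bsub>M\<^esub> gen S" "chn B (B <+>\<^bsub>M\<^esub> gen T) (card T)"
    using insert by auto
  have gB: "gen B = B" "B \<subseteq> carrier M" using insert gen_id sub_subset by auto
  have eq: "B <+>\<^bsub>M\<^esub> gen (insert x U) = (B <+>\<^bsub>M\<^esub> gen U) <+>\<^bsub>M\<^esub> cyc x" if "U \<subseteq> S" for U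
  proof -
    have U: "U \<subseteq> carrier M" using that S by auto
    have "B <+>\<^bsub>M\<^esub> gen (insert x U) = gen (B \<union> insert x U)" using gen_Un[of B "insert x U"] U x gB by simp
    also have "B \<union> insert x U = (B \<union> U) \<union> {x}" by auto
    also have "gen \<dots> = (B <+>\<^bsub>M\<^esub> gen U) <+>\<^bsub>M\<^esub> gen {x}"
      using gen_Un[of "B \<union> U" "{x}"] gen_Un[of B U] x U gB by simp
    finally show ?thesis using gen_singleton x by simp
  qed
  have s: "sub (B <+>\<^bsub>M\<^esub> gen T)" "sub (cyc x)"
    using T S x insert gen_sub sub_set_add sub_cyc by auto
  have eS: "B <+>\<^bsub>M\<^esub> gen (insert x S) = (B <+>\<^bsub>M\<^esub> gen T) <+>\<^bsub>M\<^esub> cyc x"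
    using eq[of S] T by simp
  show ?case
  proof (cases "x \<in> B <+>\<^bsub>M\<^esub> gen T")
    case True
    then have "(B <+>\<^bsub>M\<^esub> gen T) <+>\<^bsub>M\<^esub> cyc x = B <+>\<^bsub>M\<^esub> gen T"
      using s cyc_least set_add_absorb by blast
    then show ?thesis using T eS by (intro exI[of _ T]) auto
  next
    case False
    have "B <+>\<^bsub>M\<^esub> gen T \<subset> (B <+>\<^bsub>M\<^esub> gen T) <+>\<^bsub>M\<^esub> cyc x"
      using False set_add_upper1[OF s] set_add_upper2[OF s] cyc_self[OF x] by blast
    then have "chn B ((B <+>\<^bsub>M\<^esub> gen T) <+>\<^bsub>M\<^esub> cyc x) (Suc (card T))"
      using T s sub_set_add by (intro chn.step) auto
    moreover have "card (insert x T) = Suc (card T)"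
      using T insert finite_subset by (metis card_insert_disjoint subsetD)
    ultimately show ?thesis using eq[OF T(1)] eS T by (intro exI[of _ "insert x T"]) auto
  qed
qed

text \<open>By Nakayama's lemma, generators modulo \<mm> M generate M. \<open>chn_gen_subset\<close>
  with B = \<mm> M thins a generating set to at most \<open>nu\<close> elements.\<close>

lemma min_gens_eq_nu:
  assumes "fin_gen R M"
  shows "min_gens R M = nu (carrier M)" "fl (sprod \<mm> (carrier M)) (carrier M)"
    "\<exists>S. finite S \<and> card S = min_gens R M \<and> S \<subseteq> carrier M \<and> gen S = carrier M"
proof -
  obtain S0 where S0: "finite S0" "S0 \<subseteq> carrier M" "gen S0 = carrier M"
    using assms unfolding fin_gen_def by auto
  let ?P = "\<lambda>n. \<exists>S. finite S \<and> card S = n \<and> S \<subseteq> carrier M \<and> gen S = carrier M"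
  have "?P (card S0)" using S0 by blast
  then have "?P (min_gens R M)" unfolding min_gens_def by (rule LeastI)
  then show *: "\<exists>S. finite S \<and> card S = min_gens R M \<and> S \<subseteq> carrier M \<and> gen S = carrier M" .
  then obtain S where S: "finite S" "card S = min_gens R M" "S \<subseteq> carrier M" "gen S = carrier M" by blast
  show flm: "fl (sprod \<mm> (carrier M)) (carrier M)" using nu_le_card S by blast
  let ?B = "sprod \<mm> (carrier M)"
  have B: "sub ?B" "?B \<subseteq> carrier M" using flm fl_sub by auto
  obtain T where T: "T \<subseteq> S" "?B <+>\<^bsub>M\<^esub> gen T = ?B <+>\<^bsub>M\<^esub> gen S" "chn ?B (?B <+>\<^bsub>M\<^esub> gen T) (card T)"
    using chn_gen_subset S B by metis
  have "?B <+>\<^bsub>M\<^esub> carrier M = carrier M"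
    using B set_add_least[OF carrier_is_submodule, of ?B "carrier M"] set_add_upper2[OF B(1) carrier_is_submodule] by blast
  then have T2: "?B <+>\<^bsub>M\<^esub> gen T = carrier M" using T S by simp
  have sT: "sub (gen T)" using T S gen_sub by auto
  have "gen T <+>\<^bsub>M\<^esub> ?B = carrier M" using T2
    by (smt (verit, ccfv_threshold) B(1) gen_sub gen_Un gen_id sT sub_subset sup_commute)
  then have "carrier M \<subseteq> gen T"
    using nakayama[of "carrier M" "gen T"] S sT unfolding fg_def by auto
  then have "gen T = carrier M" using sT sub_subset by blast
  then have "min_gens R M \<le> card T"
    unfolding min_gens_def using T S finite_subset by (intro Least_le exI[of _ T]) auto
  also have "\<dots> \<le> nu (carrier M)" unfolding nu_def using len_upper[OF flm] T(3) T2 by simp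
  finally show "min_gens R M = nu (carrier M)" using nu_le_card[OF S(1,3,4)] S by simp
qed

end


section \<open>Lattices\<close>

text \<open>\<open>mm_power\<close> is the trace of dimension one: every nonzero principal ideal
  contains a power of \<mm>, which makes the quotients by lattices of finite length.\<close>

locale lattice_module = local_module +
  assumes dom: "domain R"
    and tf: "torsionfree R M"
    and fgM: "fg (carrier M)"
    and mm_nonzero: "\<exists>a\<in>\<mm>. a \<noteq> \<zero>"
    and mm_power: "\<lbrakk>r \<in> carrier R; r \<noteq> \<zero>\<rbrakk> \<Longrightarrow> \<exists>k. ideal_power R \<mm> k \<subseteq> (\<lambda>s. r \<otimes> s) ` carrier R"
begin

lemma smult_eq_zero: "\<lbrakk>r \<in> carrier R; x \<in> carrier M; r \<odot>\<^bsub>M\<^esub> x = \<zero>\<^bsub>M\<^esub>; r \<noteq> \<zero>\<rbrakk> \<Longrightarrow> x = \<zero>\<^bsub>M\<^esub>"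
  using tf unfolding torsionfree_def by blast

lemma smult_cancel:
  assumes "r \<in> carrier R" "r \<noteq> \<zero>" "x \<in> carrier M" "y \<in> carrier M" "r \<odot>\<^bsub>M\<^esub> x = r \<odot>\<^bsub>M\<^esub> y"
  shows "x = y"
proof -
  have "r \<odot>\<^bsub>M\<^esub> (x \<ominus>\<^bsub>M\<^esub> y) = r \<odot>\<^bsub>M\<^esub> x \<ominus>\<^bsub>M\<^esub> r \<odot>\<^bsub>M\<^esub> y"
    using assms by (simp add: M.minus_eq smult_r_distr smult_r_minus)
  also have "\<dots> = \<zero>\<^bsub>M\<^esub>" using assms by (simp add: M.minus_eq M.r_neg)
  finally have "x \<ominus>\<^bsub>M\<^esub> y = \<zero>\<^bsub>M\<^esub>" using assms smult_eq_zero by blast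
  moreover have "x = (x \<ominus>\<^bsub>M\<^esub> y) \<oplus>\<^bsub>M\<^esub> y"
    using assms by (simp add: M.minus_eq M.a_assoc M.l_neg)
  ultimately show ?thesis using assms by simp
qed

lemma mult_nonzero: "\<lbrakk>a \<in> carrier R; b \<in> carrier R; a \<noteq> \<zero>; b \<noteq> \<zero>\<rbrakk> \<Longrightarrow> a \<otimes> b \<noteq> \<zero>"
  using domain.integral[OF dom] by blast

section \<open>Powers of \<mm> acting on submodules\<close>

definition mpow :: "nat \<Rightarrow> 'c set \<Rightarrow> 'c set" where
  "mpow n A = (sprod \<mm> ^^ n) A"

lemma mpow_0 [simp]: "mpow 0 A = A"
  and mpow_Suc: "mpow (Suc n) A = sprod \<mm> (mpow n A)"
  by (auto simp: mpow_def)

lemma sub_mm: "sub A \<Longrightarrow> sub (sprod \<mm> A)"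
  using sprod_sub' mm_carrier by blast

lemma mm_le: "sub A \<Longrightarrow> sprod \<mm> A \<subseteq> A"
  using sprod_le mm_carrier by blast

lemma sub_mpow: "sub A \<Longrightarrow> sub (mpow n A)"
  by (induction n) (auto simp: mpow_Suc sub_mm)

lemma mpow_mono: "A \<subseteq> B \<Longrightarrow> mpow n A \<subseteq> mpow n B"
  by (induction n) (simp_all add: mpow_Suc sprod_mono)

lemma mpow_add: "mpow (m + n) A = mpow m (mpow n A)"
  by (simp add: mpow_def funpow_add)

lemma mpow_le: "sub A \<Longrightarrow> mpow n A \<subseteq> A"
proof (induction n)
  case (Suc n)
  then show ?case using mm_le[OF sub_mpow[of A n]] by (simp add: mpow_Suc)
qed simp

lemma ideal_power_ideal: "ideal (ideal_power R \<mm> n) R"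
proof (induction n)
  case 0
  then show ?case by (simp add: ideal_power_def R.oneideal)
next
  case (Suc n)
  then show ?case by (simp add: ideal_power_def R.ideal_prod_is_ideal[OF mm_ideal])
qed

lemma sprod_ideal_power: "sub A \<Longrightarrow> sprod (ideal_power R \<mm> n) A = mpow n A"
proof (induction n)
  case 0
  then show ?case by (simp add: ideal_power_def sprod_carrier)
next
  case (Suc n)
  have "sprod (ideal_power R \<mm> (Suc n)) A = sprod \<mm> (sprod (ideal_power R \<mm> n) A)"
    using sprod_ideal_prod[OF mm_ideal ideal_power_ideal sub_subset[OF Suc.prems]]
    by (simp add: ideal_power_def)
  then show ?case using Suc by (simp add: mpow_Suc)
qed

lemma fl_mpow: "fl (mpow n (carrier M)) (carrier M)"
proof (induction n)
  case 0
  then show ?case by (simp add: fl_refl carrier_is_submodule)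
next
  case (Suc n)
  have "fg (mpow n (carrier M))"
    using fg_carrier_imp_fg fgM sub_mpow carrier_is_submodule by blast
  then have "fl (sprod \<mm> (mpow n (carrier M))) (mpow n (carrier M))"
    using nu_le_card unfolding fg_def by blast
  then show ?case using len_add Suc by (simp add: mpow_Suc)
qed

text \<open>As M is finitely generated over a domain, this says that M / A is torsion, that is, A
  and M span the same vector space over the fraction field.\<close>

definition lat :: "'c set \<Rightarrow> bool" where
  "lat A \<longleftrightarrow> sub A \<and> (\<exists>r\<in>carrier R. r \<noteq> \<zero> \<and> scale r (carrier M) \<subseteq> A)"

lemma lat_sub: "lat A \<Longrightarrow> sub A"
  by (simp add: lat_def)

lemma lat_up: "lat B \<Longrightarrow> sub A \<Longrightarrow> B \<subseteq> A \<Longrightarrow> lat A"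
  unfolding lat_def by blast

lemma lat_carrier: "lat (carrier M)"
  unfolding lat_def using carrier_is_submodule scale_le domain.one_not_zero[OF dom] by blast

lemma lat_mpow: assumes "lat A" shows "\<exists>k. mpow k (carrier M) \<subseteq> A"
proof -
  obtain r where r: "r \<in> carrier R" "r \<noteq> \<zero>" "scale r (carrier M) \<subseteq> A" using assms lat_def by blast
  obtain k where k: "ideal_power R \<mm> k \<subseteq> (\<lambda>s. r \<otimes> s) ` carrier R" using mm_power r by blast
  have "sprod (ideal_power R \<mm> k) (carrier M) \<subseteq> scale r (carrier M)"
  proof (rule sprod_least)
    fix a x assume "a \<in> ideal_power R \<mm> k" and x: "x \<in> carrier M"
    then obtain s where "s \<in> carrier R" "a = r \<otimes> s" using k by auto
    then show "a \<odot>\<^bsub>M\<^esub> x \<in> scale r (carrier M)"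
      using r x by (auto simp: scale_def smult_assoc1)
  qed (use r sub_scale carrier_is_submodule in auto)
  then show ?thesis using r sprod_ideal_power carrier_is_submodule by (intro exI[of _ k]) auto
qed

text \<open>Some \<mm>-power multiple of M lies below B, and the interval from it up to M is a
  finite tower of quotients killed by \<mm>.\<close>

lemma fl_lat: assumes "lat B" "sub A" "B \<subseteq> A" shows "fl B A"
proof -
  obtain k where k: "mpow k (carrier M) \<subseteq> B" using assms lat_mpow by blast
  have "fl B (carrier M)"
    using fl_parts[OF fl_mpow lat_sub[OF assms(1)] k] sub_subset[OF lat_sub[OF assms(1)]] by blast
  then show ?thesis using fl_parts(1)[OF _ assms(2,3) sub_subset[OF assms(2)]] by blast
qed

lemma lat_scale: assumes "lat A" "c \<in> carrier R" "c \<noteq> \<zero>" shows "lat (scale c A)"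
proof -
  obtain r where r: "r \<in> carrier R" "r \<noteq> \<zero>" "scale r (carrier M) \<subseteq> A" using assms lat_def by blast
  have "scale (c \<otimes> r) (carrier M) \<subseteq> scale c A"
    using r assms scale_mono[OF r(3), of c] by (simp add: scale_scale)
  then show ?thesis
    unfolding lat_def using r assms lat_sub sub_scale mult_nonzero
    by (intro conjI bexI[of _ "c \<otimes> r"]) auto
qed

lemma scale_le_mm: "a \<in> \<mm> \<Longrightarrow> scale a A \<subseteq> sprod \<mm> A"
  by (auto simp: scale_def intro: sprod_memI)

lemma lat_mm: assumes "lat A" shows "lat (sprod \<mm> A)"
proof -
  obtain a where "a \<in> \<mm>" "a \<noteq> \<zero>" using mm_nonzero by blast
  then show ?thesis
    using lat_up[OF lat_scale[OF assms]] scale_le_mm sub_mm[OF lat_sub[OF assms]] mm_carrier by blast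
qed

lemma lat_mpow': "lat A \<Longrightarrow> lat (mpow n A)"
  by (induction n) (auto simp: mpow_Suc lat_mm)

lemma preim_scale:
  assumes "c \<in> carrier R" "c \<noteq> \<zero>" "A \<subseteq> carrier M" "B \<subseteq> A"
  shows "preim c A (scale c B) = B"
proof
  show "preim c A (scale c B) \<subseteq> B"
  proof
    fix x assume "x \<in> preim c A (scale c B)"
    then obtain b where "x \<in> A" "b \<in> B" "c \<odot>\<^bsub>M\<^esub> x = c \<odot>\<^bsub>M\<^esub> b" by (auto simp: preim_def scale_def)
    then show "x \<in> B" using smult_cancel[OF assms(1,2), of x b] assms(3,4) by auto
  qed
  show "B \<subseteq> preim c A (scale c B)" using assms by (auto simp: preim_def scale_def)
qed

lemma len_scale:
  assumes "c \<in> carrier R" "c \<noteq> \<zero>" "lat B" "sub A" "B \<subseteq> A"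
  shows "len (scale c B) (scale c A) = len B A"
proof -
  have p: "preim c A (scale c B) = B" 
    by (rule preim_scale[OF assms(1,2) sub_subset[OF assms(4)] assms(5)])
  have s: "sub (scale c B)" "sub (scale c A)" "scale c B \<subseteq> scale c A"
    using assms sub_scale lat_sub scale_mono by auto
  have "scale c B <+>\<^bsub>M\<^esub> scale c A = scale c A"
    using s set_add_least[OF s(2,3)] set_add_upper2[OF s(1,2)] by blast
  then show ?thesis
    using len_push(2)[OF assms(1,4) s(1)] p fl_lat assms by simp
qed

lemma nu_scale:
  assumes "c \<in> carrier R" "c \<noteq> \<zero>" "lat A"
  shows "nu (scale c A) = nu A"
  unfolding nu_def using assms sprod_scale[OF mm_carrier lat_sub[OF assms(3)] assms(1)]
    len_scale[OF assms(1,2) lat_mm lat_sub mm_le] lat_sub by simp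

text \<open>For nonzero a in \<mm>, multiplication by a identifies M / A with a M / a A. Counting M
  / a A through A and through a M shows that A / a A and M / a M have the same length. Since a A
  \<subseteq> \<mm> A, this length bounds \<open>nu A\<close> independently of A.\<close>

lemma nu_bounded: "\<exists>L. \<forall>A. lat A \<longrightarrow> nu A \<le> L"
proof -
  obtain a where a: "a \<in> \<mm>" "a \<noteq> \<zero>" "a \<in> carrier R" using mm_nonzero mm_carrier by blast
  have "nu A \<le> len (scale a (carrier M)) (carrier M)" if A: "lat A" for A
  proof -
    have s: "sub A" "A \<subseteq> carrier M" using A lat_sub sub_subset by auto
    have la: "lat (scale a A)" "lat (scale a (carrier M))" using A a lat_scale lat_carrier by auto
    have 1: "len (scale a A) (carrier M) = len (scale a A) A + len A (carrier M)"
      using len_add(2) fl_lat[OF la(1) s(1) scale_le[OF a(3) s(1)]]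
        fl_lat[OF A carrier_is_submodule s(2)] by blast
    have 2: "len (scale a A) (carrier M)
        = len (scale a A) (scale a (carrier M)) + len (scale a (carrier M)) (carrier M)"
      using len_add(2) fl_lat[OF la(1) lat_sub[OF la(2)] scale_mono[OF s(2)]]
        fl_lat[OF la(2) carrier_is_submodule scale_le[OF a(3) carrier_is_submodule]] by blast
    have "len (scale a A) (scale a (carrier M)) = len A (carrier M)"
      by (rule len_scale[OF a(3,2) A carrier_is_submodule s(2)])
    then have 3: "len (scale a A) A = len (scale a (carrier M)) (carrier M)" using 1 2 by simp
    have "len (scale a A) A = len (scale a A) (sprod \<mm> A) + nu A"
      unfolding nu_def
      using len_split[OF fl_lat[OF la(1) s(1) scale_le[OF a(3) s(1)]] sub_mm[OF s(1)] scale_le_mm[OF a(1)] mm_le[OF s(1)]] .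
    then show ?thesis using 3 by simp
  qed
  then show ?thesis by blast
qed

text \<open>A nonzero generator c is singled out as the starting point of the inductions over
  generators of \<mm>.\<close>

lemma mm_generators:
  obtains C c where "finite C" "C \<subseteq> \<mm>" "c \<in> \<mm>" "c \<noteq> \<zero>" "\<mm> = Idl\<^bsub>R\<^esub> (insert c C)"
proof -
  obtain C where C: "finite C" "C \<subseteq> carrier R" "\<mm> = Idl\<^bsub>R\<^esub> C"
    using noetherian_ring.finetely_gen[OF noeth mm_ideal] by blast
  obtain c where c: "c \<in> \<mm>" "c \<noteq> \<zero>" using mm_nonzero by blast
  have sub: "C \<subseteq> \<mm>" using C R.genideal_self by blast
  have "Idl\<^bsub>R\<^esub> (insert c C) \<subseteq> \<mm>" using sub c mm_ideal by (intro R.genideal_minimal) auto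
  moreover have "\<mm> \<subseteq> Idl\<^bsub>R\<^esub> (insert c C)"
    unfolding C(3)
  proof (rule R.genideal_minimal)
    show "ideal (Idl\<^bsub>R\<^esub> (insert c C)) R"
      using c C mm_carrier by (intro R.genideal_ideal) auto
    show "C \<subseteq> Idl\<^bsub>R\<^esub> (insert c C)"
      using R.genideal_self[of "insert c C"] c C mm_carrier by auto
  qed
  ultimately show thesis using that C c sub by blast
qed


section \<open>Numbers of generators\<close>

text \<open>Petridis's argument from additive combinatorics: passing from \<open>I A\<close> to \<open>I A + c A\<close> changes
  \<open>\<nu>\<close> by at least \<open>\<nu>(A) - \<nu>(A')\<close>, where \<open>A'\<close> is the set of all \<open>a\<close> in \<open>A\<close> with \<open>c a\<close> in \<open>I A\<close>.\<close>

lemma nu_sprod_ge: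
  assumes A: "lat A" and max: "\<And>A'. lat A' \<Longrightarrow> A' \<subseteq> A \<Longrightarrow> nu A' \<le> nu A"
    and c1: "c1 \<in> carrier R" "c1 \<noteq> \<zero>"
  shows "finite C \<Longrightarrow> C \<subseteq> carrier R \<Longrightarrow> lat (sprod (insert c1 C) A) \<and> nu A \<le> nu (sprod (insert c1 C) A)"
proof (induction C rule: finite_induct)
  case empty
  have s: "sub A" using A lat_sub by blast
  \<comment> \<open>With a single nonzero generator the product is an isomorphic copy of A.\<close>
  have "sprod {c1} A = {\<zero>\<^bsub>M\<^esub>} <+>\<^bsub>M\<^esub> scale c1 A"
    using sprod_insert[of "{}" A c1] s c1 by (simp add: sprod_empty)
  also have "\<dots> = scale c1 A"
    using set_add_upper2[OF sub_trivial sub_scale[OF c1(1) s]] sub_zero[OF sub_scale[OF c1(1) s]]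
      set_add_least[OF sub_scale[OF c1(1) s], of "{\<zero>\<^bsub>M\<^esub>}" "scale c1 A"] by blast
  finally show ?case using nu_scale c1 A lat_scale by simp
next
  case (insert c C)
  have s: "sub A" using A lat_sub by blast
  have c: "c \<in> carrier R" and C: "insert c1 C \<subseteq> carrier R" using insert c1 by auto
  let ?P = "sprod (insert c1 C) A"
  let ?Q = "?P <+>\<^bsub>M\<^esub> scale c A"
  let ?A' = "preim c A ?P"
  have IH: "lat ?P" "nu A \<le> nu ?P" using insert by auto
  have sP: "sub ?P" "sub ?Q" "?P \<subseteq> ?Q" "sub (scale c A)" "sub (sprod \<mm> A)"
    using IH lat_sub sub_scale s c sub_set_add set_add_upper1 sub_mm by auto
  have "?Q = sprod (insert c (insert c1 C)) A" using sprod_insert[OF C s c] by simp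
  then have Q: "?Q = sprod (insert c1 (insert c C)) A" by (simp add: insert_commute)
  have lQ: "lat ?Q" using lat_up IH sP by blast
  have sA': "sub ?A'" "?A' \<subseteq> A" using sub_preim c s sP by (auto simp: preim_def)
  \<comment> \<open>Since c c1 A = c1 c A lies in P, the submodule A' contains c1 A. So it is a
    lattice and the maximality assumption applies to it.\<close>
  have "scale c1 A \<subseteq> ?A'"
  proof
    fix x assume "x \<in> scale c1 A"
    then obtain a where a: "a \<in> A" "x = c1 \<odot>\<^bsub>M\<^esub> a" by (auto simp: scale_def)
    have "c \<odot>\<^bsub>M\<^esub> x = c1 \<odot>\<^bsub>M\<^esub> (c \<odot>\<^bsub>M\<^esub> a)"
      using a s c c1 sub_carrier by (metis R.m_comm smult_assoc1)
    moreover have "\<dots> \<in> ?P" using a s c by (intro sprod_memI sub_smult) auto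
    ultimately show "x \<in> ?A'" using a s c1 sub_smult by (simp add: preim_def)
  qed
  then have lA': "lat ?A'" using lat_up lat_scale A c1 sA' by blast
  have l1: "len ?P ?Q = len ?A' A"
    using len_push(2)[OF c s sP(1) fl_lat[OF lA' s sA'(2)]] .
  \<comment> \<open>The kernel of multiplication by c from \<mm> A to M / \<mm> P. It contains \<mm>
    A', hence \<mm> Q / \<mm> P is a quotient of \<mm> A / \<mm> A'.\<close>
  let ?K = "preim c (sprod \<mm> A) (sprod \<mm> ?P)"
  have sK: "sub ?K" "?K \<subseteq> sprod \<mm> A" using sub_preim c s sP sub_mm by (auto simp: preim_def)
  have "sprod \<mm> ?A' \<subseteq> ?K"
  proof (rule sprod_least[OF sK(1)])
    fix r x assume rx: "r \<in> \<mm>" "x \<in> ?A'"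
    have "c \<odot>\<^bsub>M\<^esub> (r \<odot>\<^bsub>M\<^esub> x) = r \<odot>\<^bsub>M\<^esub> (c \<odot>\<^bsub>M\<^esub> x)"
      using rx sA' c sub_carrier mm_carrier by (metis R.m_comm smult_assoc1 subsetD)
    moreover have "c \<odot>\<^bsub>M\<^esub> x \<in> ?P" using rx by (simp add: preim_def)
    then have "r \<odot>\<^bsub>M\<^esub> (c \<odot>\<^bsub>M\<^esub> x) \<in> sprod \<mm> ?P" by (rule sprod_memI[OF rx(1)])
    moreover have "r \<odot>\<^bsub>M\<^esub> x \<in> sprod \<mm> A" using rx sA'(2) by (intro sprod_memI) auto
    ultimately show "r \<odot>\<^bsub>M\<^esub> x \<in> ?K" unfolding preim_def by simp
  qed
  note mA'K = this
  have lmA': "lat (sprod \<mm> ?A')" using lat_mm lA' by blast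
  then have lK: "lat ?K" using lat_up mA'K sK by blast
  have mQ: "sprod \<mm> ?Q = sprod \<mm> ?P <+>\<^bsub>M\<^esub> scale c (sprod \<mm> A)"
    using sprod_set_add[OF mm_carrier sP(1,4)] sprod_scale[OF mm_carrier s c] by simp
  have "len (sprod \<mm> ?P) (sprod \<mm> ?Q) = len ?K (sprod \<mm> A)"
    unfolding mQ using len_push(2)[OF c sP(5) sub_mm[OF sP(1)] fl_lat[OF lK sP(5) sK(2)]] .
  also have "\<dots> \<le> len (sprod \<mm> ?A') (sprod \<mm> A)"
    using len_split[OF fl_lat[OF lmA' sP(5)] sK(1) mA'K sK(2)] mA'K sK(2) by simp
  finally have l2: "len (sprod \<mm> ?P) (sprod \<mm> ?Q) \<le> len (sprod \<mm> ?A') (sprod \<mm> A)" .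
  have mA'A: "sprod \<mm> ?A' \<subseteq> sprod \<mm> A" using sA' by (intro sprod_mono) auto
  have "fl (sprod \<mm> ?A') A" using fl_lat[OF lmA' s] mA'A mm_le[OF s] by blast
  \<comment> \<open>The interval from \<mm> A' to A is counted through \<mm> A and through
    A'.\<close>
  then have "len (sprod \<mm> ?A') (sprod \<mm> A) + nu A = nu ?A' + len ?A' A"
    unfolding nu_def
    using len_split[OF _ sP(5) mA'A mm_le[OF s]] len_split[OF _ sA'(1) mm_le[OF sA'(1)] sA'(2)]
    by simp
  then have l3: "len (sprod \<mm> ?A') (sprod \<mm> A) \<le> len ?A' A" using max[OF lA' sA'(2)] by simp
  have lmP: "lat (sprod \<mm> ?P)" using lat_mm IH by blast
  have mPQ: "sprod \<mm> ?P \<subseteq> sprod \<mm> ?Q" using sP by (intro sprod_mono) auto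
  have "fl (sprod \<mm> ?P) ?Q" using fl_lat[OF lmP sP(2)] mPQ mm_le[OF sP(2)] by blast
  \<comment> \<open>The same double count from \<mm> P to Q, through \<mm> Q and through P.\<close>
  then have "len (sprod \<mm> ?P) (sprod \<mm> ?Q) + nu ?Q = nu ?P + len ?P ?Q"
    unfolding nu_def
    using len_split[OF _ sub_mm[OF sP(2)] mPQ mm_le[OF sP(2)]]
      len_split[OF _ sP(1) mm_le[OF sP(1)] sP(3)] by simp
  then have "nu ?P \<le> nu ?Q" using l1 l2 l3 by simp
  then show ?case using IH lQ unfolding Q by simp
qed

lemma nu_mm_ge:
  assumes A: "lat A" and max: "\<And>A'. lat A' \<Longrightarrow> A' \<subseteq> A \<Longrightarrow> nu A' \<le> nu A"
  shows "nu A \<le> nu (sprod \<mm> A)"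
proof -
  obtain C c where C: "finite C" "C \<subseteq> \<mm>" "c \<in> \<mm>" "c \<noteq> \<zero>" "\<mm> = Idl\<^bsub>R\<^esub> (insert c C)"
    by (rule mm_generators)
  have cc: "insert c C \<subseteq> carrier R" using C mm_carrier by blast
  have "sprod \<mm> A = sprod (Idl\<^bsub>R\<^esub> (insert c C)) A" using C(5) by simp
  also have "\<dots> = sprod (insert c C) A"
    using sprod_Idl[OF cc] sub_subset[OF lat_sub[OF A]] by blast
  finally show ?thesis using nu_sprod_ge[OF A max, of c C] C cc by simp
qed

section \<open>The maximal number of generators and the Hilbert-Samuel function\<close>

definition nu_max :: nat where
  "nu_max = Max (nu ` {A. lat A})"

lemma nu_max: "lat A \<Longrightarrow> nu A \<le> nu_max" "\<exists>A. lat A \<and> nu A = nu_max"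
proof -
  obtain L where "\<forall>A. lat A \<longrightarrow> nu A \<le> L" using nu_bounded by blast
  then have fin: "finite (nu ` {A. lat A})" by (auto intro!: finite_subset[OF _ finite_atMost[of L]])
  show "lat A \<Longrightarrow> nu A \<le> nu_max" unfolding nu_max_def using fin by (intro Max_ge) auto
  have "nu_max \<in> nu ` {A. lat A}"
    unfolding nu_max_def using fin lat_carrier by (intro Max_in) auto
  then show "\<exists>A. lat A \<and> nu A = nu_max" by auto
qed

lemma nu_mpow:
  assumes "lat A" "nu A = nu_max"
  shows "nu (mpow n A) = nu_max"
proof (induction n)
  case (Suc n)
  have l: "lat (mpow n A)" using lat_mpow' assms by blast
  then have "nu (mpow n A) \<le> nu (sprod \<mm> (mpow n A))"
    using nu_mm_ge[OF l] nu_max(1) Suc by metis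
  then show ?case using Suc nu_max(1)[OF lat_mm[OF l]] by (simp add: mpow_Suc)
qed (use assms in simp)

lemma len_mpow:
  assumes "lat A" "nu A = nu_max"
  shows "len (mpow n A) A = n * nu_max"
proof (induction n)
  case 0
  then show ?case using fl_refl lat_sub assms by simp
next
  case (Suc n)
  have s: "sub A" "sub (mpow n A)" "lat (mpow n A)" using assms lat_sub sub_mpow lat_mpow' by auto
  have "len (mpow (Suc n) A) A = len (mpow (Suc n) A) (mpow n A) + len (mpow n A) A"
    unfolding mpow_Suc using len_add(2) fl_lat[OF lat_mm[OF s(3)] s(2) mm_le[OF s(2)]]
      fl_lat[OF s(3,1) mpow_le[OF s(1)]] by blast
  also have "len (mpow (Suc n) A) (mpow n A) = nu_max"
    using nu_mpow[OF assms, of n] by (simp add: nu_def mpow_Suc)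
  finally show ?case using Suc by simp
qed

text \<open>If A attains the maximum and \<mm>\<open>\<^sup>k\<close> M \<subseteq> A \<subseteq> M,
  then \<mm>\<open>\<^sup>n\<close> A is squeezed between
  \<mm>\<open>\<^sup>n\<^sup>+\<^sup>k\<close> M and \<mm>\<open>\<^sup>n\<close> M. So the lengths
  for M and the exact values n \<open>nu_max\<close> for A differ by a bounded amount, which
  disappears after division by n.\<close>

lemma hilbert_samuel_limit:
  "(\<lambda>n. real (len (mpow n (carrier M)) (carrier M)) / real n) \<longlonglongrightarrow> real nu_max"
proof -
  obtain A where A: "lat A" "nu A = nu_max" using nu_max by blast
  obtain k where k: "mpow k (carrier M) \<subseteq> A" using A lat_mpow by blast
  have s: "sub A" "A \<subseteq> carrier M" using A lat_sub sub_subset by auto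
  define h where "h n = len (mpow n (carrier M)) (carrier M)" for n
  have AM: "len (mpow n A) (carrier M) = n * nu_max + len A (carrier M)" for n
    using len_add(2)[OF fl_lat[OF lat_mpow'[OF A(1)] s(1) mpow_le[OF s(1)]]
      fl_lat[OF A(1) carrier_is_submodule s(2)]] len_mpow[OF A] by simp
  have up: "h n \<le> n * nu_max + len A (carrier M)" for n
    using len_split[OF fl_lat[OF lat_mpow'[OF A(1), of n] carrier_is_submodule]
        sub_mpow[OF carrier_is_submodule] mpow_mono[OF s(2)] mpow_le[OF carrier_is_submodule]]
      AM[of n] sub_subset[OF sub_mpow[OF s(1)]] by (simp add: h_def)
  have lo: "n * nu_max \<le> h (n + k)" for n
  proof -
    have 1: "mpow (n + k) (carrier M) \<subseteq> mpow n A" using k by (simp add: mpow_add mpow_mono)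
    have "h (n + k) = len (mpow (n + k) (carrier M)) (mpow n A) + len (mpow n A) (carrier M)"
      unfolding h_def
      using len_split[OF fl_mpow sub_mpow[OF s(1)] 1 sub_subset[OF sub_mpow[OF s(1)]]] .
    then show ?thesis using AM[of n] by simp
  qed
  have lo': "real n * real nu_max - real k * real nu_max \<le> real (h n)" for n
  proof (cases "k \<le> n")
    case True
    have "(n - k) * nu_max \<le> h n" using lo[of "n - k"] True by simp
    then have "real ((n - k) * nu_max) \<le> real (h n)" by (simp only: of_nat_le_iff)
    then show ?thesis using True by (simp add: of_nat_diff algebra_simps)
  next
    case False
    then have "real n * real nu_max \<le> real k * real nu_max" by (intro mult_right_mono) auto
    then show ?thesis by simp
  qed
  have up': "real (h n) \<le> real n * real nu_max + real (len A (carrier M))" for n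
    using up[of n] by (metis of_nat_add of_nat_le_iff of_nat_mult)
  have l: "(\<lambda>n. real nu_max - real k * real nu_max / real n) \<longlonglongrightarrow> real nu_max - 0"
    by (intro tendsto_intros lim_const_over_n)
  have u: "(\<lambda>n. real nu_max + real (len A (carrier M)) / real n) \<longlonglongrightarrow> real nu_max + 0"
    by (intro tendsto_intros lim_const_over_n)
  have "(\<lambda>n. real (h n) / real n) \<longlonglongrightarrow> real nu_max"
  proof (rule tendsto_sandwich)
    show "\<forall>\<^sub>F n in sequentially. real nu_max - real k * real nu_max / real n \<le> real (h n) / real n"
      using eventually_gt_at_top[of 0]
    proof eventually_elim
      case (elim n)
      then show ?case using divide_right_mono[OF lo'[of n], of "real n"] by (simp add: diff_divide_distrib)
    qed
    show "\<forall>\<^sub>F n in sequentially. real (h n) / real n \<le> real nu_max + real (len A (carrier M)) / real n"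
      using eventually_gt_at_top[of 0]
    proof eventually_elim
      case (elim n)
      then show ?case using divide_right_mono[OF up'[of n], of "real n"] by (simp add: add_divide_distrib)
    qed
  qed (use l u in auto)
  then show ?thesis by (simp add: h_def)
qed


section \<open>Socles\<close>

text \<open>Formed inside M, so that \<open>colon \<mm> A\<close> modulo A is the socle of M /
  A.\<close>

definition colon :: "'a set \<Rightarrow> 'c set \<Rightarrow> 'c set" where
  "colon C A = {v \<in> carrier M. \<forall>c\<in>C. c \<odot>\<^bsub>M\<^esub> v \<in> A}"

lemma sub_colon: "C \<subseteq> carrier R \<Longrightarrow> sub A \<Longrightarrow> sub (colon C A)"
proof (rule subI)
  fix a x assume C: "C \<subseteq> carrier R" and A: "sub A" and a: "a \<in> carrier R" and x: "x \<in> colon C A"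
  have "c \<odot>\<^bsub>M\<^esub> (a \<odot>\<^bsub>M\<^esub> x) = a \<odot>\<^bsub>M\<^esub> (c \<odot>\<^bsub>M\<^esub> x)" if "c \<in> C" for c
    using that C a x by (metis (no_types, lifting) R.m_comm colon_def mem_Collect_eq smult_assoc1 subsetD)
  then show "a \<odot>\<^bsub>M\<^esub> x \<in> colon C A"
    using A a x by (auto simp: colon_def intro: sub_smult)
qed (auto simp: colon_def smult_r_distr subset_iff intro: sub_add)

lemma colon_upper: "C \<subseteq> carrier R \<Longrightarrow> sub A \<Longrightarrow> A \<subseteq> colon C A"
  using sub_carrier sub_smult by (auto simp: colon_def)

lemma colon_mono: "A \<subseteq> B \<Longrightarrow> colon C A \<subseteq> colon C B"
  by (auto simp: colon_def)

lemma sprod_colon: "sub A \<Longrightarrow> sprod C (colon C A) \<subseteq> A"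
  by (rule sprod_least) (auto simp: colon_def)

lemma lat_colon: "C \<subseteq> carrier R \<Longrightarrow> lat A \<Longrightarrow> lat (colon C A)"
  using lat_up sub_colon colon_upper lat_sub by metis

lemma colon_insert: "colon (insert c C) A = preim c (colon C A) A"
  by (auto simp: colon_def preim_def)

lemma colon_Idl:
  assumes "C \<subseteq> carrier R" "sub A"
  shows "colon (Idl\<^bsub>R\<^esub> C) A = colon C A"
proof
  show "colon (Idl\<^bsub>R\<^esub> C) A \<subseteq> colon C A"
    using R.genideal_self[OF assms(1)] by (auto simp: colon_def)
  show "colon C A \<subseteq> colon (Idl\<^bsub>R\<^esub> C) A"
  proof
    fix v assume v: "v \<in> colon C A"
    have "Idl\<^bsub>R\<^esub> C \<subseteq> {r \<in> carrier R. \<forall>x\<in>{v}. r \<odot>\<^bsub>M\<^esub> x \<in> A}"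
      using v assms by (intro R.genideal_minimal multiplier_ideal) (auto simp: colon_def)
    then show "v \<in> colon (Idl\<^bsub>R\<^esub> C) A" using v by (auto simp: colon_def)
  qed
qed

definition tau :: "'c set \<Rightarrow> nat" where
  "tau A = len A (colon \<mm> A)"

text \<open>Since \<mm> (A : \<mm>) \<subseteq> A, the socle (A : \<mm>) / A is a quotient of (A :
  \<mm>) / \<mm> (A : \<mm>).\<close>

lemma len_colon_le:
  assumes "lat A" shows "tau A \<le> nu (colon \<mm> A)"
proof -
  have s: "sub A" "sub (colon \<mm> A)" "lat (colon \<mm> A)" "A \<subseteq> colon \<mm> A"
    using assms lat_sub sub_colon lat_colon colon_upper mm_carrier by auto
  show ?thesis
    unfolding tau_def nu_def
    using len_split[OF fl_lat[OF lat_mm[OF s(3)] s(2) mm_le[OF s(2)]] s(1) sprod_colon[OF s(1)] s(4)] by simp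
qed

text \<open>The argument of \<open>nu_sprod_ge\<close> with quotients in place of submodules.\<close>

lemma tau_colon_ge:
  assumes A: "lat A" and max: "\<And>A'. lat A' \<Longrightarrow> tau A' \<le> tau A"
    and c1: "c1 \<in> carrier R" and base: "tau A \<le> tau (colon {c1} A)"
  shows "finite C \<Longrightarrow> C \<subseteq> carrier R \<Longrightarrow> tau A \<le> tau (colon (insert c1 C) A)"
proof (induction C rule: finite_induct)
  case empty
  \<comment> \<open>Here the start is a hypothesis: A : c1 is cut off at M and need not be a copy of
    A, unlike c1 A in \<open>nu_sprod_ge\<close>.\<close>
  then show ?case using base by simp
next
  case (insert c C)
  have s: "sub A" using A lat_sub by blast
  have c: "c \<in> carrier R" and C: "insert c1 C \<subseteq> carrier R" using insert c1 by auto
  let ?X = "colon (insert c1 C) A"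
  let ?X2 = "preim c ?X A"
  \<comment> \<open>The comparison lattice now lies above A, with A' / A isomorphic to X / X2
    through multiplication by c.\<close>
  let ?A' = "A <+>\<^bsub>M\<^esub> scale c ?X"
  have X2: "colon (insert c1 (insert c C)) A = ?X2"
    using colon_insert[of c "insert c1 C" A] by (simp add: insert_commute)
  have X: "sub ?X" "lat ?X" using C s A sub_colon lat_colon by auto
  have sX2: "sub ?X2" "?X2 \<subseteq> ?X" "lat ?X2"
    using lat_colon[of "insert c1 (insert c C)" A] A C c X2 lat_sub[of ?X2] by (auto simp: preim_def)
  have sA': "sub ?A'" "A \<subseteq> ?A'" "lat ?A'"
    using s c X sub_scale sub_set_add set_add_upper1 lat_up[OF A] by auto
  have l1: "len ?X2 ?X = len A ?A'"
    using len_push(2)[OF c X(1) s fl_lat[OF sX2(3) X(1) sX2(2)]] by simp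
  note cs = sub_colon[OF mm_carrier]
  \<comment> \<open>Colons commute with each other, so multiplication by c embeds (X : \<mm>) / (X2
    : \<mm>) into M / (A : \<mm>).\<close>
  have pre: "preim c (colon \<mm> ?X) (colon \<mm> A) = colon \<mm> ?X2"
  proof -
    have "r \<odot>\<^bsub>M\<^esub> (c \<odot>\<^bsub>M\<^esub> v) = c \<odot>\<^bsub>M\<^esub> (r \<odot>\<^bsub>M\<^esub> v)" if "r \<in> \<mm>" "v \<in> carrier M" for r v
      using that c mm_carrier by (metis R.m_comm smult_assoc1 subsetD)
    then show ?thesis using c by (auto simp: preim_def colon_def[of \<mm>])
  qed
  have lX2: "lat (colon \<mm> ?X2)" "colon \<mm> ?X2 \<subseteq> colon \<mm> ?X"
    using sX2 lat_colon mm_carrier colon_mono by auto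
  let ?E = "colon \<mm> A <+>\<^bsub>M\<^esub> scale c (colon \<mm> ?X)"
  have l2: "len (colon \<mm> ?X2) (colon \<mm> ?X) = len (colon \<mm> A) ?E"
    using len_push(2)[OF c cs[OF X(1)] cs[OF s]] fl_lat[OF lX2(1) cs[OF X(1)] lX2(2)] pre by simp
  have lcA: "lat (colon \<mm> A)" using lat_colon A mm_carrier by blast
  have E: "sub ?E" "colon \<mm> A \<subseteq> ?E"
    using cs s X c sub_scale sub_set_add set_add_upper1 by auto
  \<comment> \<open>The image of that embedding stays within A' : \<mm>, which bounds its
    length.\<close>
  have "scale c (colon \<mm> ?X) \<subseteq> colon \<mm> ?A'"
  proof
    fix w assume "w \<in> scale c (colon \<mm> ?X)"
    then obtain v where v: "v \<in> colon \<mm> ?X" "w = c \<odot>\<^bsub>M\<^esub> v" by (auto simp: scale_def)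
    have "r \<odot>\<^bsub>M\<^esub> w \<in> ?A'" if r: "r \<in> \<mm>" for r
    proof -
      have "r \<odot>\<^bsub>M\<^esub> w = c \<odot>\<^bsub>M\<^esub> (r \<odot>\<^bsub>M\<^esub> v)"
        using r v c mm_carrier by (metis (no_types, lifting) R.m_comm colon_def mem_Collect_eq smult_assoc1 subsetD)
      also have "\<dots> \<in> scale c ?X" using v r by (auto simp: colon_def[of \<mm>] scale_def)
      finally show ?thesis using set_add_upper2[OF s sub_scale[OF c X(1)]] by blast
    qed
    then show "w \<in> colon \<mm> ?A'" using v c by (auto simp: colon_def[of \<mm>])
  qed
  then have Ele: "?E \<subseteq> colon \<mm> ?A'"
    using cs sA' colon_mono[of A ?A' \<mm>] by (intro set_add_least) auto
  have l3: "len (colon \<mm> A) ?E \<le> len (colon \<mm> A) (colon \<mm> ?A')"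
    using len_split[OF fl_lat[OF lcA cs[OF sA'(1)]] E(1,2) Ele] E(2) Ele by simp
  note up = colon_upper[OF mm_carrier]
  \<comment> \<open>Counting from A to A' : \<mm> through A' and through A : \<mm> converts
    maximality of tau(A) into an inequality of lengths.\<close>
  have "len A (colon \<mm> ?A') = len A ?A' + tau ?A'"
    unfolding tau_def using len_split[OF fl_lat[OF A cs[OF sA'(1)]] sA'(1,2) up[OF sA'(1)]]
      sA'(2) up[OF sA'(1)] by blast
  moreover have "len A (colon \<mm> ?A') = tau A + len (colon \<mm> A) (colon \<mm> ?A')"
    unfolding tau_def using len_split[OF fl_lat[OF A cs[OF sA'(1)]] cs[OF s] up[OF s] colon_mono[OF sA'(2)]]
      sA'(2) up[OF sA'(1)] by blast
  ultimately have l4: "len (colon \<mm> A) (colon \<mm> ?A') \<le> len A ?A'" using max[OF sA'(3)] by simp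
  \<comment> \<open>The same double count from X2 to X : \<mm>.\<close>
  have "len ?X2 (colon \<mm> ?X) = len ?X2 ?X + tau ?X"
    unfolding tau_def using len_split[OF fl_lat[OF sX2(3) cs[OF X(1)]] X(1) sX2(2) up[OF X(1)]]
      sX2(2) up[OF X(1)] by blast
  moreover have "len ?X2 (colon \<mm> ?X) = tau ?X2 + len (colon \<mm> ?X2) (colon \<mm> ?X)"
    unfolding tau_def using len_split[OF fl_lat[OF sX2(3) cs[OF X(1)]] cs[OF sX2(1)] up[OF sX2(1)] lX2(2)]
      sX2(2) up[OF X(1)] by blast
  ultimately have "tau ?X \<le> tau ?X2" using l1 l2 l3 l4 by simp
  then show ?case using insert X2 by simp
qed

text \<open>Take x = c c and A = x \<mm> M. The socle of M / A contains x M / A, already of the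
  largest possible length, so A : \<mm> = x M. By \<open>tau_colon_ge\<close>, tau(x M) is maximal
  too, and the bound on nu(D) for D = x M : \<mm> then forces \<mm> D to be all of x M.\<close>

lemma maximal_nu_divisible:
  assumes max: "nu (carrier M) = nu_max"
  obtains x where "x \<in> \<mm>" "x \<noteq> \<zero>"
    "sprod \<mm> (colon \<mm> (scale x (carrier M))) = scale x (carrier M)"
proof -
  obtain C c where C: "finite C" "C \<subseteq> \<mm>" "c \<in> \<mm>" "c \<noteq> \<zero>" "\<mm> = Idl\<^bsub>R\<^esub> (insert c C)"
    by (rule mm_generators)
  have cc: "c \<in> carrier R" "insert c C \<subseteq> carrier R" using C mm_carrier by auto
  have c2: "c \<otimes> c \<in> carrier R" "c \<otimes> c \<noteq> \<zero>" "c \<otimes> c \<in> \<mm>"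
    using C cc mult_nonzero ideal.I_l_closed[OF mm_ideal] by auto
  let ?A = "scale (c \<otimes> c) (sprod \<mm> (carrier M))"
  let ?M2 = "scale (c \<otimes> c) (carrier M)"
  have lM: "lat (sprod \<mm> (carrier M))" using lat_mm lat_carrier by blast
  have A: "lat ?A" "sub ?A" "lat ?M2" "sub ?M2" "?A \<subseteq> ?M2"
    using lM lat_scale c2 lat_carrier lat_sub scale_mono mm_le carrier_is_submodule by auto
  have tle: "tau A' \<le> nu_max" if "lat A'" for A'
    using len_colon_le[OF that] nu_max(1)[OF lat_colon[OF mm_carrier that]] by linarith
  note cs = sub_colon[OF mm_carrier]
  have smm: "sprod \<mm> ?M2 = ?A" using sprod_scale mm_carrier carrier_is_submodule c2 by blast
  have M2A: "?M2 \<subseteq> colon \<mm> ?A"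
    using sub_subset[OF A(4)] smm sprod_memI[of _ \<mm> _ ?M2] by (auto simp: colon_def)
  have nM2: "len ?A ?M2 = nu_max"
    using nu_scale[OF c2(1,2) lat_carrier] max smm by (simp add: nu_def)
  \<comment> \<open>The chain of bounds nu_max = len(x M / A) \<le> tau(A) \<le> nu_max
    collapses.\<close>
  have tA: "tau ?A = nu_max \<and> len ?M2 (colon \<mm> ?A) = 0"
    using len_split[OF fl_lat[OF A(1) cs[OF A(2)]] A(4,5) M2A] A(5) M2A nM2 tle[OF A(1)]
    by (simp add: tau_def)
  then have cA: "colon \<mm> ?A = ?M2" using len_0 fl_lat[OF A(3) cs[OF A(2)] M2A] by blast
  let ?X = "colon {c} ?A"
  let ?Y = "scale c (sprod \<mm> (carrier M))"
  have ccs: "scale (c \<otimes> c) B = scale c (scale c B)" if "B \<subseteq> carrier M" for B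
    using scale_scale[OF cc(1) cc(1) that] by simp
  have Y: "sub ?Y" "lat ?Y" using lM lat_scale C cc lat_sub by auto
  \<comment> \<open>This prepares the start of \<open>tau_colon_ge\<close>: A : c is c \<mm> M, and
    c M / c \<mm> M is a part of length \<open>nu_max\<close> in its socle.\<close>
  have XY: "?X = ?Y"
  proof -
    have "?X = preim c (carrier M) (scale c ?Y)"
      using ccs[OF sub_subset[OF lat_sub[OF lM]]] by (simp add: colon_def preim_def)
    then show ?thesis using preim_scale[OF cc(1) C(4) _ sub_subset[OF Y(1)]] by simp
  qed
  have M1: "sub (scale c (carrier M))" "lat (scale c (carrier M))" "?Y \<subseteq> scale c (carrier M)"
    using sub_scale cc carrier_is_submodule lat_scale lat_carrier C mm_le scale_mono by auto
  have "sprod \<mm> (scale c (carrier M)) = ?Y" using sprod_scale mm_carrier carrier_is_submodule cc by blast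
  then have "scale c (carrier M) \<subseteq> colon \<mm> ?Y" "len ?Y (scale c (carrier M)) = nu_max"
    using sub_subset[OF M1(1)] sprod_memI[of _ \<mm> _ "scale c (carrier M)"]
      nu_scale[OF cc(1) C(4) lat_carrier] max by (auto simp: colon_def nu_def)
  then have base: "tau ?A \<le> tau ?X"
    using len_split[OF fl_lat[OF Y(2) cs[OF Y(1)]] M1(1,3)] M1(3) tA unfolding XY
    by (simp add: tau_def subset_trans)
  have "tau ?A \<le> tau (colon (insert c C) ?A)"
    using tau_colon_ge[OF A(1) _ cc(1) base C(1)] tA tle cc by auto
  also have "colon (insert c C) ?A = ?M2" using colon_Idl[OF cc(2) A(2)] C(5) cA by simp
  finally have t2: "nu_max \<le> tau ?M2" using tA by simp
  let ?D = "colon \<mm> ?M2"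
  have D: "sub ?D" "lat ?D" "sprod \<mm> ?D \<subseteq> ?M2" "?M2 \<subseteq> ?D"
    using cs A lat_colon mm_carrier sprod_colon colon_upper by auto
  \<comment> \<open>x M divides D / \<mm> D into x M / \<mm> D and the socle D / x M. The latter
    already has length at least \<open>nu_max\<close>.\<close>
  have "nu ?D = len (sprod \<mm> ?D) ?M2 + tau ?M2"
    unfolding nu_def tau_def
    using len_split[OF fl_lat[OF lat_mm[OF D(2)] D(1) mm_le[OF D(1)]] A(4) D(3,4)] .
  then have "len (sprod \<mm> ?D) ?M2 = 0" using t2 nu_max(1)[OF D(2)] by simp
  then have "?M2 = sprod \<mm> ?D" using len_0 fl_lat[OF lat_mm[OF D(2)] A(4) D(3)] by blast
  then show thesis using that[of "c \<otimes> c"] c2 by simp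
qed

end


section \<open>Lengths of quotient modules\<close>

context module
begin

lemma sub_abelian_subgroup: "sub N \<Longrightarrow> abelian_subgroup N M"
  by (intro abelian_subgroupI3 additive_subgroup.intro submodule.axioms(1) M.abelian_group_axioms)

text \<open>The additive monoid of \<open>quot_mod\<close> carries the same data as the factor group
  \<open>A_Mod\<close>, whose theory thereby becomes available.\<close>

lemma subgroup_quot_iff: "subgroup S (add_monoid (quot_mod M N)) \<longleftrightarrow> subgroup S (M A_Mod N)"
  by (simp add: subgroup_def m_inv_def A_FactGroup_def' quot_mod_def)

lemma coset_eq_iff:
  assumes "sub N" "x \<in> carrier M" "y \<in> carrier M"
  shows "N +>\<^bsub>M\<^esub> x = N +>\<^bsub>M\<^esub> y \<longleftrightarrow> x \<in> N +>\<^bsub>M\<^esub> y"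
proof -
  interpret N: abelian_subgroup N M using assms sub_abelian_subgroup by blast
  show ?thesis
    using N.a_rcos_self[OF assms(2)] a_repr_independence[OF _ assms(3) submodule.axioms(1)[OF assms(1)]]
    by auto
qed

lemma coset_memE:
  assumes "y \<in> N +>\<^bsub>M\<^esub> x" obtains n where "n \<in> N" "y = n \<oplus>\<^bsub>M\<^esub> x"
  using assms by (auto simp: a_r_coset_def')

lemma coset_memI: "n \<in> N \<Longrightarrow> n \<oplus>\<^bsub>M\<^esub> x \<in> N +>\<^bsub>M\<^esub> x"
  by (auto simp: a_r_coset_def')

lemma coset_subset: "sub A \<Longrightarrow> N \<subseteq> A \<Longrightarrow> x \<in> A \<Longrightarrow> N +>\<^bsub>M\<^esub> x \<subseteq> A"
  by (auto simp: a_r_coset_def' intro: sub_add)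

lemma smult_coset:
  assumes "sub N" "r \<in> carrier R" "x \<in> carrier M"
  shows "r \<odot>\<^bsub>quot_mod M N\<^esub> (N +>\<^bsub>M\<^esub> x) = N +>\<^bsub>M\<^esub> (r \<odot>\<^bsub>M\<^esub> x)"
proof -
  interpret N: abelian_subgroup N M using assms sub_abelian_subgroup by blast
  \<comment> \<open>All members of the union defining the scalar action coincide, as r n lies in N
    for n in N.\<close>
  have eq: "N +>\<^bsub>M\<^esub> (r \<odot>\<^bsub>M\<^esub> y) = N +>\<^bsub>M\<^esub> (r \<odot>\<^bsub>M\<^esub> x)" if "y \<in> N +>\<^bsub>M\<^esub> x" for y
  proof -
    obtain n where n: "n \<in> N" "y = n \<oplus>\<^bsub>M\<^esub> x" using \<open>y \<in> N +>\<^bsub>M\<^esub> x\<close> by (rule coset_memE)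
    have nc: "n \<in> carrier M" using n assms sub_carrier by blast
    then have "r \<odot>\<^bsub>M\<^esub> y = r \<odot>\<^bsub>M\<^esub> n \<oplus>\<^bsub>M\<^esub> r \<odot>\<^bsub>M\<^esub> x" using n assms smult_r_distr by simp
    moreover have "r \<odot>\<^bsub>M\<^esub> n \<in> N" using n assms sub_smult by blast
    ultimately have "r \<odot>\<^bsub>M\<^esub> y \<in> N +>\<^bsub>M\<^esub> (r \<odot>\<^bsub>M\<^esub> x)" using coset_memI by simp
    then show ?thesis using coset_eq_iff[OF assms(1), of "r \<odot>\<^bsub>M\<^esub> y" "r \<odot>\<^bsub>M\<^esub> x"] nc n assms by auto
  qed
  have "r \<odot>\<^bsub>quot_mod M N\<^esub> (N +>\<^bsub>M\<^esub> x) = (\<Union>y\<in>N +>\<^bsub>M\<^esub> x. N +>\<^bsub>M\<^esub> (r \<odot>\<^bsub>M\<^esub> y))"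
    by (simp add: quot_mod_def)
  also have "\<dots> = (\<Union>y\<in>N +>\<^bsub>M\<^esub> x. N +>\<^bsub>M\<^esub> (r \<odot>\<^bsub>M\<^esub> x))"
    by (intro SUP_cong refl eq)
  also have "\<dots> = N +>\<^bsub>M\<^esub> (r \<odot>\<^bsub>M\<^esub> x)"
    using N.a_rcos_self[OF assms(3)] by (intro SUP_const) blast
  finally show ?thesis .
qed

text \<open>One half of the correspondence theorem: the union of the cosets in S is the preimage of
  S in M. \<open>quot_submodule_image\<close> is the other half.\<close>

lemma quot_submodule_Union:
  assumes N: "sub N" and S: "submodule S R (quot_mod M N)"
  shows "S = (\<lambda>x. N +>\<^bsub>M\<^esub> x) ` \<Union>S" "sub (\<Union>S)" "N \<subseteq> \<Union>S"
proof -
  interpret N: abelian_subgroup N M using N sub_abelian_subgroup by blast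
  have sg: "subgroup S (M A_Mod N)" using submodule.axioms(1)[OF S] subgroup_quot_iff by blast
  have Sc: "S \<subseteq> (\<lambda>x. N +>\<^bsub>M\<^esub> x) ` carrier M"
    using subgroup.subset[OF sg] by (auto simp: A_FactGroup_def' A_RCOSETS_def')
  have mem: "C = N +>\<^bsub>M\<^esub> x \<and> x \<in> carrier M" if C: "C \<in> S" and x: "x \<in> C" for C x
  proof -
    obtain y where y: "y \<in> carrier M" "C = N +>\<^bsub>M\<^esub> y" using C Sc by blast
    have "x \<in> carrier M" using N.a_elemrcos_carrier[OF y(1)] x y(2) by blast
    then show ?thesis using coset_eq_iff[OF N] x y by blast
  qed
  have mem': "x \<in> \<Union>S" if "x \<in> carrier M" "N +>\<^bsub>M\<^esub> x \<in> S" for x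
    using N.a_rcos_self that by blast
  have ex: "\<exists>x\<in>\<Union>S. C = N +>\<^bsub>M\<^esub> x" if "C \<in> S" for C
    using that Sc mem' by blast
  show eq: "S = (\<lambda>x. N +>\<^bsub>M\<^esub> x) ` \<Union>S"
  proof
    show "S \<subseteq> (\<lambda>x. N +>\<^bsub>M\<^esub> x) ` \<Union>S" using ex by blast
    show "(\<lambda>x. N +>\<^bsub>M\<^esub> x) ` \<Union>S \<subseteq> S" using mem by fastforce
  qed
  have NS: "N \<in> S" using subgroup.one_closed[OF sg] by (simp add: A_FactGroup_def')
  then show "N \<subseteq> \<Union>S" by blast
  show "sub (\<Union>S)"
  proof (rule subI)
    show "\<Union>S \<subseteq> carrier M" using mem by blast
    show "\<zero>\<^bsub>M\<^esub> \<in> \<Union>S" using NS sub_zero[OF N] by blast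
  next
    fix a b assume "a \<in> \<Union>S" "b \<in> \<Union>S"
    then have ab: "N +>\<^bsub>M\<^esub> a \<in> S" "N +>\<^bsub>M\<^esub> b \<in> S" "a \<in> carrier M" "b \<in> carrier M"
      using mem by blast+
    then have "N +>\<^bsub>M\<^esub> (a \<oplus>\<^bsub>M\<^esub> b) \<in> S"
      using subgroup.m_closed[OF sg ab(1,2)] N.a_rcos_sum by simp
    then show "a \<oplus>\<^bsub>M\<^esub> b \<in> \<Union>S" using mem' ab by blast
  next
    fix r x assume r: "r \<in> carrier R" and "x \<in> \<Union>S"
    then have x: "N +>\<^bsub>M\<^esub> x \<in> S" "x \<in> carrier M" using mem by blast+
    have "r \<odot>\<^bsub>quot_mod M N\<^esub> (N +>\<^bsub>M\<^esub> x) \<in> S"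
      using submodule.smult_closed[OF S r x(1)] .
    then show "r \<odot>\<^bsub>M\<^esub> x \<in> \<Union>S" using mem' smult_coset[OF N r x(2)] r x by auto
  qed
qed

lemma quot_submodule_image:
  assumes N: "sub N" and A: "sub A" "N \<subseteq> A"
  shows "submodule ((\<lambda>x. N +>\<^bsub>M\<^esub> x) ` A) R (quot_mod M N)"
proof -
  interpret N: abelian_subgroup N M using N sub_abelian_subgroup by blast
  let ?S = "(\<lambda>x. N +>\<^bsub>M\<^esub> x) ` A"
  have Ac: "A \<subseteq> carrier M" using A sub_subset by blast
  have Sc: "?S \<subseteq> carrier (M A_Mod N)" using Ac by (auto simp: A_FactGroup_def' A_RCOSETS_def')
  have "subgroup ?S (M A_Mod N)"
  proof (rule group.subgroupI[OF N.a_factorgroup_is_group Sc])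
    show "?S \<noteq> {}" using sub_zero[OF A(1)] by blast
  next
    fix C assume "C \<in> ?S"
    then obtain a where a: "a \<in> A" "C = N +>\<^bsub>M\<^esub> a" by blast
    have "inv\<^bsub>M A_Mod N\<^esub> C = a_set_inv\<^bsub>M\<^esub> (N +>\<^bsub>M\<^esub> a)"
      using N.a_inv_FactGroup[OF subsetD[OF Sc \<open>C \<in> ?S\<close>]] a(2) by simp
    also have "\<dots> = N +>\<^bsub>M\<^esub> (\<ominus>\<^bsub>M\<^esub> a)" by (rule N.a_rcos_inv[OF subsetD[OF Ac a(1)]])
    finally show "inv\<^bsub>M A_Mod N\<^esub> C \<in> ?S" using a A sub_neg by blast
  next
    fix C D assume "C \<in> ?S" "D \<in> ?S"
    then obtain a b where ab: "a \<in> A" "C = N +>\<^bsub>M\<^esub> a" "b \<in> A" "D = N +>\<^bsub>M\<^esub> b" by blast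
    then have "C \<otimes>\<^bsub>M A_Mod N\<^esub> D = N +>\<^bsub>M\<^esub> (a \<oplus>\<^bsub>M\<^esub> b)"
      using N.a_rcos_sum Ac by auto
    then show "C \<otimes>\<^bsub>M A_Mod N\<^esub> D \<in> ?S" using ab A sub_add by blast
  qed
  then have "subgroup ?S (add_monoid (quot_mod M N))" using subgroup_quot_iff by blast
  moreover have "submodule_axioms ?S R (quot_mod M N)"
  proof
    fix r C assume r: "r \<in> carrier R" and "C \<in> ?S"
    then obtain a where a: "a \<in> A" "C = N +>\<^bsub>M\<^esub> a" by blast
    then show "r \<odot>\<^bsub>quot_mod M N\<^esub> C \<in> ?S"
      using smult_coset[OF N r] Ac sub_smult[OF A(1) r] by auto
  qed
  ultimately show ?thesis by (rule submodule.intro)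
qed

lemma length_quot:
  assumes "fl N (carrier M)"
  shows "length_mod R (quot_mod M N) = enat (len N (carrier M))"
proof -
  have N: "sub N" using assms fl_sub by blast
  interpret N: abelian_subgroup N M using N sub_abelian_subgroup by blast
  let ?Q = "quot_mod M N" and ?p = "\<lambda>x. N +>\<^bsub>M\<^esub> x"
  have up: "n \<le> len N (carrier M)"
    if F: "\<forall>i\<le>n. submodule (F i) R ?Q" "\<forall>i<n. F i \<subset> F (Suc i)" for n and F :: "nat \<Rightarrow> 'c set set"
  proof -
    have "k \<le> n \<Longrightarrow> chn (\<Union>(F 0)) (\<Union>(F k)) k" for k
    proof (induction k)
      case 0
      then show ?case using quot_submodule_Union(2)[OF N] F by (auto intro!: chn.base)
    next
      case (Suc k)
      have s: "submodule (F k) R ?Q" "submodule (F (Suc k)) R ?Q" "F k \<subset> F (Suc k)" using Suc F by auto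
      have "\<Union>(F k) \<noteq> \<Union>(F (Suc k))"
        using s quot_submodule_Union(1)[OF N] by (metis psubset_eq)
      then have "\<Union>(F k) \<subset> \<Union>(F (Suc k))" using s by blast
      then show ?case using Suc quot_submodule_Union(2)[OF N s(2)] by (intro chn.step) auto
    qed
    then have c: "chn (\<Union>(F 0)) (\<Union>(F n)) n" by simp
    \<comment> \<open>A chain in the quotient may start above zero and stop below the top; m and m'
      fill both gaps.\<close>
    have s: "submodule (F 0) R ?Q" using F by simp
    obtain m where m: "chn N (\<Union>(F 0)) m"
      using chn_ex[OF N quot_submodule_Union(2,3)[OF N s]] by blast
    obtain m' where m': "chn (\<Union>(F n)) (carrier M) m'"
      using chn_ex[OF _ carrier_is_submodule, of "\<Union>(F n)"] chn_sub[OF c] sub_subset by blast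
    have "m + (n + m') \<le> len N (carrier M)"
      using len_upper[OF assms chn_trans[OF chn_trans[OF m' c] m]] .
    then show ?thesis by simp
  qed
  have ex: "\<exists>F :: nat \<Rightarrow> 'c set set. (\<forall>i\<le>n. submodule (F i) R ?Q) \<and> (\<forall>i<n. F i \<subset> F (Suc i)) \<and> F n = ?p ` A"
    if "chn N A n" for A n
    using that
  proof (induction rule: chn.induct)
    case base
    then show ?case using quot_submodule_image[OF N N] by (intro exI[of _ "\<lambda>_. ?p ` N"]) auto
  next
    case (step A n A')
    then obtain F where F: "\<forall>i\<le>n. submodule (F i) R ?Q" "\<forall>i<n. F i \<subset> F (Suc i)" "F n = ?p ` A" by blast
    have A: "sub A" "N \<subseteq> A" using chn_sub[OF step.hyps(1)] by auto
    have s': "submodule (?p ` A') R ?Q"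
      using A(2) step.hyps(3) by (intro quot_submodule_image[OF N step.hyps(2)]) auto
    obtain x where x: "x \<in> A'" "x \<notin> A" using step by blast
    have "?p x \<notin> ?p ` A"
    proof
      assume "?p x \<in> ?p ` A"
      then obtain y where y: "y \<in> A" "?p x = ?p y" by blast
      then have "x \<in> ?p y" using N.a_rcos_self sub_carrier[OF step.hyps(2) x(1)] by blast
      then show False using x coset_subset[OF A y(1)] by blast
    qed
    moreover have "?p x \<in> ?p ` A'" using x(1) by (rule imageI)
    moreover have "?p ` A \<subseteq> ?p ` A'" using step.hyps(3) by (intro image_mono) auto
    ultimately have "?p ` A \<subset> ?p ` A'" by (metis psubsetI)
    then show ?case
      using F s' by (intro exI[of _ "\<lambda>i. if i \<le> n then F i else ?p ` A'"]) (auto simp: le_Suc_eq less_Suc_eq)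
  qed
  show ?thesis
  proof (rule antisym)
    show "length_mod R ?Q \<le> enat (len N (carrier M))"
      unfolding length_mod_def using up by (intro Sup_least) auto
    show "enat (len N (carrier M)) \<le> length_mod R ?Q"
      unfolding length_mod_def using ex[OF chn_len[OF assms]] by (intro Sup_upper) blast
  qed
qed

end


section \<open>Noetherian local domains of dimension one\<close>

lemma (in noetherian_ring) ideal_maximal_element:
  assumes "S \<noteq> {}" "S \<subseteq> {I. ideal I R}"
  shows "\<exists>I\<in>S. \<forall>J\<in>S. I \<subseteq> J \<longrightarrow> J = I"
proof (rule subset_Zorn_nonempty[OF assms(1)])
  fix C assume C: "C \<noteq> {}" "subset.chain S C"
  from C(2) have "subset.chain {I. ideal I R} C" using subset_trans[OF _ assms(2)] by (simp add: subset_chain_def)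
  then have "\<Union>C \<in> C" by (rule ideal_chain_is_trivial[OF C(1)])
  then show "\<Union>C \<in> S" using C(2) by (auto simp: subset_chain_def)
qed

context
  fixes R :: "('a, 'm) ring_scheme" (structure)
  assumes local: "noetherian_local R"
begin

interpretation cring R using local by (simp add: noetherian_local_def)
interpretation noetherian_ring R using local by (simp add: noetherian_local_def)

lemma max_ideal_maximal: "maximalideal (max_ideal R) R"
  unfolding max_ideal_def
  by (rule theI'[of "\<lambda>I. maximalideal I R"]) (use local in \<open>simp add: noetherian_local_def\<close>)

lemma max_ideal_unique: "maximalideal I R \<Longrightarrow> I = max_ideal R"
  using local max_ideal_maximal unfolding noetherian_local_def by blast

lemma max_ideal_ideal: "ideal (max_ideal R) R"
  using max_ideal_maximal maximalideal.axioms(1) by blast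

lemma one_notin_max_ideal: "\<one> \<notin> max_ideal R"
  using maximalideal.I_notcarr[OF max_ideal_maximal] ideal.one_imp_carrier[OF max_ideal_ideal] by blast

text \<open>The Noetherian condition provides a maximal member J among the proper ideals above I;
  such a J is a maximal ideal, and there is only one.\<close>

lemma ideal_le_max_ideal:
  assumes I: "ideal I R" "\<one> \<notin> I"
  shows "I \<subseteq> max_ideal R"
proof -
  let ?S = "{J. ideal J R \<and> I \<subseteq> J \<and> \<one> \<notin> J}"
  have "?S \<noteq> {}" using I by auto
  then have "\<exists>J\<in>?S. \<forall>K\<in>?S. J \<subseteq> K \<longrightarrow> K = J" by (rule ideal_maximal_element) auto
  then obtain J where J: "ideal J R" "I \<subseteq> J" "\<one> \<notin> J"
    and max: "\<And>K. ideal K R \<Longrightarrow> I \<subseteq> K \<Longrightarrow> \<one> \<notin> K \<Longrightarrow> J \<subseteq> K \<Longrightarrow> K = J" by auto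
  have "maximalideal J R"
  proof (rule maximalidealI[OF J(1)])
    show "carrier R \<noteq> J" using J by auto
    fix K assume K: "ideal K R" "J \<subseteq> K" "K \<subseteq> carrier R"
    then show "K = J \<or> K = carrier R"
      using max[OF K(1)] J ideal.one_imp_carrier[OF K(1)] by auto
  qed
  then show ?thesis using max_ideal_unique J by blast
qed

lemma not_max_ideal_unit:
  assumes "a \<in> carrier R" "a \<notin> max_ideal R"
  shows "a \<in> Units R"
proof -
  have "\<one> \<in> PIdl a"
    using ideal_le_max_ideal[OF cgenideal_ideal[OF assms(1)]] cgenideal_self[OF assms(1)] assms by blast
  then obtain b where "b \<in> carrier R" "\<one> = b \<otimes> a" by (auto simp: cgenideal_def)
  then show ?thesis unfolding Units_def using assms m_comm by force
qed

lemma primeideal_le_max_ideal: "primeideal P R \<Longrightarrow> P \<subseteq> max_ideal R"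
  using ideal_le_max_ideal ideal.one_imp_carrier primeideal.I_notcarr primeideal.axioms(1) by metis

lemma ideal_power_is_ideal: "ideal I R \<Longrightarrow> ideal (ideal_power R I n) R"
  by (induction n) (auto simp: ideal_power_def oneideal ideal_prod_is_ideal)

lemma ideal_power_add:
  assumes "ideal I R"
  shows "ideal_power R I (m + n) = ideal_power R I m \<cdot> ideal_power R I n"
proof (induction m)
  case 0
  have "ideal_power R I n \<cdot> carrier R = ideal_power R I n"
    using ideal_prod_one ideal_power_is_ideal[OF assms] by blast
  then have "carrier R \<cdot> ideal_power R I n = ideal_power R I n"
    using ideal_prod_commute[OF oneideal ideal_power_is_ideal[OF assms]] by simp
  then show ?case by (simp add: ideal_power_def)
next
  case (Suc m)
  then show ?case
    using ideal_prod_assoc[OF assms ideal_power_is_ideal[OF assms] ideal_power_is_ideal[OF assms]]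
    by (simp add: ideal_power_def)
qed

lemma krull_dim_one:
  assumes "krull_dim R = 1"
  shows "\<exists>P P'. primeideal P R \<and> primeideal P' R \<and> P \<subset> P'"
    and "\<lbrakk>primeideal P R; primeideal P' R; primeideal P'' R; P \<subset> P'; P' \<subset> P''\<rbrakk> \<Longrightarrow> False"
proof -
  let ?chain = "\<lambda>n. \<exists>P :: nat \<Rightarrow> 'a set. (\<forall>i\<le>n. primeideal (P i) R) \<and> (\<forall>i<n. P i \<subset> P (Suc i))"
  show "\<exists>P P'. primeideal P R \<and> primeideal P' R \<and> P \<subset> P'"
  proof (rule ccontr)
    assume no: "\<not> ?thesis"
    have "n = 0" if ch: "?chain n" for n
    proof (rule ccontr)
      assume "n \<noteq> 0"
      moreover obtain P :: "nat \<Rightarrow> 'a set" where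
        "\<forall>i\<le>n. primeideal (P i) R" "\<forall>i<n. P i \<subset> P (Suc i)" using ch by blast
      ultimately have "primeideal (P 0) R" "primeideal (P 1) R" "P 0 \<subset> P 1" by auto
      then show False using no by blast
    qed
    then have "krull_dim R \<le> 0"
      unfolding krull_dim_def by (intro Sup_least) (auto simp: zero_enat_def)
    then show False using assms by simp
  qed
  assume P: "primeideal P R" "primeideal P' R" "primeideal P'' R" "P \<subset> P'" "P' \<subset> P''"
  define F where "F i = (if i = 0 then P else if i = 1 then P' else P'')" for i :: nat
  have "?chain 2"
    using P by (intro exI[of _ F]) (auto simp: F_def less_2_cases_iff)
  then have "enat 2 \<le> krull_dim R"
    unfolding krull_dim_def by (intro Sup_upper) blast
  then show False using assms by (simp add: one_enat_def)
qed

lemma max_ideal_nonzero: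
  assumes "krull_dim R = 1"
  shows "\<exists>a\<in>max_ideal R. a \<noteq> \<zero>"
proof -
  obtain P P' where P: "primeideal P R" "primeideal P' R" "P \<subset> P'"
    using krull_dim_one(1)[OF assms] by blast
  then obtain a where "a \<in> P'" "a \<notin> P" by blast
  moreover have "\<zero> \<in> P"
    using additive_subgroup.zero_closed[OF ideal.axioms(1)[OF primeideal.axioms(1)[OF P(1)]]] .
  ultimately have "a \<noteq> \<zero>" "a \<in> max_ideal R" using primeideal_le_max_ideal[OF P(2)] by auto
  then show ?thesis by blast
qed

text \<open>Otherwise choose P maximal among the ideals that contain r and no power of \<mm>. If I
  and J are not inside P, then P + I and P + J contain powers of \<mm>, and so does P + I J; hence P
  is prime. From 0 \<noteq> P \<subseteq> \<mm> and dimension one, P = \<mm>, a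
  contradiction.\<close>

lemma ideal_power_le_principal:
  assumes dim: "krull_dim R = 1" and dom: "domain R" and r: "r \<in> carrier R" "r \<noteq> \<zero>"
  shows "\<exists>k. ideal_power R (max_ideal R) k \<subseteq> (\<lambda>s. r \<otimes> s) ` carrier R"
proof (rule ccontr)
  assume no: "\<not> ?thesis"
  let ?m = "ideal_power R (max_ideal R)"
  let ?S = "{I. ideal I R \<and> r \<in> I \<and> (\<forall>k. \<not> ?m k \<subseteq> I)}"
  have "PIdl r = (\<lambda>s. r \<otimes> s) ` carrier R"
    using r m_comm by (auto simp: cgenideal_def image_iff)
  then have "PIdl r \<in> ?S" using no cgenideal_ideal[OF r(1)] cgenideal_self[OF r(1)] by simp
  then have "\<exists>J\<in>?S. \<forall>K\<in>?S. J \<subseteq> K \<longrightarrow> K = J" by (intro ideal_maximal_element) auto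
  then obtain P where PS: "P \<in> ?S" and mx: "\<forall>K\<in>?S. P \<subseteq> K \<longrightarrow> K = P" ..
  then have P: "ideal P R" "r \<in> P" "\<And>k. \<not> ?m k \<subseteq> P" by simp_all
  have max: "\<exists>k. ?m k \<subseteq> K" if "ideal K R" "r \<in> K" "P \<subset> K" for K
  proof (rule ccontr)
    assume "\<not> ?thesis"
    then have "K \<in> ?S" using that by simp
    then show False using mx that(3) by blast
  qed
  have "primeideal P R"
  proof (rule divides_ideal_prod_imp_primeideal[OF P(1)])
    \<comment> \<open>The zeroth power of \<mm> is the whole ring, so P is proper.\<close>
    show "P \<noteq> carrier R" using P(3)[of 0] by (auto simp: ideal_power_def)
    fix I J assume I: "ideal I R" and J: "ideal J R" and IJ: "I \<cdot> J \<subseteq> P"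
    show "I \<subseteq> P \<or> J \<subseteq> P"
    proof (rule ccontr)
      assume neg: "\<not> ?thesis"
      have pow: "\<exists>k. ?m k \<subseteq> P <+> K" if K: "ideal K R" "\<not> K \<subseteq> P" for K
      proof (rule max)
        have 1: "P \<subseteq> P <+> K"
        proof
          fix p assume p: "p \<in> P"
          have "p \<oplus> \<zero> \<in> P <+> K" unfolding set_add_def'
            using p additive_subgroup.zero_closed[OF ideal.axioms(1)[OF K(1)]] by blast
          then show "p \<in> P <+> K" using p ideal.Icarr[OF P(1)] by simp
        qed
        have 2: "K \<subseteq> P <+> K"
        proof
          fix p assume p: "p \<in> K"
          have "\<zero> \<oplus> p \<in> P <+> K" unfolding set_add_def'
            using p additive_subgroup.zero_closed[OF ideal.axioms(1)[OF P(1)]] by blast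
          then show "p \<in> P <+> K" using p ideal.Icarr[OF K(1)] by simp
        qed
        show "P \<subset> P <+> K" "r \<in> P <+> K" using 1 2 K P by blast+
        show "ideal (P <+> K) R" by (rule add_ideals[OF P(1) K(1)])
      qed
      obtain k l where kl: "?m k \<subseteq> P <+> I" "?m l \<subseteq> P <+> J" using pow I J neg by blast
      have "?m (k + l) \<subseteq> P"
      proof
        fix s assume "s \<in> ?m (k + l)"
        then have "s \<in> ?m k \<cdot> ?m l" by (simp add: ideal_power_add[OF max_ideal_ideal])
        then show "s \<in> P"
        proof (induction rule: ideal_prod.induct)
          case (prod i j)
          obtain p a where pa: "p \<in> P" "a \<in> I" "i = p \<oplus> a" using prod kl by (auto simp: set_add_def')
          obtain q b where qb: "q \<in> P" "b \<in> J" "j = q \<oplus> b" using prod kl by (auto simp: set_add_def')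
          have c: "p \<in> carrier R" "q \<in> carrier R" "a \<in> carrier R" "b \<in> carrier R"
            using pa qb ideal.Icarr[OF P(1)] ideal.Icarr[OF I] ideal.Icarr[OF J] by auto
          have "i \<otimes> j = p \<otimes> (q \<oplus> b) \<oplus> (a \<otimes> q \<oplus> a \<otimes> b)"
            unfolding pa(3) qb(3) using l_distr[of p a "q \<oplus> b"] r_distr[of q b a] c by simp
          moreover have "p \<otimes> (q \<oplus> b) \<in> P" "a \<otimes> q \<in> P" "a \<otimes> b \<in> P"
            using c pa qb ideal.I_r_closed[OF P(1)] ideal.I_l_closed[OF P(1)] subsetD[OF IJ ideal_prod.prod[of a I b J]]
            by auto
          ultimately show ?case
            using additive_subgroup.a_closed[OF ideal.axioms(1)[OF P(1)]] by simp
        next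
          case (sum s1 s2)
          then show ?case using additive_subgroup.a_closed[OF ideal.axioms(1)[OF P(1)]] by simp
        qed
      qed
      then show False using P(3) by blast
    qed
  qed
  moreover have "{\<zero>} \<subset> P"
    using P r additive_subgroup.zero_closed[OF ideal.axioms(1)[OF P(1)]] by blast
  moreover have "primeideal (max_ideal R) R"
    using maximalideal_prime[OF max_ideal_maximal] .
  ultimately have "P = max_ideal R"
    using krull_dim_one(2)[OF dim domain.zeroprimeideal[OF dom], of P "max_ideal R"]
      primeideal_le_max_ideal by blast
  then have "?m 1 \<subseteq> P"
    using ideal_prod_one[OF max_ideal_ideal] by (simp add: ideal_power_def)
  then show False using P(3) by blast
qed

end

theorem multiplicity_eq_nu_max:
  fixes R :: "('a, 'm) ring_scheme" and M :: "('a, 'b, 'n) module_scheme"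
  assumes local: "noetherian_local R" and dom: "domain R" and dim: "krull_dim R = 1"
    and mod: "module R M" and fg: "fin_gen R M" and tf: "torsionfree R M"
  shows "lattice_module R M (max_ideal R)"
    and "multiplicity_mod R M = real (lattice_module.nu_max R M (max_ideal R))"
proof -
  show lm: "lattice_module R M (max_ideal R)"
  proof (intro lattice_module.intro local_module.intro local_module_axioms.intro lattice_module_axioms.intro)
    show "noetherian_ring R" using local by (simp add: noetherian_local_def)
    show "module.fg R M (carrier M)" using fg module.fg_def[OF mod] by (simp add: fin_gen_def)
  qed (fact mod dom tf max_ideal_ideal[OF local] one_notin_max_ideal[OF local]
      not_max_ideal_unit[OF local] max_ideal_nonzero[OF local dim]
      ideal_power_le_principal[OF local dim dom])+
  interpret lattice_module R M "max_ideal R" by (rule lm)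
  have eq: "ideal_smult R (ideal_power R (max_ideal R) n) M = mpow n (carrier M)" for n
    using sprod_ideal_power[OF carrier_is_submodule] by (simp add: ideal_smult_def sprod_def)
  \<comment> \<open>In dimension one the normalizing factor is 1 / n.\<close>
  have "multiplicity_mod R M = lim (\<lambda>n. real (len (mpow n (carrier M)) (carrier M)) / real n)"
    using length_quot[OF fl_mpow] by (simp add: multiplicity_mod_def dim eq one_enat_def)
  then show "multiplicity_mod R M = real nu_max" using limI[OF hilbert_samuel_limit] by simp
qed


section \<open>Homomorphisms\<close>

lemma mod_homs_closed: "f \<in> mod_homs R M N \<Longrightarrow> x \<in> carrier M \<Longrightarrow> f x \<in> carrier N"
  by (auto simp: mod_homs_def)

lemma mod_homs_add:
  "f \<in> mod_homs R M N \<Longrightarrow> x \<in> carrier M \<Longrightarrow> y \<in> carrier M \<Longrightarrow> f (x \<oplus>\<^bsub>M\<^esub> y) = f x \<oplus>\<^bsub>N\<^esub> f y"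
  by (auto simp: mod_homs_def)

lemma mod_homs_smult:
  "f \<in> mod_homs R M N \<Longrightarrow> r \<in> carrier R \<Longrightarrow> x \<in> carrier M \<Longrightarrow> f (r \<odot>\<^bsub>M\<^esub> x) = r \<odot>\<^bsub>N\<^esub> f x"
  by (auto simp: mod_homs_def)

lemma mod_homs_zero:
  assumes "module R M" "module R N" "f \<in> mod_homs R M N"
  shows "f \<zero>\<^bsub>M\<^esub> = \<zero>\<^bsub>N\<^esub>"
proof -
  interpret M: module R M by fact
  interpret N: module R N by fact
  have "f (\<zero>\<^bsub>R\<^esub> \<odot>\<^bsub>M\<^esub> \<zero>\<^bsub>M\<^esub>) = \<zero>\<^bsub>R\<^esub> \<odot>\<^bsub>N\<^esub> f \<zero>\<^bsub>M\<^esub>"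
    by (rule mod_homs_smult[OF assms(3)]) auto
  then show ?thesis using mod_homs_closed[OF assms(3)] by simp
qed

lemma mod_homs_restrictI:
  assumes "module R M"
    and "\<And>x. x \<in> carrier M \<Longrightarrow> f x \<in> carrier N"
    and "\<And>x y. x \<in> carrier M \<Longrightarrow> y \<in> carrier M \<Longrightarrow> f (x \<oplus>\<^bsub>M\<^esub> y) = f x \<oplus>\<^bsub>N\<^esub> f y"
    and "\<And>r x. r \<in> carrier R \<Longrightarrow> x \<in> carrier M \<Longrightarrow> f (r \<odot>\<^bsub>M\<^esub> x) = r \<odot>\<^bsub>N\<^esub> f x"
  shows "restrict f (carrier M) \<in> mod_homs R M N"
proof -
  interpret M: module R M by fact
  show ?thesis using assms(2-4) by (auto simp: mod_homs_def)
qed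

lemma mod_homs_comp:
  assumes "module R M" "f \<in> mod_homs R M N" "g \<in> mod_homs R N L"
  shows "(\<lambda>x\<in>carrier M. g (f x)) \<in> mod_homs R M L"
  using assms by (intro mod_homs_restrictI) (auto simp: mod_homs_closed mod_homs_add mod_homs_smult)

lemma submodule_equalizer:
  assumes "module R M" "module R N" "f \<in> mod_homs R M N" "g \<in> mod_homs R M N"
  shows "submodule {x \<in> carrier M. f x = g x} R M"
proof -
  interpret M: module R M by fact
  have "f \<zero>\<^bsub>M\<^esub> = g \<zero>\<^bsub>M\<^esub>"
    using mod_homs_zero[OF assms(1,2,3)] mod_homs_zero[OF assms(1,2,4)] by simp
  then show ?thesis
    using assms by (intro M.subI) (auto simp: mod_homs_add mod_homs_smult)
qed

lemma submodule_ker: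
  assumes "module R M" "module R N" "f \<in> mod_homs R M N"
  shows "submodule (mod_ker M N f) R M"
proof -
  interpret M: module R M by fact
  interpret N: module R N by fact
  show ?thesis
    using assms mod_homs_zero[OF assms]
    by (intro M.subI) (auto simp: mod_ker_def mod_homs_add mod_homs_smult)
qed

text \<open>Single-valuedness need only be tested at zero: if T relates x to y and y', it relates x
  - x to y - y'.\<close>

lemma hom_of_graph:
  assumes "module R M" "module R N"
    and total: "\<And>x. x \<in> carrier M \<Longrightarrow> \<exists>y\<in>carrier N. T x y"
    and add: "\<And>x x' y y'. x \<in> carrier M \<Longrightarrow> x' \<in> carrier M \<Longrightarrow> y \<in> carrier N \<Longrightarrow> y' \<in> carrier N \<Longrightarrow>
      T x y \<Longrightarrow> T x' y' \<Longrightarrow> T (x \<oplus>\<^bsub>M\<^esub> x') (y \<oplus>\<^bsub>N\<^esub> y')"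
    and smult: "\<And>r x y. r \<in> carrier R \<Longrightarrow> x \<in> carrier M \<Longrightarrow> y \<in> carrier N \<Longrightarrow>
      T x y \<Longrightarrow> T (r \<odot>\<^bsub>M\<^esub> x) (r \<odot>\<^bsub>N\<^esub> y)"
    and zero: "\<And>y. y \<in> carrier N \<Longrightarrow> T \<zero>\<^bsub>M\<^esub> y \<Longrightarrow> y = \<zero>\<^bsub>N\<^esub>"
  obtains f where "f \<in> mod_homs R M N" "\<And>x. x \<in> carrier M \<Longrightarrow> T x (f x)"
    "\<And>x y. x \<in> carrier M \<Longrightarrow> y \<in> carrier N \<Longrightarrow> T x y \<Longrightarrow> f x = y"
proof -
  interpret M: module R M by fact
  interpret N: module R N by fact
  have unique: "y = y'" if "x \<in> carrier M" "y \<in> carrier N" "y' \<in> carrier N" "T x y" "T x y'" for x y y'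
  proof -
    let ?u = "\<ominus>\<^bsub>R\<^esub> \<one>\<^bsub>R\<^esub>"
    have "T (x \<oplus>\<^bsub>M\<^esub> ?u \<odot>\<^bsub>M\<^esub> x) (y \<oplus>\<^bsub>N\<^esub> ?u \<odot>\<^bsub>N\<^esub> y')"
      using that by (intro add smult) auto
    moreover have "x \<oplus>\<^bsub>M\<^esub> ?u \<odot>\<^bsub>M\<^esub> x = \<zero>\<^bsub>M\<^esub>" using that by (simp add: M.smult_l_minus M.M.r_neg)
    moreover have eq: "?u \<odot>\<^bsub>N\<^esub> y' = \<ominus>\<^bsub>N\<^esub> y'" using that by (simp add: N.smult_l_minus)
    ultimately have "y \<oplus>\<^bsub>N\<^esub> \<ominus>\<^bsub>N\<^esub> y' = \<zero>\<^bsub>N\<^esub>" using zero that by simp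
    then show ?thesis using that by (metis N.M.add.inv_closed N.M.minus_equality N.M.minus_minus)
  qed
  define f where "f x = (SOME y. y \<in> carrier N \<and> T x y)" for x
  have f: "f x \<in> carrier N \<and> T x (f x)" if "x \<in> carrier M" for x
    unfolding f_def using someI_ex[OF total[OF that, unfolded Bex_def]] .
  show thesis
  proof
    show "restrict f (carrier M) \<in> mod_homs R M N"
    proof (rule mod_homs_restrictI[OF assms(1)])
      fix x y assume xy: "x \<in> carrier M" "y \<in> carrier M"
      show "f (x \<oplus>\<^bsub>M\<^esub> y) = f x \<oplus>\<^bsub>N\<^esub> f y"
        using f[OF xy(1)] f[OF xy(2)] f[of "x \<oplus>\<^bsub>M\<^esub> y"] xy add
        by (intro unique[of "x \<oplus>\<^bsub>M\<^esub> y"]) auto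
    next
      fix r x assume rx: "r \<in> carrier R" "x \<in> carrier M"
      show "f (r \<odot>\<^bsub>M\<^esub> x) = r \<odot>\<^bsub>N\<^esub> f x"
        using f[OF rx(2)] f[of "r \<odot>\<^bsub>M\<^esub> x"] rx smult
        by (intro unique[of "r \<odot>\<^bsub>M\<^esub> x"]) auto
    qed (use f in blast)
    show "T x (restrict f (carrier M) x)" if "x \<in> carrier M" for x using f that by simp
    show "restrict f (carrier M) x = y" if "x \<in> carrier M" "y \<in> carrier N" "T x y" for x y
      using f[OF that(1)] unique that by simp
  qed
qed


section \<open>Free modules\<close>

lemma (in module) finsum_extend:
  assumes "finite B" "A \<subseteq> B" "c \<in> A \<rightarrow> carrier R" "h \<in> B \<rightarrow> carrier M"
  shows "(\<Oplus>\<^bsub>M\<^esub>b\<in>B. (if b \<in> A then c b else \<zero>) \<odot>\<^bsub>M\<^esub> h b) = (\<Oplus>\<^bsub>M\<^esub>b\<in>A. c b \<odot>\<^bsub>M\<^esub> h b)"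
  using assms
  by (intro M.add.finprod_mono_neutral_cong_right) (auto simp: Pi_iff subset_iff)

text \<open>T relates a combination of basis elements to the same combination of their prescribed
  images. Linear independence says exactly that a representation of zero has zero coefficients,
  which is the test required by \<open>hom_of_graph\<close>.\<close>

lemma free_universal:
  assumes P: "module R P" and B: "B \<subseteq> carrier P" "lin_indep R P B" "gen_submodule R P B = carrier P"
    and N: "module R N" and h: "h \<in> B \<rightarrow> carrier N"
  obtains f where "f \<in> mod_homs R P N" "\<And>b. b \<in> B \<Longrightarrow> f b = h b"
proof -
  interpret P: module R P by fact
  interpret N: module R N by fact
  let ?s = "\<lambda>A c. \<Oplus>\<^bsub>P\<^esub>b\<in>A. c b \<odot>\<^bsub>P\<^esub> b" and ?t = "\<lambda>A c. \<Oplus>\<^bsub>N\<^esub>b\<in>A. c b \<odot>\<^bsub>N\<^esub> h b"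
  let ?coef = "\<lambda>A c. finite A \<and> A \<subseteq> B \<and> c \<in> A \<rightarrow> carrier R"
  define T where "T p y \<longleftrightarrow> (\<exists>A c. ?coef A c \<and> p = ?s A c \<and> y = ?t A c)" for p y
  have hc: "h b \<in> carrier N" if "b \<in> B" for b using h that by auto
  have bc: "b \<in> carrier P" if "b \<in> B" for b using B that by auto
  \<comment> \<open>Padding with zero coefficients brings two representations to a common support,
    where they can be added.\<close>
  have ext: "\<exists>c'. ?coef A' c' \<and> ?s A' c' = ?s A c \<and> ?t A' c' = ?t A c"
    if "?coef A c" "finite A'" "A \<subseteq> A'" "A' \<subseteq> B" for A A' c
    using that hc bc P.finsum_extend[of A' A c "\<lambda>b. b"] N.finsum_extend[of A' A c h]
    by (intro exI[of _ "\<lambda>b. if b \<in> A then c b else \<zero>\<^bsub>R\<^esub>"]) auto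
  have add: "T (x \<oplus>\<^bsub>P\<^esub> x') (y \<oplus>\<^bsub>N\<^esub> y')" if T: "T x y" "T x' y'" for x x' y y'
  proof -
    obtain A c where 1: "?coef A c" "x = ?s A c" "y = ?t A c" using T(1) unfolding T_def by blast
    obtain A' c' where 2: "?coef A' c'" "x' = ?s A' c'" "y' = ?t A' c'" using T(2) unfolding T_def by blast
    let ?A = "A \<union> A'"
    have A: "finite ?A" "?A \<subseteq> B" using 1 2 by auto
    obtain d where d: "?coef ?A d" "?s ?A d = x" "?t ?A d = y"
      using ext[OF 1(1) A(1) _ A(2)] 1 by auto
    obtain d' where d': "?coef ?A d'" "?s ?A d' = x'" "?t ?A d' = y'"
      using ext[OF 2(1) A(1) _ A(2)] 2 by auto
    have "?s ?A (\<lambda>b. d b \<oplus>\<^bsub>R\<^esub> d' b) = (\<Oplus>\<^bsub>P\<^esub>b\<in>?A. d b \<odot>\<^bsub>P\<^esub> b \<oplus>\<^bsub>P\<^esub> d' b \<odot>\<^bsub>P\<^esub> b)"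
      using d(1) d'(1) bc A by (intro P.M.finsum_cong') (auto simp: P.smult_l_distr Pi_iff)
    also have "\<dots> = x \<oplus>\<^bsub>P\<^esub> x'"
      using d d' bc A by (subst P.M.finsum_addf) (auto simp: Pi_iff)
    finally have s: "?s ?A (\<lambda>b. d b \<oplus>\<^bsub>R\<^esub> d' b) = x \<oplus>\<^bsub>P\<^esub> x'" .
    have "?t ?A (\<lambda>b. d b \<oplus>\<^bsub>R\<^esub> d' b) = (\<Oplus>\<^bsub>N\<^esub>b\<in>?A. d b \<odot>\<^bsub>N\<^esub> h b \<oplus>\<^bsub>N\<^esub> d' b \<odot>\<^bsub>N\<^esub> h b)"
      using d(1) d'(1) hc A by (intro N.M.finsum_cong') (auto simp: N.smult_l_distr Pi_iff subset_iff)
    also have "\<dots> = y \<oplus>\<^bsub>N\<^esub> y'"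
      using d d' hc A by (subst N.M.finsum_addf) (auto simp: Pi_iff subset_iff)
    finally have t: "?t ?A (\<lambda>b. d b \<oplus>\<^bsub>R\<^esub> d' b) = y \<oplus>\<^bsub>N\<^esub> y'" .
    show ?thesis
      unfolding T_def using d(1) d'(1) s t by (intro exI[of _ ?A] exI[of _ "\<lambda>b. d b \<oplus>\<^bsub>R\<^esub> d' b"]) auto
  qed
  have smult: "T (r \<odot>\<^bsub>P\<^esub> x) (r \<odot>\<^bsub>N\<^esub> y)" if r: "r \<in> carrier R" and T: "T x y" for r x y
  proof -
    obtain A c where 1: "?coef A c" "x = ?s A c" "y = ?t A c" using T unfolding T_def by blast
    have "r \<odot>\<^bsub>P\<^esub> x = (\<Oplus>\<^bsub>P\<^esub>b\<in>A. r \<odot>\<^bsub>P\<^esub> (c b \<odot>\<^bsub>P\<^esub> b))"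
      unfolding 1 using 1 r bc by (intro P.finsum_smult_ldistr) auto
    also have "\<dots> = ?s A (\<lambda>b. r \<otimes>\<^bsub>R\<^esub> c b)"
      using 1 r bc by (intro P.M.finsum_cong') (auto simp: P.smult_assoc1 Pi_iff subset_iff)
    finally have s: "r \<odot>\<^bsub>P\<^esub> x = ?s A (\<lambda>b. r \<otimes>\<^bsub>R\<^esub> c b)" .
    have "r \<odot>\<^bsub>N\<^esub> y = (\<Oplus>\<^bsub>N\<^esub>b\<in>A. r \<odot>\<^bsub>N\<^esub> (c b \<odot>\<^bsub>N\<^esub> h b))"
      unfolding 1 using 1 r hc by (intro N.finsum_smult_ldistr) auto
    also have "\<dots> = ?t A (\<lambda>b. r \<otimes>\<^bsub>R\<^esub> c b)"
      using 1 r hc by (intro N.M.finsum_cong') (auto simp: N.smult_assoc1 Pi_iff subset_iff)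
    finally have t: "r \<odot>\<^bsub>N\<^esub> y = ?t A (\<lambda>b. r \<otimes>\<^bsub>R\<^esub> c b)" .
    show ?thesis unfolding T_def using 1(1) r s t by (intro exI[of _ A] exI[of _ "\<lambda>b. r \<otimes>\<^bsub>R\<^esub> c b"]) auto
  qed
  have zero: "y = \<zero>\<^bsub>N\<^esub>" if T: "T x y" and x: "x = \<zero>\<^bsub>P\<^esub>" for x y
  proof -
    obtain A c where 1: "?coef A c" "x = ?s A c" "y = ?t A c" using T unfolding T_def by blast
    have "?s A c = \<zero>\<^bsub>P\<^esub>" using 1(2) x by metis
    then have "\<forall>b\<in>A. c b = \<zero>\<^bsub>R\<^esub>"
      using 1(1) by (intro B(2)[unfolded lin_indep_def, THEN spec, THEN spec, THEN mp]) simp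
    then have "?t A c = (\<Oplus>\<^bsub>N\<^esub>b\<in>A. \<zero>\<^bsub>N\<^esub>)" using 1 hc by (intro N.M.finsum_cong') auto
    then show ?thesis using 1 by simp
  qed
  have basis: "T b (h b)" if b: "b \<in> B" for b
    unfolding T_def using b bc[OF b] hc[OF b] by (intro exI[of _ "{b}"] exI[of _ "\<lambda>_. \<one>\<^bsub>R\<^esub>"]) (auto simp: Pi_iff)
  have Tc: "y \<in> carrier N" if "T x y" for x y
    using that hc unfolding T_def by (auto intro!: N.M.finsum_closed simp: Pi_iff subset_iff)
  have "submodule {x \<in> carrier P. \<exists>y. T x y} R P"
  proof (rule P.subI)
    have "T \<zero>\<^bsub>P\<^esub> \<zero>\<^bsub>N\<^esub>" 
      unfolding T_def by (intro exI[of _ "{}"] exI[of _ "\<lambda>_. \<one>\<^bsub>R\<^esub>"]) auto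
    then show "\<zero>\<^bsub>P\<^esub> \<in> {x \<in> carrier P. \<exists>y. T x y}" by blast
  next
    fix a b assume ab: "a \<in> {x \<in> carrier P. \<exists>y. T x y}" "b \<in> {x \<in> carrier P. \<exists>y. T x y}"
    then obtain y y' where "T a y" "T b y'" by blast
    from add[OF this] show "a \<oplus>\<^bsub>P\<^esub> b \<in> {x \<in> carrier P. \<exists>y. T x y}" using ab by blast
  next
    fix r a assume ra: "r \<in> carrier R" "a \<in> {x \<in> carrier P. \<exists>y. T x y}"
    then obtain y where "T a y" by blast
    from smult[OF ra(1) this] show "r \<odot>\<^bsub>P\<^esub> a \<in> {x \<in> carrier P. \<exists>y. T x y}" using ra by blast
  qed blast
  then have "gen_submodule R P B \<subseteq> {x \<in> carrier P. \<exists>y. T x y}"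
    using basis bc by (intro P.gen_least) blast+
  then have total: "\<exists>y\<in>carrier N. T x y" if "x \<in> carrier P" for x
    using that Tc B(3) by blast
  obtain f where f: "f \<in> mod_homs R P N"
    "\<And>x y. x \<in> carrier P \<Longrightarrow> y \<in> carrier N \<Longrightarrow> T x y \<Longrightarrow> f x = y"
    by (rule hom_of_graph[OF P N, of T])
       (erule total | erule (1) add | erule (1) smult | erule zero[OF _ refl] | blast)+
  then show thesis using that basis bc hc by blast
qed

text \<open>Sequences vanishing from n on: all ranks share the type
  \<open>nat \<Rightarrow> 'a\<close> that \<open>Ext_mod\<close> demands for resolutions.\<close>

definition free_pow :: "('a, 'm) ring_scheme \<Rightarrow> nat \<Rightarrow> ('a, nat \<Rightarrow> 'a) module" where
  "free_pow R n =
    \<lparr>carrier = {f. (\<forall>i<n. f i \<in> carrier R) \<and> (\<forall>i\<ge>n. f i = \<zero>\<^bsub>R\<^esub>)},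
     monoid.mult = undefined, one = undefined, zero = (\<lambda>i. \<zero>\<^bsub>R\<^esub>),
     add = (\<lambda>f g i. f i \<oplus>\<^bsub>R\<^esub> g i), smult = (\<lambda>r f i. r \<otimes>\<^bsub>R\<^esub> f i)\<rparr>"

definition unit_vec :: "('a, 'm) ring_scheme \<Rightarrow> nat \<Rightarrow> nat \<Rightarrow> 'a" where
  "unit_vec R j = (\<lambda>i. if i = j then \<one>\<^bsub>R\<^esub> else \<zero>\<^bsub>R\<^esub>)"

text \<open>Indexed by positions, so that repetitions among the \<open>g i\<close> are
  harmless.\<close>

primrec lin_comb :: "('a, 'b, 'n) module_scheme \<Rightarrow> nat \<Rightarrow> (nat \<Rightarrow> 'b) \<Rightarrow> (nat \<Rightarrow> 'a) \<Rightarrow> 'b" where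
  "lin_comb M 0 g f = \<zero>\<^bsub>M\<^esub>"
| "lin_comb M (Suc n) g f = lin_comb M n g f \<oplus>\<^bsub>M\<^esub> f n \<odot>\<^bsub>M\<^esub> g n"

lemma free_pow_simps:
  "zero (free_pow R n) = (\<lambda>i. \<zero>\<^bsub>R\<^esub>)" "f \<oplus>\<^bsub>free_pow R n\<^esub> g = (\<lambda>i. f i \<oplus>\<^bsub>R\<^esub> g i)"
  "r \<odot>\<^bsub>free_pow R n\<^esub> f = (\<lambda>i. r \<otimes>\<^bsub>R\<^esub> f i)"
  by (simp_all add: free_pow_def)

lemma free_pow_carrier:
  assumes "cring R"
  shows "f \<in> carrier (free_pow R n) \<longleftrightarrow> (\<forall>i. f i \<in> carrier R) \<and> (\<forall>i\<ge>n. f i = \<zero>\<^bsub>R\<^esub>)"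
proof -
  interpret cring R by fact
  show ?thesis unfolding free_pow_def by simp (metis linorder_not_less zero_closed)
qed

lemma free_pow_module: assumes "cring R" shows "module R (free_pow R n)"
proof -
  interpret cring R by fact
  note car = free_pow_carrier[OF assms]
  show ?thesis
  proof (rule moduleI[OF assms])
    show "abelian_group (free_pow R n)"
    proof (rule abelian_groupI)
      fix x assume "x \<in> carrier (free_pow R n)"
      then show "\<exists>y\<in>carrier (free_pow R n). y \<oplus>\<^bsub>free_pow R n\<^esub> x = \<zero>\<^bsub>free_pow R n\<^esub>"
        by (intro bexI[of _ "\<lambda>i. \<ominus>\<^bsub>R\<^esub> x i"]) (auto simp: car free_pow_simps l_neg)
    qed (auto simp: car free_pow_simps a_ac)
  qed (auto simp: car free_pow_simps l_distr r_distr m_assoc)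
qed

lemma unit_vec_carrier: "cring R \<Longrightarrow> j < n \<Longrightarrow> unit_vec R j \<in> carrier (free_pow R n)"
  by (auto simp: free_pow_carrier unit_vec_def cring.cring_simprules)

lemma free_pow_generated:
  assumes "cring R"
  shows "gen_submodule R (free_pow R n) (unit_vec R ` {..<n}) = carrier (free_pow R n)"
proof
  interpret cring R by fact
  interpret F: module R "free_pow R n" by (rule free_pow_module[OF assms])
  note car = free_pow_carrier[OF assms]
  have sub: "unit_vec R ` {..<n} \<subseteq> carrier (free_pow R n)"
    using unit_vec_carrier[OF assms] by auto
  let ?N = "F.gen (unit_vec R ` {..<n})"
  have N: "F.sub ?N" using F.gen_sub sub by blast
  show "?N \<subseteq> carrier (free_pow R n)" using N F.sub_subset by blast
  \<comment> \<open>Induction on the number k of leading coordinates that may be nonzero.\<close>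
  have "k \<le> n \<Longrightarrow> f \<in> carrier (free_pow R n) \<Longrightarrow> (\<And>i. i \<ge> k \<Longrightarrow> f i = \<zero>\<^bsub>R\<^esub>) \<Longrightarrow> f \<in> ?N" for k f
  proof (induction k arbitrary: f)
    case 0
    then have "f = \<zero>\<^bsub>free_pow R n\<^esub>" by (auto simp: free_pow_simps)
    then show ?case using F.sub_zero[OF N] by simp
  next
    case (Suc k)
    let ?g = "f(k := \<zero>\<^bsub>R\<^esub>)"
    have g: "?g \<in> ?N" using Suc by (intro Suc.IH) (auto simp: car)
    have u: "f k \<odot>\<^bsub>free_pow R n\<^esub> unit_vec R k \<in> ?N"
      using Suc F.gen_incl[of "unit_vec R ` {..<n}"] by (intro F.sub_smult[OF N]) (auto simp: car)
    have "f = ?g \<oplus>\<^bsub>free_pow R n\<^esub> f k \<odot>\<^bsub>free_pow R n\<^esub> unit_vec R k"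
      using Suc.prems by (intro ext) (auto simp: free_pow_simps unit_vec_def car)
    then show ?case using F.sub_add[OF N g u] by simp
  qed
  from this[of n] show "carrier (free_pow R n) \<subseteq> ?N" by (auto simp: car)
qed

lemma free_pow_free: assumes "cring R" shows "free_mod R (free_pow R n)"
proof -
  interpret cring R by fact
  interpret F: module R "free_pow R n" by (rule free_pow_module[OF assms])
  note car = free_pow_carrier[OF assms]
  have sub: "unit_vec R ` {..<n} \<subseteq> carrier (free_pow R n)"
    using unit_vec_carrier[OF assms] by auto
  have coord: "(\<Oplus>\<^bsub>free_pow R n\<^esub>b\<in>A. h b) k = (\<Oplus>\<^bsub>R\<^esub>b\<in>A. h b k)"
    if "finite A" "h \<in> A \<rightarrow> carrier (free_pow R n)" for A :: "(nat \<Rightarrow> 'a) set" and h k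
    using that
  proof (induction A rule: finite_induct)
    case empty
    then show ?case by (simp add: free_pow_simps)
  next
    case (insert x A)
    then have "(\<lambda>b. h b k) \<in> A \<rightarrow> carrier R" "h x k \<in> carrier R" by (auto simp: car Pi_iff)
    then show ?case using insert by (simp add: free_pow_simps Pi_iff)
  qed
  have "lin_indep R (free_pow R n) (unit_vec R ` {..<n})"
    unfolding lin_indep_def
  proof (intro allI impI ballI)
    fix A c b
    assume A: "finite A \<and> A \<subseteq> unit_vec R ` {..<n} \<and> c \<in> A \<rightarrow> carrier R
      \<and> (\<Oplus>\<^bsub>free_pow R n\<^esub>b\<in>A. c b \<odot>\<^bsub>free_pow R n\<^esub> b) = \<zero>\<^bsub>free_pow R n\<^esub>" and b: "b \<in> A"
    then obtain j where j: "b = unit_vec R j" by blast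
    have cl: "(\<lambda>b. c b \<odot>\<^bsub>free_pow R n\<^esub> b) \<in> A \<rightarrow> carrier (free_pow R n)" by (intro funcsetI F.smult_closed) (use A sub in auto)
    have "\<zero>\<^bsub>R\<^esub> = (\<Oplus>\<^bsub>free_pow R n\<^esub>b\<in>A. c b \<odot>\<^bsub>free_pow R n\<^esub> b) j" using A by (simp add: free_pow_simps)
    also have "\<dots> = (\<Oplus>\<^bsub>R\<^esub>b\<in>A. (c b \<odot>\<^bsub>free_pow R n\<^esub> b) j)" using coord cl A by blast
    also have "\<dots> = (\<Oplus>\<^bsub>R\<^esub>a\<in>A. if b = a then c a else \<zero>\<^bsub>R\<^esub>)"
    proof (rule finsum_cong')
      fix a assume a: "a \<in> A"
      then obtain i where i: "a = unit_vec R i" using A by blast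
      have ca: "c a \<in> carrier R" using a A by auto
      show "(c a \<odot>\<^bsub>free_pow R n\<^esub> a) j = (if b = a then c a else \<zero>\<^bsub>R\<^esub>)"
      proof (cases "i = j")
        case True
        then show ?thesis using i j ca by (simp add: free_pow_simps unit_vec_def)
      next
        case False
        then have l: "(c a \<odot>\<^bsub>free_pow R n\<^esub> a) j = \<zero>\<^bsub>R\<^esub>"
          using i ca by (simp add: free_pow_simps unit_vec_def)
        \<comment> \<open>Unit vectors with different indices coincide only if one = zero, and then
          every coefficient vanishes.\<close>
        have "c a = \<zero>\<^bsub>R\<^esub>" if ba: "b = a"
        proof -
          have "b j = \<one>\<^bsub>R\<^esub>" "a j = \<zero>\<^bsub>R\<^esub>" using i j False by (simp_all add: unit_vec_def)
          then have "c a = c a \<otimes>\<^bsub>R\<^esub> \<zero>\<^bsub>R\<^esub>" using ba ca by (metis r_one)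
          then show ?thesis using ca by simp
        qed
        then show ?thesis using l by simp
      qed
    qed (use A in auto)
    also have "\<dots> = c b" using b A by (intro add.finprod_singleton) auto
    finally show "c b = \<zero>\<^bsub>R\<^esub>" by simp
  qed
  then show ?thesis using sub free_pow_generated[OF assms] unfolding free_mod_def by blast
qed

section \<open>Linear combinations and finite presentations\<close>

context module
begin

lemma lin_comb_closed:
  assumes "\<And>i. i < n \<Longrightarrow> g i \<in> carrier M" "\<And>i. i < n \<Longrightarrow> f i \<in> carrier R"
  shows "lin_comb M n g f \<in> carrier M"
  using assms by (induction n) auto

lemma lin_comb_mem:
  assumes "sub N" "\<And>i. i < n \<Longrightarrow> f i \<odot>\<^bsub>M\<^esub> g i \<in> N"
  shows "lin_comb M n g f \<in> N"
  using assms by (induction n) (auto intro: sub_add)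

lemma lin_comb_add:
  assumes "\<And>i. i < n \<Longrightarrow> g i \<in> carrier M" "\<And>i. i < n \<Longrightarrow> f i \<in> carrier R" "\<And>i. i < n \<Longrightarrow> f' i \<in> carrier R"
  shows "lin_comb M n g (\<lambda>i. f i \<oplus> f' i) = lin_comb M n g f \<oplus>\<^bsub>M\<^esub> lin_comb M n g f'"
  using assms
proof (induction n)
  case (Suc n)
  then have c: "lin_comb M n g f \<in> carrier M" "lin_comb M n g f' \<in> carrier M"
    by (auto intro!: lin_comb_closed)
  then show ?case using Suc by (simp add: smult_l_distr M.a_ac)
qed simp

lemma lin_comb_add_right:
  assumes "\<And>i. i < n \<Longrightarrow> g i \<in> carrier M" "\<And>i. i < n \<Longrightarrow> g' i \<in> carrier M" "\<And>i. i < n \<Longrightarrow> f i \<in> carrier R"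
  shows "lin_comb M n (\<lambda>i. g i \<oplus>\<^bsub>M\<^esub> g' i) f = lin_comb M n g f \<oplus>\<^bsub>M\<^esub> lin_comb M n g' f"
  using assms
proof (induction n)
  case (Suc n)
  then have c: "lin_comb M n g f \<in> carrier M" "lin_comb M n g' f \<in> carrier M"
    by (auto intro!: lin_comb_closed)
  then show ?case using Suc by (simp add: smult_r_distr M.a_ac)
qed simp

lemma lin_comb_smult:
  assumes "\<And>i. i < n \<Longrightarrow> g i \<in> carrier M" "\<And>i. i < n \<Longrightarrow> f i \<in> carrier R" "r \<in> carrier R"
  shows "lin_comb M n g (\<lambda>i. r \<otimes> f i) = r \<odot>\<^bsub>M\<^esub> lin_comb M n g f"
  using assms
proof (induction n)
  case (Suc n)
  then have c: "lin_comb M n g f \<in> carrier M" by (auto intro!: lin_comb_closed)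
  then show ?case using Suc by (simp add: smult_r_distr smult_assoc1)
qed simp

lemma lin_comb_cong:
  "(\<And>i. i < n \<Longrightarrow> g i = g' i) \<Longrightarrow> (\<And>i. i < n \<Longrightarrow> f i = f' i) \<Longrightarrow> lin_comb M n g f = lin_comb M n g' f'"
  by (induction n) auto

lemma lin_comb_delta:
  assumes "v \<in> carrier M" "\<And>i. i < n \<Longrightarrow> f i \<in> carrier R"
  shows "lin_comb M n (\<lambda>i. if i = l then v else \<zero>\<^bsub>M\<^esub>) f = (if l < n then f l \<odot>\<^bsub>M\<^esub> v else \<zero>\<^bsub>M\<^esub>)"
  using assms by (induction n) (auto simp: less_Suc_eq)

lemma lin_comb_unit_vec:
  assumes "\<And>i. i < n \<Longrightarrow> g i \<in> carrier M"
  shows "lin_comb M n g (unit_vec R l) = (if l < n then g l else \<zero>\<^bsub>M\<^esub>)"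
  using assms by (induction n) (auto simp: less_Suc_eq unit_vec_def)

lemma lin_comb_hom:
  assumes "\<And>i. i < n \<Longrightarrow> g i \<in> carrier M"
  shows "restrict (lin_comb M n g) (carrier (free_pow R n)) \<in> mod_homs R (free_pow R n) M"
  using assms
  by (intro mod_homs_restrictI free_pow_module R.is_cring)
     (auto simp: free_pow_carrier[OF R.is_cring] free_pow_simps lin_comb_closed lin_comb_add lin_comb_smult)

lemma hom_lin_comb:
  assumes "module R N" "\<phi> \<in> mod_homs R M N"
    "\<And>i. i < n \<Longrightarrow> g i \<in> carrier M" "\<And>i. i < n \<Longrightarrow> f i \<in> carrier R"
  shows "\<phi> (lin_comb M n g f) = lin_comb N n (\<lambda>i. \<phi> (g i)) f"
  using assms(3,4)
proof (induction n)
  case 0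
  then show ?case using mod_homs_zero[OF module_axioms assms(1,2)] by simp
next
  case (Suc n)
  then have "lin_comb M n g f \<in> carrier M" by (auto intro!: lin_comb_closed)
  then show ?case using Suc mod_homs_add[OF assms(2)] mod_homs_smult[OF assms(2)] by simp
qed

lemma lin_comb_image:
  assumes g: "\<And>i. i < n \<Longrightarrow> g i \<in> carrier M"
  shows "lin_comb M n g ` carrier (free_pow R n) = gen (g ` {..<n})"
proof
  note car = free_pow_carrier[OF R.is_cring]
  have gc: "g ` {..<n} \<subseteq> carrier M" using g by auto
  have s: "sub (gen (g ` {..<n}))" using gen_sub gc by blast
  show "lin_comb M n g ` carrier (free_pow R n) \<subseteq> gen (g ` {..<n})"
    using gen_incl[of "g ` {..<n}"] by (auto simp: car intro!: lin_comb_mem[OF s] sub_smult[OF s])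
  show "gen (g ` {..<n}) \<subseteq> lin_comb M n g ` carrier (free_pow R n)"
  proof (rule gen_least)
    show "sub (lin_comb M n g ` carrier (free_pow R n))"
    proof (rule subI)
      show "lin_comb M n g ` carrier (free_pow R n) \<subseteq> carrier M"
        using g by (auto simp: car intro!: lin_comb_closed)
      have "lin_comb M n g (\<lambda>i. \<zero>) = \<zero>\<^bsub>M\<^esub>" using lin_comb_mem[OF sub_trivial, of n "\<lambda>i. \<zero>" g] g by simp
      then show "\<zero>\<^bsub>M\<^esub> \<in> lin_comb M n g ` carrier (free_pow R n)"
        by (intro image_eqI[of _ _ "\<lambda>i. \<zero>"]) (auto simp: car)
    next
      fix a b assume "a \<in> lin_comb M n g ` carrier (free_pow R n)" "b \<in> lin_comb M n g ` carrier (free_pow R n)"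
      then obtain f f' where "f \<in> carrier (free_pow R n)" "f' \<in> carrier (free_pow R n)"
        "a = lin_comb M n g f" "b = lin_comb M n g f'" by blast
      then show "a \<oplus>\<^bsub>M\<^esub> b \<in> lin_comb M n g ` carrier (free_pow R n)"
        using g by (intro image_eqI[of _ _ "\<lambda>i. f i \<oplus> f' i"]) (auto simp: car lin_comb_add)
    next
      fix r a assume r: "r \<in> carrier R" and "a \<in> lin_comb M n g ` carrier (free_pow R n)"
      then obtain f where "f \<in> carrier (free_pow R n)" "a = lin_comb M n g f" by blast
      then show "r \<odot>\<^bsub>M\<^esub> a \<in> lin_comb M n g ` carrier (free_pow R n)"
        using g r by (intro image_eqI[of _ _ "\<lambda>i. r \<otimes> f i"]) (auto simp: car lin_comb_smult)
    qed
    show "g ` {..<n} \<subseteq> lin_comb M n g ` carrier (free_pow R n)"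
    proof
      fix y assume "y \<in> g ` {..<n}"
      then obtain l where "l < n" "y = g l" by auto
      then show "y \<in> lin_comb M n g ` carrier (free_pow R n)"
        using lin_comb_unit_vec[of n g l] g unit_vec_carrier[OF R.is_cring, of l n]
        by (intro image_eqI[of _ _ "unit_vec R l"]) auto
    qed
  qed
qed

lemma fg_cover:
  assumes "fg N"
  shows "\<exists>n. \<exists>\<phi> \<in> mod_homs R (free_pow R n) M. \<phi> ` carrier (free_pow R n) = N"
proof -
  obtain S where S: "finite S" "S \<subseteq> carrier M" "gen S = N" using assms fg_def by auto
  then obtain n :: nat and g where g: "S = g ` {i. i < n}" using finite_imp_nat_seg_image_inj_on by metis
  then have gc: "g i \<in> carrier M" if "i < n" for i using S that by auto
  have "restrict (lin_comb M n g) (carrier (free_pow R n)) ` carrier (free_pow R n) = N"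
    using lin_comb_image[of n g] gc S g by (simp add: lessThan_def)
  then show ?thesis using lin_comb_hom[of n g] gc by blast
qed

end

lemma free_pow_sub_fg:
  assumes "cring R" "noetherian_ring R" "submodule N R (free_pow R n)"
  shows "module.fg R (free_pow R n) N"
proof -
  interpret F: module R "free_pow R n" by (rule free_pow_module[OF assms(1)])
  show ?thesis
  proof (rule F.sub_of_gen_fg[OF assms(2) _ _ assms(3)])
    show "unit_vec R ` {..<n} \<subseteq> carrier (free_pow R n)" using unit_vec_carrier[OF assms(1)] by auto
    show "N \<subseteq> F.gen (unit_vec R ` {..<n})"
      using F.sub_subset[OF assms(3)] free_pow_generated[OF assms(1)] by blast
  qed simp
qed

text \<open>Guarantees that the choice operator in \<open>Ext_mod\<close> selects a genuine
  resolution.\<close>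

lemma free_resolution_exists:
  fixes R :: "('a, 'm) ring_scheme" and M :: "('a, 'b, 'n) module_scheme"
  assumes noeth: "noetherian_ring R" and M: "module R M" and fg: "fin_gen R M"
  shows "\<exists>(P :: nat \<Rightarrow> ('a, nat \<Rightarrow> 'a) module) d \<epsilon>. free_resolution R M P d \<epsilon>"
proof -
  interpret M: module R M by fact
  have cr: "cring R" by (rule M.R.is_cring)
  note Fm = free_pow_module[OF cr]
  obtain n0 \<epsilon> where \<epsilon>: "\<epsilon> \<in> mod_homs R (free_pow R n0) M" "\<epsilon> ` carrier (free_pow R n0) = carrier M"
    using M.fg_cover[of "carrier M"] fg unfolding M.fg_def fin_gen_def by auto
  let ?F = "\<lambda>s. free_pow R (fst s)"
  \<comment> \<open>X i consists of the rank of the i-th free module and of the submodule that the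
    next differential has to hit. Dependent choice iterates covering this submodule and passing to
    the kernel.\<close>
  have "\<exists>X. \<forall>i. (submodule (snd (X i)) R (?F (X i)) \<and> (i = 0 \<longrightarrow> X i = (n0, mod_ker (free_pow R n0) M \<epsilon>)))
    \<and> (\<exists>d\<in>mod_homs R (?F (X (Suc i))) (?F (X i)). d ` carrier (?F (X (Suc i))) = snd (X i)
          \<and> snd (X (Suc i)) = mod_ker (?F (X (Suc i))) (?F (X i)) d)"
  proof (rule dependent_nat_choice)
    show "\<exists>x. submodule (snd x) R (?F x) \<and> ((0::nat) = 0 \<longrightarrow> x = (n0, mod_ker (free_pow R n0) M \<epsilon>))"
      using submodule_ker[OF Fm M \<epsilon>(1)] by auto
  next
    fix x :: "nat \<times> (nat \<Rightarrow> 'a) set" and i :: nat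
    assume x: "submodule (snd x) R (?F x) \<and> (i = 0 \<longrightarrow> x = (n0, mod_ker (free_pow R n0) M \<epsilon>))"
    interpret F: module R "?F x" by (rule Fm)
    obtain n d where d: "d \<in> mod_homs R (free_pow R n) (?F x)" "d ` carrier (free_pow R n) = snd x"
      using F.fg_cover free_pow_sub_fg[OF cr noeth] x by blast
    then show "\<exists>y. (submodule (snd y) R (?F y) \<and> (Suc i = 0 \<longrightarrow> y = (n0, mod_ker (free_pow R n0) M \<epsilon>)))
      \<and> (\<exists>d\<in>mod_homs R (?F y) (?F x). d ` carrier (?F y) = snd x \<and> snd y = mod_ker (?F y) (?F x) d)"
      using submodule_ker[OF Fm Fm d(1)]
      by (intro exI[of _ "(n, mod_ker (free_pow R n) (?F x) d)"]) auto
  qed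
  then obtain X where X0: "X 0 = (n0, mod_ker (free_pow R n0) M \<epsilon>)"
    and ex: "\<forall>i. \<exists>d\<in>mod_homs R (?F (X (Suc i))) (?F (X i)). d ` carrier (?F (X (Suc i))) = snd (X i)
          \<and> snd (X (Suc i)) = mod_ker (?F (X (Suc i))) (?F (X i)) d" by auto
  obtain d where d: "\<And>i. d i \<in> mod_homs R (?F (X (Suc i))) (?F (X i))"
    "\<And>i. d i ` carrier (?F (X (Suc i))) = snd (X i)"
    "\<And>i. snd (X (Suc i)) = mod_ker (?F (X (Suc i))) (?F (X i)) (d i)"
  proof -
    have "\<forall>i. \<exists>d. d \<in> mod_homs R (?F (X (Suc i))) (?F (X i)) \<and> d ` carrier (?F (X (Suc i))) = snd (X i)
        \<and> snd (X (Suc i)) = mod_ker (?F (X (Suc i))) (?F (X i)) d"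
      using ex by blast
    from choice[OF this] that show ?thesis by blast
  qed
  have "free_resolution R M (\<lambda>i. ?F (X i)) d \<epsilon>"
    unfolding free_resolution_def using Fm free_pow_free[OF cr] d \<epsilon> X0 by auto
  then show ?thesis by blast
qed


section \<open>Lifting homomorphisms when Ext vanishes\<close>

text \<open>The resolution is existential because the one selected inside \<open>Ext_mod\<close> is
  known only to be some resolution of M. Vanishing of the quotient puts every cocycle among the
  coboundaries.\<close>

lemma Ext_vanishing:
  fixes R :: "('a, 'm) ring_scheme" and M :: "('a, 'b, 'n) module_scheme" and N :: "('a, 'c, 'o) module_scheme"
  assumes noeth: "noetherian_ring R" and M: "module R M" and fg: "fin_gen R M" and N: "module R N"
    and ext: "zero_mod (Ext_mod R 1 M N)"
  shows "\<exists>(P :: nat \<Rightarrow> ('a, nat \<Rightarrow> 'a) module) d \<epsilon>. free_resolution R M P d \<epsilon> \<and>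
    (\<forall>f\<in>cocycles R P d N 1. \<exists>g\<in>mod_homs R (P 0) N. \<forall>x\<in>carrier (P 1). f x = g (d 0 x))"
proof -
  interpret N: module R N by fact
  let ?res = "\<lambda>(P :: nat \<Rightarrow> ('a, nat \<Rightarrow> 'a) module, d). \<exists>\<epsilon>. free_resolution R M P d \<epsilon>"
  obtain P :: "nat \<Rightarrow> ('a, nat \<Rightarrow> 'a) module" and d where Pd: "(SOME z. ?res z) = (P, d)"
    by (cases "SOME z. ?res z") auto
  have "\<exists>z. ?res z" using free_resolution_exists[OF noeth M fg] by auto
  then have "?res (P, d)" using someI_ex[of ?res] Pd by metis
  then obtain \<epsilon> where res: "free_resolution R M P d \<epsilon>" by auto
  then have P: "module R (P i)" for i by (simp add: free_resolution_def)
  let ?H = "(Hom_mod R (P 1) N)\<lparr>carrier := cocycles R P d N 1\<rparr>" and ?B = "coboundaries R P d N 1"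
  let ?z = "\<lambda>x\<in>carrier (P 1). \<zero>\<^bsub>N\<^esub>"
  have z: "zero_mod (quot_mod ?H ?B)"
    using ext Pd by (simp add: Ext_mod_def Hom_cohomology_def)
  have zB: "?z \<in> ?B"
  proof -
    have "(\<lambda>x\<in>carrier (P 0). \<zero>\<^bsub>N\<^esub>) \<in> mod_homs R (P 0) N"
      by (rule mod_homs_restrictI[OF P]) auto
    moreover have "d 0 x \<in> carrier (P 0)" if "x \<in> carrier (P 1)" for x
      using res mod_homs_closed that by (fastforce simp: free_resolution_def)
    ultimately show ?thesis
      by (auto simp: coboundaries_def intro!: image_eqI[of _ _ "\<lambda>x\<in>carrier (P 0). \<zero>\<^bsub>N\<^esub>"] restrict_ext)
  qed
  have "\<exists>g\<in>mod_homs R (P 0) N. \<forall>x\<in>carrier (P 1). f x = g (d 0 x)" if f: "f \<in> cocycles R P d N 1" for f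
  proof -
    have "?B +>\<^bsub>?H\<^esub> f \<in> carrier (quot_mod ?H ?B)"
      using f by (auto simp: quot_mod_def A_RCOSETS_def')
    then have "?B +>\<^bsub>?H\<^esub> f = ?B" using z by (simp add: zero_mod_def quot_mod_def)
    \<comment> \<open>The coset of f consists of sums of a coboundary and f, so f appears in it as
      zero plus f.\<close>
    moreover have "?z \<oplus>\<^bsub>?H\<^esub> f \<in> ?B +>\<^bsub>?H\<^esub> f" using zB by (auto simp: a_r_coset_def')
    ultimately have "(\<lambda>x\<in>carrier (P 1). ?z x \<oplus>\<^bsub>N\<^esub> f x) \<in> ?B" by (simp add: Hom_mod_def)
    then obtain g where g: "g \<in> mod_homs R (P 0) N"
      "(\<lambda>x\<in>carrier (P 1). ?z x \<oplus>\<^bsub>N\<^esub> f x) = (\<lambda>x\<in>carrier (P 1). g (d 0 x))"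
      by (auto simp: coboundaries_def)
    have "f x = g (d 0 x)" if x: "x \<in> carrier (P 1)" for x
    proof -
      have "f x \<in> carrier N" using f x by (auto simp: cocycles_def mod_homs_closed)
      then show ?thesis using fun_cong[OF g(2), of x] x by simp
    qed
    then show ?thesis using g(1) by blast
  qed
  then show ?thesis using res by blast
qed

text \<open>Applying \<open>Hom(M, -)\<close> to \<open>0 \<rightarrow> M \<rightarrow> M \<rightarrow> M / x M \<rightarrow> 0\<close>, every homomorphism from \<open>M\<close> to \<open>M / x M\<close> lifts
  to an endomorphism of \<open>M\<close>. Here \<open>\<pi>\<close> presents \<open>M\<close> and \<open>\<psi>\<close> induces a homomorphism to \<open>M / x M\<close>.\<close>

lemma Ext_lifting:
  fixes R :: "('a, 'm) ring_scheme" and M :: "('a, 'b, 'n) module_scheme"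
    and F :: "('a, 'p, 'o) module_scheme"
  assumes noeth: "noetherian_ring R" and M: "module R M" and fg: "fin_gen R M"
    and ext: "zero_mod (Ext_mod R 1 M M)"
    and x: "x \<in> carrier R" "nonzerodivisor_on x M"
    and F: "module R F" and \<pi>: "\<pi> \<in> mod_homs R F M" "\<pi> ` carrier F = carrier M"
    and \<psi>: "\<psi> \<in> mod_homs R F M"
    and ker: "\<And>f. f \<in> carrier F \<Longrightarrow> \<pi> f = \<zero>\<^bsub>M\<^esub> \<Longrightarrow> \<exists>y\<in>carrier M. \<psi> f = x \<odot>\<^bsub>M\<^esub> y"
  obtains \<gamma> where "\<gamma> \<in> mod_homs R M M"
    "\<And>f. f \<in> carrier F \<Longrightarrow> \<exists>y\<in>carrier M. \<gamma> (\<pi> f) = \<psi> f \<oplus>\<^bsub>M\<^esub> x \<odot>\<^bsub>M\<^esub> y"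
proof -
  interpret M: module R M by fact
  interpret F: module R F by fact
  have xz: "y = \<zero>\<^bsub>M\<^esub>" if "y \<in> carrier M" "x \<odot>\<^bsub>M\<^esub> y = \<zero>\<^bsub>M\<^esub>" for y
    using x that unfolding nonzerodivisor_on_def by blast
  obtain P :: "nat \<Rightarrow> ('a, nat \<Rightarrow> 'a) module" and d \<epsilon> where res: "free_resolution R M P d \<epsilon>"
    and cob: "\<And>f. f \<in> cocycles R P d M 1 \<Longrightarrow>
      \<exists>g\<in>mod_homs R (P 0) M. \<forall>x\<in>carrier (P 1). f x = g (d 0 x)"
    using Ext_vanishing[OF noeth M fg M ext] by blast
  have P: "module R (P i)" "free_mod R (P i)" for i using res by (auto simp: free_resolution_def)
  have d: "d i \<in> mod_homs R (P (Suc i)) (P i)" for i using res by (auto simp: free_resolution_def)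
  have \<epsilon>: "\<epsilon> \<in> mod_homs R (P 0) M" "\<epsilon> ` carrier (P 0) = carrier M"
    and ex0: "d 0 ` carrier (P 1) = mod_ker (P 0) M \<epsilon>"
    and ex1: "d 1 ` carrier (P 2) = mod_ker (P 1) (P 0) (d 0)"
    using res by (auto simp: free_resolution_def numeral_2_eq_2)
  interpret P0: module R "P 0" by (rule P)
  interpret P1: module R "P 1" by (rule P)
  have d0: "d 0 \<in> mod_homs R (P 1) (P 0)" using d[of 0] by simp
  obtain B where B: "B \<subseteq> carrier (P 0)" "lin_indep R (P 0) B" "gen_submodule R (P 0) B = carrier (P 0)"
    using P(2)[of 0] unfolding free_mod_def by blast
  have "\<exists>f. f \<in> carrier F \<and> \<pi> f = \<epsilon> b" if b: "b \<in> B" for b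
  proof -
    have "\<epsilon> b \<in> \<pi> ` carrier F" using mod_homs_closed[OF \<epsilon>(1) subsetD[OF B(1) b]] \<pi>(2) by simp
    then show ?thesis by auto
  qed
  then obtain h where h: "\<And>b. b \<in> B \<Longrightarrow> h b \<in> carrier F \<and> \<pi> (h b) = \<epsilon> b" by metis
  \<comment> \<open>\<theta> lifts \<epsilon> through \<pi> and thereby compares the resolution
    behind \<open>Ext_mod\<close> with the given presentation F.\<close>
  obtain \<theta> where \<theta>: "\<theta> \<in> mod_homs R (P 0) F" "\<And>b. b \<in> B \<Longrightarrow> \<theta> b = h b"
  proof (rule free_universal[OF P(1) B F, of h])
    show "h \<in> B \<rightarrow> carrier F" using h by simp
  qed (rule that)
  have \<theta>c: "\<theta> p \<in> carrier F" if "p \<in> carrier (P 0)" for p using mod_homs_closed[OF \<theta>(1) that] .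
  have \<pi>\<theta>: "\<pi> (\<theta> p) = \<epsilon> p" if p: "p \<in> carrier (P 0)" for p
  proof -
    let ?E = "{q \<in> carrier (P 0). (\<lambda>q\<in>carrier (P 0). \<pi> (\<theta> q)) q = \<epsilon> q}"
    have "submodule ?E R (P 0)"
      by (rule submodule_equalizer[OF P(1) M mod_homs_comp[OF P(1) \<theta>(1) \<pi>(1)] \<epsilon>(1)])
    moreover have "B \<subseteq> ?E" using B(1) \<theta>(2) h by auto
    ultimately have "carrier (P 0) \<subseteq> ?E" using P0.gen_least B(3) by blast
    then show ?thesis using p by auto
  qed
  define \<rho> where "\<rho> = (\<lambda>p\<in>carrier (P 0). \<psi> (\<theta> p))"
  have \<rho>: "\<rho> \<in> mod_homs R (P 0) M" unfolding \<rho>_def by (rule mod_homs_comp[OF P(1) \<theta>(1) \<psi>])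
  have \<rho>c: "\<rho> p \<in> carrier M" if "p \<in> carrier (P 0)" for p using mod_homs_closed[OF \<rho> that] .
  have d0c: "d 0 p \<in> carrier (P 0)" if "p \<in> carrier (P 1)" for p using mod_homs_closed[OF d0 that] .
  note [simp del] = One_nat_def
  have div: "\<exists>y\<in>carrier M. \<rho> (d 0 p) = x \<odot>\<^bsub>M\<^esub> y" if p: "p \<in> carrier (P 1)" for p
  proof -
    have "d 0 p \<in> mod_ker (P 0) M \<epsilon>" using ex0 p by blast
    then have "\<pi> (\<theta> (d 0 p)) = \<zero>\<^bsub>M\<^esub>" using \<pi>\<theta> by (auto simp: mod_ker_def)
    then show ?thesis using ker[OF \<theta>c[OF d0c[OF p]]] d0c[OF p] by (simp add: \<rho>_def)
  qed
  \<comment> \<open>Dividing \<rho> after \<open>d 0\<close> by the nonzerodivisor x is the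
    connecting homomorphism: f represents the obstruction in Ext\<open>\<^sup>1\<close>(M, M) to
    lifting.\<close>
  obtain f where f: "f \<in> mod_homs R (P 1) M" "\<And>p. p \<in> carrier (P 1) \<Longrightarrow> \<rho> (d 0 p) = x \<odot>\<^bsub>M\<^esub> f p"
  proof (rule hom_of_graph[OF P(1)[of 1] M, of "\<lambda>p y. \<rho> (d 0 p) = x \<odot>\<^bsub>M\<^esub> y"])
    show "\<exists>y\<in>carrier M. \<rho> (d 0 p) = x \<odot>\<^bsub>M\<^esub> y" if "p \<in> carrier (P 1)" for p by (rule div[OF that])
  next
    fix p p' y y' assume "p \<in> carrier (P 1)" "p' \<in> carrier (P 1)" "y \<in> carrier M" "y' \<in> carrier M"
      "\<rho> (d 0 p) = x \<odot>\<^bsub>M\<^esub> y" "\<rho> (d 0 p') = x \<odot>\<^bsub>M\<^esub> y'"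
    then show "\<rho> (d 0 (p \<oplus>\<^bsub>P 1\<^esub> p')) = x \<odot>\<^bsub>M\<^esub> (y \<oplus>\<^bsub>M\<^esub> y')"
      using d0c x by (simp add: mod_homs_add[OF d0] mod_homs_add[OF \<rho>] M.smult_r_distr)
  next
    fix r p y assume "r \<in> carrier R" "p \<in> carrier (P 1)" "y \<in> carrier M" "\<rho> (d 0 p) = x \<odot>\<^bsub>M\<^esub> y"
    then show "\<rho> (d 0 (r \<odot>\<^bsub>P 1\<^esub> p)) = x \<odot>\<^bsub>M\<^esub> (r \<odot>\<^bsub>M\<^esub> y)"
      using d0c x M.R.m_comm[of r x]
      by (simp add: mod_homs_smult[OF d0] mod_homs_smult[OF \<rho>] M.smult_assoc1[symmetric])
  next
    fix y assume "y \<in> carrier M" "\<rho> (d 0 \<zero>\<^bsub>P 1\<^esub>) = x \<odot>\<^bsub>M\<^esub> y"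
    then show "y = \<zero>\<^bsub>M\<^esub>"
      using xz mod_homs_zero[OF P(1) P(1) d0] mod_homs_zero[OF P(1) M \<rho>] by simp
  qed blast
  have "f \<in> cocycles R P d M 1"
  proof -
    have "f (d 1 q) = \<zero>\<^bsub>M\<^esub>" if q: "q \<in> carrier (P 2)" for q
    proof -
      have "d 1 q \<in> mod_ker (P 1) (P 0) (d 0)" using ex1 q by blast
      then have k: "d 1 q \<in> carrier (P 1)" "d 0 (d 1 q) = \<zero>\<^bsub>P 0\<^esub>" by (auto simp: mod_ker_def)
      then have "x \<odot>\<^bsub>M\<^esub> f (d 1 q) = \<zero>\<^bsub>M\<^esub>"
        using f(2)[OF k(1)] mod_homs_zero[OF P(1) M \<rho>] by simp
      then show ?thesis using xz mod_homs_closed[OF f(1) k(1)] by blast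
    qed
    then show ?thesis using f(1) by (simp add: cocycles_def Suc_1)
  qed
  then obtain g where g: "g \<in> mod_homs R (P 0) M" "\<And>p. p \<in> carrier (P 1) \<Longrightarrow> f p = g (d 0 p)"
    using cob by blast
  have gc: "g p \<in> carrier M" if "p \<in> carrier (P 0)" for p using mod_homs_closed[OF g(1) that] .
  \<comment> \<open>Correcting \<rho> by x g makes it vanish on the kernel of \<epsilon>, so that it
    descends to M without changing modulo x M.\<close>
  define \<sigma> where "\<sigma> p = \<rho> p \<oplus>\<^bsub>M\<^esub> (\<ominus>\<^bsub>R\<^esub> x) \<odot>\<^bsub>M\<^esub> g p" for p
  have \<sigma>c: "\<sigma> p \<in> carrier M" if "p \<in> carrier (P 0)" for p
    using \<rho>c gc that x by (simp add: \<sigma>_def)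
  have \<sigma>_add: "\<sigma> (p \<oplus>\<^bsub>P 0\<^esub> q) = \<sigma> p \<oplus>\<^bsub>M\<^esub> \<sigma> q" if "p \<in> carrier (P 0)" "q \<in> carrier (P 0)" for p q
    using that \<rho>c gc x
    by (simp add: \<sigma>_def mod_homs_add[OF \<rho>] mod_homs_add[OF g(1)] M.smult_r_distr M.M.a_ac)
  have \<sigma>_smult: "\<sigma> (r \<odot>\<^bsub>P 0\<^esub> p) = r \<odot>\<^bsub>M\<^esub> \<sigma> p" if "r \<in> carrier R" "p \<in> carrier (P 0)" for r p
    using that \<rho>c gc x M.R.m_comm[of r "\<ominus>\<^bsub>R\<^esub> x"]
    by (simp add: \<sigma>_def mod_homs_smult[OF \<rho>] mod_homs_smult[OF g(1)] M.smult_r_distr M.smult_assoc1[symmetric])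
  have \<sigma>_ker: "\<sigma> p = \<zero>\<^bsub>M\<^esub>" if p: "p \<in> carrier (P 0)" "\<epsilon> p = \<zero>\<^bsub>M\<^esub>" for p
  proof -
    obtain q where q: "q \<in> carrier (P 1)" "p = d 0 q" using ex0 p by (auto simp: mod_ker_def)
    have "\<rho> p = x \<odot>\<^bsub>M\<^esub> g p" using f(2)[OF q(1)] g(2)[OF q(1)] q(2) by simp
    then show ?thesis using gc p x by (simp add: \<sigma>_def M.smult_l_minus M.M.r_neg)
  qed
  obtain \<gamma> where \<gamma>: "\<gamma> \<in> mod_homs R M M"
    "\<And>m. m \<in> carrier M \<Longrightarrow> \<exists>p\<in>carrier (P 0). \<epsilon> p = m \<and> \<sigma> p = \<gamma> m"
  proof (rule hom_of_graph[OF M M, of "\<lambda>m y. \<exists>p\<in>carrier (P 0). \<epsilon> p = m \<and> \<sigma> p = y"])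
    fix m assume "m \<in> carrier M"
    then have "m \<in> \<epsilon> ` carrier (P 0)" by (simp add: \<epsilon>(2))
    then obtain p where "p \<in> carrier (P 0)" "\<epsilon> p = m" by (auto elim: imageE)
    then show "\<exists>y\<in>carrier M. \<exists>p\<in>carrier (P 0). \<epsilon> p = m \<and> \<sigma> p = y"
      by (intro bexI[of _ "\<sigma> p"] bexI[of _ p] \<sigma>c) auto
  next
    fix m m' y y' assume "\<exists>p\<in>carrier (P 0). \<epsilon> p = m \<and> \<sigma> p = y" "\<exists>p\<in>carrier (P 0). \<epsilon> p = m' \<and> \<sigma> p = y'"
    then obtain p p' where "p \<in> carrier (P 0)" "\<epsilon> p = m" "\<sigma> p = y" "p' \<in> carrier (P 0)" "\<epsilon> p' = m'" "\<sigma> p' = y'"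
      by blast
    then show "\<exists>p\<in>carrier (P 0). \<epsilon> p = m \<oplus>\<^bsub>M\<^esub> m' \<and> \<sigma> p = y \<oplus>\<^bsub>M\<^esub> y'"
      using \<sigma>_add mod_homs_add[OF \<epsilon>(1)] by (intro bexI[of _ "p \<oplus>\<^bsub>P 0\<^esub> p'"]) auto
  next
    fix r m y assume r: "r \<in> carrier R" and "\<exists>p\<in>carrier (P 0). \<epsilon> p = m \<and> \<sigma> p = y"
    then obtain p where "p \<in> carrier (P 0)" "\<epsilon> p = m" "\<sigma> p = y" by blast
    then show "\<exists>p\<in>carrier (P 0). \<epsilon> p = r \<odot>\<^bsub>M\<^esub> m \<and> \<sigma> p = r \<odot>\<^bsub>M\<^esub> y"
      using r \<sigma>_smult mod_homs_smult[OF \<epsilon>(1)] by (intro bexI[of _ "r \<odot>\<^bsub>P 0\<^esub> p"]) auto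
  next
    fix y assume "\<exists>p\<in>carrier (P 0). \<epsilon> p = \<zero>\<^bsub>M\<^esub> \<and> \<sigma> p = y"
    then show "y = \<zero>\<^bsub>M\<^esub>" using \<sigma>_ker by blast
  qed blast
  show thesis
  proof (rule that[OF \<gamma>(1)])
    fix u assume u: "u \<in> carrier F"
    let ?n = "\<lambda>v. (\<ominus>\<^bsub>R\<^esub> \<one>\<^bsub>R\<^esub>) \<odot>\<^bsub>F\<^esub> v"
    have \<pi>u: "\<pi> u \<in> carrier M" "\<psi> u \<in> carrier M" using mod_homs_closed[OF \<pi>(1) u] mod_homs_closed[OF \<psi> u] by auto
    obtain p where p: "p \<in> carrier (P 0)" "\<epsilon> p = \<pi> u" "\<sigma> p = \<gamma> (\<pi> u)" using \<gamma>(2)[OF \<pi>u(1)] by blast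
    note \<theta>p = \<theta>c[OF p(1)]
    have \<psi>\<theta>: "\<psi> (\<theta> p) \<in> carrier M" using mod_homs_closed[OF \<psi> \<theta>p] .
    have neg: "(\<ominus>\<^bsub>R\<^esub> \<one>\<^bsub>R\<^esub>) \<odot>\<^bsub>M\<^esub> m = \<ominus>\<^bsub>M\<^esub> m" if "m \<in> carrier M" for m
      using that by (simp add: M.smult_l_minus)
    \<comment> \<open>u and \<theta> p lie over the same element of M, so by \<open>ker\<close>
      their images under \<psi> differ by a multiple of x.\<close>
    have "\<pi> (\<theta> p \<oplus>\<^bsub>F\<^esub> ?n u) = \<zero>\<^bsub>M\<^esub>"
      using \<pi>\<theta>[OF p(1)] p(2) \<theta>p u \<pi>u neg
      by (simp add: mod_homs_add[OF \<pi>(1)] mod_homs_smult[OF \<pi>(1)] M.M.r_neg)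
    then obtain y where y: "y \<in> carrier M" "\<psi> (\<theta> p \<oplus>\<^bsub>F\<^esub> ?n u) = x \<odot>\<^bsub>M\<^esub> y"
      using ker[of "\<theta> p \<oplus>\<^bsub>F\<^esub> ?n u"] \<theta>p u by auto
    then have "\<psi> (\<theta> p) \<oplus>\<^bsub>M\<^esub> \<ominus>\<^bsub>M\<^esub> \<psi> u = x \<odot>\<^bsub>M\<^esub> y"
      using \<theta>p u \<pi>u neg by (simp add: mod_homs_add[OF \<psi>] mod_homs_smult[OF \<psi>])
    then have "\<psi> (\<theta> p) = \<psi> u \<oplus>\<^bsub>M\<^esub> x \<odot>\<^bsub>M\<^esub> y"
      using \<psi>\<theta> \<pi>u x y by (metis M.M.a_comm M.M.add.inv_closed M.M.add.inv_solve_right M.smult_closed)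
    then have "\<gamma> (\<pi> u) = \<psi> u \<oplus>\<^bsub>M\<^esub> x \<odot>\<^bsub>M\<^esub> y \<oplus>\<^bsub>M\<^esub> (\<ominus>\<^bsub>R\<^esub> x) \<odot>\<^bsub>M\<^esub> g p"
      using p by (simp add: \<sigma>_def \<rho>_def)
    also have "\<dots> = \<psi> u \<oplus>\<^bsub>M\<^esub> x \<odot>\<^bsub>M\<^esub> (y \<oplus>\<^bsub>M\<^esub> \<ominus>\<^bsub>M\<^esub> g p)"
      using x y \<pi>u gc[OF p(1)]
      by (simp add: M.smult_r_distr M.smult_l_minus M.smult_r_minus M.M.a_assoc)
    finally show "\<exists>y\<in>carrier M. \<gamma> (\<pi> u) = \<psi> u \<oplus>\<^bsub>M\<^esub> x \<odot>\<^bsub>M\<^esub> y"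
      using y(1) gc[OF p(1)] by (intro bexI[of _ "y \<oplus>\<^bsub>M\<^esub> \<ominus>\<^bsub>M\<^esub> g p"]) auto
  qed
qed


section \<open>Freeness\<close>

lemma (in module) lin_comb_eq_finsum:
  assumes "\<And>i. i < n \<Longrightarrow> g i \<in> carrier M" "\<And>i. i < n \<Longrightarrow> f i \<in> carrier R"
  shows "lin_comb M n g f = (\<Oplus>\<^bsub>M\<^esub>i\<in>{..<n}. f i \<odot>\<^bsub>M\<^esub> g i)"
  using assms
proof (induction n)
  case (Suc n)
  have "(\<Oplus>\<^bsub>M\<^esub>i\<in>{..<n}. f i \<odot>\<^bsub>M\<^esub> g i) \<in> carrier M"
    using Suc.prems by (intro M.finsum_closed) auto
  then show ?case
    using Suc by (simp add: lessThan_Suc M.a_comm Pi_iff)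
qed simp

context lattice_module
begin

text \<open>A coefficient outside \<mm> is a unit, and then the relation expresses
  \<open>b l\<close> through the other generators, contradicting minimality.\<close>

lemma minimal_relation_coeff:
  assumes b: "\<And>i. i < n \<Longrightarrow> b i \<in> carrier M" and gb: "gen (b ` {..<n}) = carrier M"
    and n: "n = min_gens R M"
    and f: "f \<in> carrier (free_pow R n)" "lin_comb M n b f = \<zero>\<^bsub>M\<^esub>" and l: "l < n"
  shows "f l \<in> \<mm>"
proof (rule ccontr)
  assume "f l \<notin> \<mm>"
  have fc: "f i \<in> carrier R" for i using f(1) free_pow_carrier[OF R.is_cring] by blast
  then have u: "f l \<in> Units R" using mm_unit \<open>f l \<notin> \<mm>\<close> by blast
  let ?S = "b ` ({..<n} - {l})"
  have S: "?S \<subseteq> carrier M" using b by auto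
  then have s: "sub (gen ?S)" by (rule gen_sub)
  let ?f = "\<lambda>i. if i = l then \<zero> else f i"
  have "lin_comb M n b f = lin_comb M n b (\<lambda>i. ?f i \<oplus> f l \<otimes> unit_vec R l i)"
    using fc by (intro lin_comb_cong) (auto simp: unit_vec_def)
  also have "\<dots> = lin_comb M n b ?f \<oplus>\<^bsub>M\<^esub> lin_comb M n b (\<lambda>i. f l \<otimes> unit_vec R l i)"
    using b fc by (intro lin_comb_add) (auto simp: unit_vec_def)
  also have "lin_comb M n b (\<lambda>i. f l \<otimes> unit_vec R l i) = f l \<odot>\<^bsub>M\<^esub> lin_comb M n b (unit_vec R l)"
    using b fc by (intro lin_comb_smult) (auto simp: unit_vec_def)
  also have "lin_comb M n b (unit_vec R l) = b l"
    using lin_comb_unit_vec[of n b l] b l by simp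
  finally have "lin_comb M n b ?f \<oplus>\<^bsub>M\<^esub> f l \<odot>\<^bsub>M\<^esub> b l = \<zero>\<^bsub>M\<^esub>" using f(2) by metis
  then have "lin_comb M n b ?f \<oplus>\<^bsub>M\<^esub> f l \<odot>\<^bsub>M\<^esub> b l \<in> gen ?S" using sub_zero[OF s] by metis
  moreover have "lin_comb M n b ?f \<in> gen ?S"
  proof (rule lin_comb_mem[OF s])
    fix i assume i: "i < n"
    show "?f i \<odot>\<^bsub>M\<^esub> b i \<in> gen ?S"
    proof (cases "i = l")
      case True
      then show ?thesis using s b[OF i] by simp
    next
      case False
      then have "b i \<in> gen ?S" using gen_incl[of ?S] i by blast
      then show ?thesis using sub_smult[OF s] fc False by simp
    qed
  qed
  ultimately have "f l \<odot>\<^bsub>M\<^esub> b l \<in> gen ?S"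
    using sub_add_cancel[OF s] fc b[OF l] by blast
  then have bl: "b l \<in> gen ?S" using unit_smult_cancel[OF u s b[OF l]] by blast
  have "b ` {..<n} \<subseteq> gen ?S"
  proof
    fix y assume "y \<in> b ` {..<n}"
    then show "y \<in> gen ?S" using bl gen_incl[of ?S] by blast
  qed
  then have "gen ?S = carrier M" using gen_least[OF s] gb sub_subset[OF s] by blast
  then have "min_gens R M \<le> card ?S"
    unfolding min_gens_def using S by (intro Least_le exI[of _ ?S]) auto
  also have "\<dots> \<le> card ({..<n} - {l})" by (rule card_image_le) simp
  also have "\<dots> < n" using l by simp
  finally show False using n by simp
qed

text \<open>Let \<open>I\<close> be the ideal of coefficients of relations among minimal generators and \<open>\<mm> D = x M\<close>.
  Lifting the homomorphisms from \<open>M\<close> to \<open>D / x M\<close> that kill all but one generator gives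
  \<open>I D \<subseteq> I x M = \<mm> I D\<close>, whence \<open>I D = 0\<close> by Nakayama's lemma.\<close>

theorem free_of_nu_max:
  assumes fin: "fin_gen R M" and max: "nu (carrier M) = nu_max" and ext: "zero_mod (Ext_mod R 1 M M)"
  shows "free_mod R M"
proof (cases "carrier M = {\<zero>\<^bsub>M\<^esub>}")
  case True
  then show ?thesis
    unfolding free_mod_def lin_indep_def by (intro exI[of _ "{}"]) (auto simp: gen_empty)
next
  case False
  \<comment> \<open>This nonzero element is the final witness: \<open>f l\<close> x m = 0 will force
    \<open>f l\<close> to vanish.\<close>
  then obtain m where m: "m \<in> carrier M" "m \<noteq> \<zero>\<^bsub>M\<^esub>" using carrier_is_submodule sub_zero by blast
  define n where "n = min_gens R M"
  obtain S where S: "finite S" "card S = n" "S \<subseteq> carrier M" "gen S = carrier M"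
    using min_gens_eq_nu(3)[OF fin] n_def by blast
  obtain b where "bij_betw b {0..<n} S" using ex_bij_betw_nat_finite[OF S(1)] S(2) by blast
  then have inj: "inj_on b {..<n}" and bS: "b ` {..<n} = S"
    by (auto simp: bij_betw_def lessThan_atLeast0)
  have b: "b i \<in> carrier M" if "i < n" for i using that bS S(3) by blast
  have gb: "gen (b ` {..<n}) = carrier M" using bS S by simp
  let ?F = "free_pow R n" and ?lc = "lin_comb M n b"
  have F: "module R ?F" by (rule free_pow_module[OF R.is_cring])
  note car = free_pow_carrier[OF R.is_cring]
  let ?rel = "\<lambda>f. f \<in> carrier ?F \<and> ?lc f = \<zero>\<^bsub>M\<^esub>"
  have rel_mm: "f l \<in> \<mm>" if "?rel f" "l < n" for f l
    using minimal_relation_coeff[OF b gb n_def] that by blast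
  obtain x where x: "x \<in> \<mm>" "x \<noteq> \<zero>"
    "sprod \<mm> (colon \<mm> (scale x (carrier M))) = scale x (carrier M)"
    by (rule maximal_nu_divisible[OF max])
  have xc: "x \<in> carrier R" using x mm_carrier by blast
  let ?xM = "scale x (carrier M)"
  let ?D = "colon \<mm> ?xM"
  have sxM: "sub ?xM" using sub_scale xc carrier_is_submodule by blast
  have D: "sub ?D" "?xM \<subseteq> ?D" using sub_colon colon_upper mm_carrier sxM by auto
  \<comment> \<open>A set of coefficients spanning the ideal I; \<open>sprod\<close> accepts it
    without closure under sums.\<close>
  let ?I = "{f l | f l. ?rel f \<and> l < n}"
  have I: "?I \<subseteq> carrier R" using rel_mm mm_carrier by blast
  let ?T = "sprod \<mm> (sprod ?I ?D)"
  have T: "sub ?T" "sub (sprod ?I ?D)" using sub_mm sprod_sub'[OF I D(1)] by auto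
  have IT: "r \<odot>\<^bsub>M\<^esub> w \<in> ?T" if r: "r \<in> ?I" and w: "w \<in> ?xM" for r w
  proof -
    have rc: "r \<in> carrier R" using r I by blast
    \<comment> \<open>As x M = \<mm> D, it suffices to treat w = a d with a in \<mm> and d in D,
      where r a d = a r d.\<close>
    have "sprod \<mm> ?D \<subseteq> preim r (carrier M) ?T"
    proof (rule sprod_least[OF sub_preim[OF rc carrier_is_submodule T(1)]])
      fix a d assume a: "a \<in> \<mm>" and d: "d \<in> ?D"
      have ad: "a \<in> carrier R" "d \<in> carrier M" using a d mm_carrier sub_carrier[OF D(1)] by auto
      have "a \<odot>\<^bsub>M\<^esub> (r \<odot>\<^bsub>M\<^esub> d) \<in> ?T" using a sprod_memI[OF r d] by (rule sprod_memI)
      moreover have "a \<odot>\<^bsub>M\<^esub> (r \<odot>\<^bsub>M\<^esub> d) = r \<odot>\<^bsub>M\<^esub> (a \<odot>\<^bsub>M\<^esub> d)"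
        using ad rc R.m_comm[of a r] by (simp add: smult_assoc1[symmetric])
      ultimately show "a \<odot>\<^bsub>M\<^esub> d \<in> preim r (carrier M) ?T" using ad by (simp add: preim_def)
    qed
    then show ?thesis using w x(3) by (auto simp: preim_def)
  qed
  have key: "f l \<odot>\<^bsub>M\<^esub> v \<in> ?T" if f: "?rel f" and l: "l < n" and v: "v \<in> ?D" for f l v
  proof -
    have vc: "v \<in> carrier M" using v D sub_carrier by blast
    have fc: "f i \<in> carrier R" for i using f car by blast
    \<comment> \<open>The homomorphism sends the generator \<open>b l\<close> to v and the other
      generators to zero.\<close>
    let ?d = "\<lambda>i. if i = l then v else \<zero>\<^bsub>M\<^esub>"
    let ?\<pi> = "restrict ?lc (carrier ?F)" and ?\<psi> = "restrict (lin_comb M n ?d) (carrier ?F)"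
    have \<pi>: "?\<pi> \<in> mod_homs R ?F M" using b by (rule lin_comb_hom)
    have \<psi>: "?\<psi> \<in> mod_homs R ?F M" using vc by (intro lin_comb_hom) auto
    have \<pi>F: "?\<pi> ` carrier ?F = carrier M" using lin_comb_image[of n b] b gb by simp
    have delta: "lin_comb M n ?d g = g l \<odot>\<^bsub>M\<^esub> v" if "g \<in> carrier ?F" for g
      using lin_comb_delta[OF vc, of n g l] l that car by simp
    \<comment> \<open>It is well defined modulo x M: coefficients of relations lie in \<mm>, and
      \<mm> v \<subseteq> x M by the choice of D.\<close>
    have ker: "\<exists>y\<in>carrier M. ?\<psi> g = x \<odot>\<^bsub>M\<^esub> y" if g: "g \<in> carrier ?F" "?\<pi> g = \<zero>\<^bsub>M\<^esub>" for g
    proof -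
      have "g l \<in> \<mm>" using rel_mm[of g l] g l by simp
      then have "g l \<odot>\<^bsub>M\<^esub> v \<in> ?xM" using v by (simp add: colon_def)
      then show ?thesis using delta[OF g(1)] g(1) by (auto simp: scale_def)
    qed
    have nzd: "nonzerodivisor_on x M"
      unfolding nonzerodivisor_on_def using smult_eq_zero xc x(2) by blast
    obtain \<gamma> where \<gamma>: "\<gamma> \<in> mod_homs R M M"
      "\<And>g. g \<in> carrier ?F \<Longrightarrow> \<exists>y\<in>carrier M. \<gamma> (?\<pi> g) = ?\<psi> g \<oplus>\<^bsub>M\<^esub> x \<odot>\<^bsub>M\<^esub> y"
      using Ext_lifting[OF noeth module_axioms fin ext xc nzd F \<pi> \<pi>F \<psi> ker] by blast
    have "\<exists>y\<in>carrier M. \<gamma> (b i) = ?d i \<oplus>\<^bsub>M\<^esub> x \<odot>\<^bsub>M\<^esub> y" if i: "i < n" for i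
    proof -
      have ui: "unit_vec R i \<in> carrier ?F" using unit_vec_carrier[OF R.is_cring i] .
      have "?\<pi> (unit_vec R i) = b i" using lin_comb_unit_vec[of n b i] b i ui by simp
      moreover have "?\<psi> (unit_vec R i) = ?d i" using lin_comb_unit_vec[of n ?d i] vc i ui by simp
      ultimately show ?thesis using \<gamma>(2)[OF ui] by simp
    qed
    then obtain y where y: "\<And>i. i < n \<Longrightarrow> y i \<in> carrier M \<and> \<gamma> (b i) = ?d i \<oplus>\<^bsub>M\<^esub> x \<odot>\<^bsub>M\<^esub> y i" by metis
    \<comment> \<open>Applying the lift \<gamma> to the relation f isolates \<open>f l\<close> v up
      to terms in I x M.\<close>
    have "\<zero>\<^bsub>M\<^esub> = \<gamma> (?lc f)" using f mod_homs_zero[OF module_axioms module_axioms \<gamma>(1)] by simp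
    also have "\<dots> = lin_comb M n (\<lambda>i. \<gamma> (b i)) f"
      using b fc by (intro hom_lin_comb[OF module_axioms \<gamma>(1)]) auto
    also have "\<dots> = lin_comb M n (\<lambda>i. ?d i \<oplus>\<^bsub>M\<^esub> x \<odot>\<^bsub>M\<^esub> y i) f"
      using y by (intro lin_comb_cong) auto
    also have "\<dots> = lin_comb M n ?d f \<oplus>\<^bsub>M\<^esub> lin_comb M n (\<lambda>i. x \<odot>\<^bsub>M\<^esub> y i) f"
      using y xc vc fc by (intro lin_comb_add_right) auto
    finally have eq: "f l \<odot>\<^bsub>M\<^esub> v \<oplus>\<^bsub>M\<^esub> lin_comb M n (\<lambda>i. x \<odot>\<^bsub>M\<^esub> y i) f = \<zero>\<^bsub>M\<^esub>"
      using delta f by simp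
    have rest: "lin_comb M n (\<lambda>i. x \<odot>\<^bsub>M\<^esub> y i) f \<in> ?T"
    proof (rule lin_comb_mem[OF T(1)])
      fix i assume i: "i < n"
      then have "f i \<in> ?I" using f by blast
      moreover have "x \<odot>\<^bsub>M\<^esub> y i \<in> ?xM" using y[OF i] by (simp add: scale_def)
      ultimately show "f i \<odot>\<^bsub>M\<^esub> (x \<odot>\<^bsub>M\<^esub> y i) \<in> ?T" by (rule IT)
    qed
    have fv: "f l \<odot>\<^bsub>M\<^esub> v \<in> carrier M" using fc vc by simp
    show ?thesis
      using sub_add_cancel[OF T(1) rest fv] eq sub_zero[OF T(1)]
        M.a_comm[OF fv sub_carrier[OF T(1) rest]] by simp
  qed
  have "sprod ?I ?D \<subseteq> ?T"
  proof (rule sprod_least[OF T(1)])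
    fix r v assume "r \<in> ?I" "v \<in> ?D"
    then show "r \<odot>\<^bsub>M\<^esub> v \<in> ?T" using key by blast
  qed
  also have "\<dots> \<subseteq> {\<zero>\<^bsub>M\<^esub>} <+>\<^bsub>M\<^esub> ?T" by (rule set_add_upper2[OF sub_trivial T(1)])
  finally have ID: "sprod ?I ?D \<subseteq> {\<zero>\<^bsub>M\<^esub>}"
    by (rule nakayama[OF fg_carrier_imp_fg[OF fgM T(2)] sub_trivial])
  have rel_zero: "f l = \<zero>" if f: "?rel f" and l: "l < n" for f l
  proof (rule ccontr)
    assume nz: "f l \<noteq> \<zero>"
    have fl: "f l \<in> carrier R" using f car by blast
    have xm: "x \<odot>\<^bsub>M\<^esub> m \<in> ?D" using D(2) m by (auto simp: scale_def)
    have fI: "f l \<in> ?I" using f l by blast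
    have "f l \<odot>\<^bsub>M\<^esub> (x \<odot>\<^bsub>M\<^esub> m) = \<zero>\<^bsub>M\<^esub>" using subsetD[OF ID sprod_memI[OF fI xm]] by simp
    then have "x \<odot>\<^bsub>M\<^esub> m = \<zero>\<^bsub>M\<^esub>" using smult_eq_zero[OF fl _ _ nz] xc m by simp
    then show False using smult_eq_zero[OF xc m(1) _ x(2)] m(2) by blast
  qed
  have "lin_indep R M S"
    unfolding lin_indep_def
  proof (intro allI impI ballI)
    fix A c a
    assume A: "finite A \<and> A \<subseteq> S \<and> c \<in> A \<rightarrow> carrier R \<and> (\<Oplus>\<^bsub>M\<^esub>b\<in>A. c b \<odot>\<^bsub>M\<^esub> b) = \<zero>\<^bsub>M\<^esub>"
      and a: "a \<in> A"
    \<comment> \<open>Linear independence concerns arbitrary finite subsets of S; extending by zero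
      turns the combination into a relation among all n generators.\<close>
    let ?c = "\<lambda>s. if s \<in> A then c s else \<zero>"
    define f where "f i = (if i < n then ?c (b i) else \<zero>)" for i
    have cc: "?c s \<in> carrier R" for s using A by auto
    have fF: "f \<in> carrier ?F" using cc by (simp add: car f_def)
    have "?lc f = (\<Oplus>\<^bsub>M\<^esub>i\<in>{..<n}. f i \<odot>\<^bsub>M\<^esub> b i)"
      using b fF car by (intro lin_comb_eq_finsum) auto
    also have "\<dots> = (\<Oplus>\<^bsub>M\<^esub>i\<in>{..<n}. ?c (b i) \<odot>\<^bsub>M\<^esub> b i)"
      by (intro M.finsum_cong' refl funcsetI smult_closed cc b) (simp_all add: f_def)
    also have "\<dots> = (\<Oplus>\<^bsub>M\<^esub>s\<in>b ` {..<n}. ?c s \<odot>\<^bsub>M\<^esub> s)"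
      using cc b by (intro M.finsum_reindex[symmetric] inj funcsetI smult_closed) auto
    also have "\<dots> = \<zero>\<^bsub>M\<^esub>"
      using finsum_extend[of S A c "\<lambda>s. s"] S A by (auto simp: bS)
    finally have rel: "?rel f" using fF by simp
    obtain i where i: "i < n" "a = b i" using a A bS by blast
    then show "c a = \<zero>" using rel_zero[OF rel i(1)] a by (simp add: f_def)
  qed
  then show ?thesis unfolding free_mod_def using S by blast
qed

end

theorem corollary5p7:
  fixes R :: "('a, 'm) ring_scheme" and M :: "('a, 'b, 'n) module_scheme"
  assumes "gorenstein_local R" and "domain R" and "krull_dim R = 1"
    and "module R M" and "fin_gen R M" and "torsionfree R M"
    and "zero_mod (Ext_mod R 1 M M)"
    and "ulrich R M"
  shows "free_mod R M"
proof -
  have local: "noetherian_local R" using assms(1) by (simp add: gorenstein_local_def)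
  note mult = multiplicity_eq_nu_max[OF local assms(2-6)]
  interpret lattice_module R M "max_ideal R" by (rule mult(1))
  have "real (nu (carrier M)) = real nu_max"
    using assms(8) mult(2) min_gens_eq_nu(1)[OF assms(5)] by (simp add: ulrich_def)
  then show ?thesis using free_of_nu_max assms by simp
qed

end
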